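(* A spherical or hyperbolic ellipsoid $E$ charged with a homeoidal density creates an electrostatic force field that vanishes inside $E$ (and inside $-E$, in the spherical case) and has the confocal ellipsoids $E_\lambda$ (and $-E_\lambda$, in the spherical case) as equipotential surfaces.
   Context: Potential. In $\mathbb{S}^n\subset\mathbb{R}^{n+1}$ (unit sphere), respectively $\mathbb{H}^n=\{-x_0^2+x_1^2+\dots+x_n^2=-1,\ x_0>0\}$, a unit point charge creates at distance $r$ the potential $u(r)=\int_r^{\pi/2}\frac{dx}{\sin^{n-1}x}$, respectively $u(r)=\int_r^{\infty}\frac{dx}{\sinh^{n-1}x}$; the potential of a charged hypersurface is the integral of $u$ against the charge, and the force field is (up to sign) its gradient. Ellipsoids. Let $q$ be a quadratic form of signature $(-,+,\dots,+)$ on $\mathbb{R}^{n+1}$ with zero cone $C=\{q=0\}$. In the spherical case $C\cap\mathbb{S}^n=E\cup -E$ has two antipodal components, each called a spherical ellipsoid. In the hyperbolic case $C$ is assumed to be contained in the light cone $\{-x_0^2+x_1^2+\dots+x_n^2<0\}$ (apart from the origin), and $E=C\cap\mathbb{H}^n$ is called a hyperbolic ellipsoid. The inside of $E$ is the region bounded by $E$ on which $q<0$ (in the spherical case, the component whose boundary is $E$). Normal form and confocal ellipsoids. In a suitable orthonormal basis (orthonormal for the Minkowski product $-x_0^2+x_1^2+\cdots+x_n^2$ in the hyperbolic case), $q(x)=\frac{x_1^2}{a_1}+\dots+\frac{x_n^2}{a_n}-\frac{x_0^2}{b}$ with $a_i,b>0$ (and $a_i<b$ for all $i$ in the hyperbolic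 case) and $E$ lies in $\{x_0>0\}$; the $a_i$ are assumed distinct and ordered $a_1>\dots>a_n>0$. Put, in the spherical case, $$q_\lambda(x)=\frac{x_1^2}{a_1-\lambda}+\dots+\frac{x_n^2}{a_n-\lambda}-\frac{x_0^2}{b+\lambda},\quad -b<\lambda<a_n,\qquad E_\lambda=q_\lambda^{-1}(0)\cap\mathbb{S}^n\cap\{x_0>0\},$$ and, in the hyperbolic case, $$q_\lambda(x)=\frac{x_1^2}{a_1-\lambda}+\dots+\frac{x_n^2}{a_n-\lambda}-\frac{x_0^2}{b-\lambda},\quad \lambda<a_n,\qquad E_\lambda=q_\lambda^{-1}(0)\cap\mathbb{H}^n.$$ These $E_\lambda$ are the ellipsoids confocal to $E=E_0$. Homeoidal density. It is the charge density on $E$ (with respect to the Riemannian volume of $E$) obtained as the renormalized limit of the thickness of the shells $\{\epsilon_1\le q\le\epsilon_2\}$ around $E$ as they become infinitely thin; explicitly, it is a constant multiple of $1/\|\mathrm{grad}\,q\|$ in the spherical case, and of $1/\|\mathrm{grad}\,q\|_{n,1}$ (Minkowski norm of the Minkowski gradient) in the hyperbolic case. *)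

theory Defs
  imports "HOL-Analysis.Analysis"
begin

text \<open>
  Points of $R^{n+1}$ are pairs \<open>(x\<^sub>0, (x\<^sub>1, \<dots>, x\<^sub>n))\<close> with \<open>n = CARD('n)\<close>. The library's inner
  product on the product type is the Euclidean one, so \<open>sphere 0 1\<close> is the unit sphere $S^n$.
\<close>

type_synonym 'n space = "real \<times> (real ^ 'n)"

definition mink :: "'n::finite space \<Rightarrow> 'n space \<Rightarrow> real" where
  "mink x y = snd x \<bullet> snd y - fst x * fst y"

definition hyperboloid :: "'n::finite space set" where
  "hyperboloid = {x. mink x x = - 1 \<and> fst x > 0}"

text \<open>
  Below, \<open>g\<close> is the ambient bilinear form: the inner product for the sphere, \<open>mink\<close> for the
  hyperboloid. In both cases \<open>g\<close> restricts to the Riemannian metric of \<open>M\<close>, and the tangent space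
  of \<open>M\<close> at \<open>x\<close> is \<open>{w. g x w = 0}\<close>.
\<close>

definition gram_density ::
  "('v::real_normed_vector \<Rightarrow> 'v \<Rightarrow> real) \<Rightarrow> ((real ^ 'k::finite) \<Rightarrow>\<^sub>L 'v) \<Rightarrow> real" where
  "gram_density g A =
     sqrt (det (\<chi> i j. g (blinfun_apply A (axis i 1)) (blinfun_apply A (axis j 1))))"

text \<open>
  \<open>\<mu>\<close> is the Riemannian volume of the \<open>k\<close>-dimensional submanifold \<open>E\<close>, \<open>k = CARD('k)\<close>: a Borel
  measure carried by \<open>E\<close> which in every regular \<open>C\<^sup>1\<close> parametrization \<open>\<phi>\<close> of a part of \<open>E\<close> has the
  density $\sqrt{\det (g(\partial_i \phi, \partial_j \phi))}$. As countably many parametrized parts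
  cover \<open>E\<close>, this determines \<open>\<mu>\<close>.
\<close>

definition riemannian_volume ::
  "'k::finite itself \<Rightarrow> ('v::euclidean_space \<Rightarrow> 'v \<Rightarrow> real) \<Rightarrow> 'v set \<Rightarrow> 'v measure \<Rightarrow> bool" where
  "riemannian_volume _ g E \<mu> \<longleftrightarrow>
     sets \<mu> = sets borel \<and> emeasure \<mu> (- E) = 0 \<and>
     (\<forall>(U :: (real ^ 'k) set) (\<phi> :: real ^ 'k \<Rightarrow> 'v) (\<phi>' :: real ^ 'k \<Rightarrow> (real ^ 'k) \<Rightarrow>\<^sub>L 'v) B.
        open U \<and> inj_on \<phi> U \<and> \<phi> ` U \<subseteq> E \<and> continuous_on U \<phi>' \<and>
        (\<forall>s\<in>U. (\<phi> has_derivative blinfun_apply (\<phi>' s)) (at s) \<and> inj (blinfun_apply (\<phi>' s))) \<and>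
        B \<in> sets borel \<and> B \<subseteq> \<phi> ` U \<longrightarrow>
          emeasure \<mu> B =
            (\<integral>\<^sup>+s\<in>U. ennreal (gram_density g (\<phi>' s)) * indicator B (\<phi> s) \<partial>lborel))"

definition metric_gradient ::
  "('v::real_normed_vector \<Rightarrow> 'v \<Rightarrow> real) \<Rightarrow> ('v \<Rightarrow> real) \<Rightarrow> 'v \<Rightarrow> 'v" where
  "metric_gradient g f x = (THE v. \<forall>w. frechet_derivative f (at x) w = g v w)"

text \<open>
  The force at \<open>x \<in> M\<close> is minus the Riemannian gradient in \<open>M\<close> of the potential \<open>f\<close>. The derivative
  within \<open>M\<close> only sees tangent directions, so the tangent vector \<open>F\<close> is unique.
\<close>

definition force_at ::
  "('v::real_normed_vector \<Rightarrow> 'v \<Rightarrow> real) \<Rightarrow> 'v set \<Rightarrow> ('v \<Rightarrow> real) \<Rightarrow> 'v \<Rightarrow> 'v \<Rightarrow> bool" where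
  "force_at g M f x F \<longleftrightarrow> g x F = 0 \<and> (f has_derivative (\<lambda>w. - g F w)) (at x within M)"

text \<open>
  The integrals are oriented: the spherical potential is negative for \<open>r > pi / 2\<close>. At \<open>r = 0\<close>
  (and at \<open>r = pi\<close> on the sphere) the integral diverges and the library assigns it the value 0;
  this concerns a single source point, which carries no charge.
\<close>

definition spherical_u :: "nat \<Rightarrow> real \<Rightarrow> real" where
  "spherical_u n r = (LBINT t=ereal r..ereal (pi / 2). 1 / sin t ^ (n - 1))"

definition hyperbolic_u :: "nat \<Rightarrow> real \<Rightarrow> real" where
  "hyperbolic_u n r = (LBINT t=ereal r..\<infinity>. 1 / sinh t ^ (n - 1))"

text \<open>Here \<open>arccos (x \<bullet> y)\<close> and \<open>arcosh (- mink x y)\<close> are the geodesic distances.\<close>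

definition spherical_point_potential :: "'n::finite space \<Rightarrow> 'n space \<Rightarrow> real" where
  "spherical_point_potential x y = spherical_u CARD('n) (arccos (x \<bullet> y))"

definition hyperbolic_point_potential :: "'n::finite space \<Rightarrow> 'n space \<Rightarrow> real" where
  "hyperbolic_point_potential x y = hyperbolic_u CARD('n) (arcosh (- mink x y))"

definition potential_exists ::
  "('v \<Rightarrow> 'v \<Rightarrow> real) \<Rightarrow> 'v measure \<Rightarrow> 'v set \<Rightarrow> ('v \<Rightarrow> real) \<Rightarrow> 'v \<Rightarrow> bool" where
  "potential_exists p vol E \<rho> x \<longleftrightarrow> set_integrable vol E (\<lambda>y. \<rho> y * p x y)"

definition potential ::
  "('v \<Rightarrow> 'v \<Rightarrow> real) \<Rightarrow> 'v measure \<Rightarrow> 'v set \<Rightarrow> ('v \<Rightarrow> real) \<Rightarrow> 'v \<Rightarrow> real" where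
  "potential p vol E \<rho> x = (LINT y:E|vol. \<rho> y * p x y)"

definition force_vanishes_on ::
  "('v::real_normed_vector \<Rightarrow> 'v \<Rightarrow> real) \<Rightarrow> 'v set \<Rightarrow> ('v \<Rightarrow> 'v \<Rightarrow> real) \<Rightarrow>
   'v measure \<Rightarrow> 'v set \<Rightarrow> ('v \<Rightarrow> real) \<Rightarrow> 'v set \<Rightarrow> bool" where
  "force_vanishes_on g M p vol E \<rho> S \<longleftrightarrow>
     (\<forall>x\<in>S. potential_exists p vol E \<rho> x \<and> force_at g M (potential p vol E \<rho>) x 0)"

definition equipotential ::
  "('v \<Rightarrow> 'v \<Rightarrow> real) \<Rightarrow> 'v measure \<Rightarrow> 'v set \<Rightarrow> ('v \<Rightarrow> real) \<Rightarrow> 'v set \<Rightarrow> bool" where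
  "equipotential p vol E \<rho> S \<longleftrightarrow>
     (\<exists>c. \<forall>x\<in>S. potential_exists p vol E \<rho> x \<and> potential p vol E \<rho> x = c)"

text \<open>Quadratic forms of signature $(-,+,\dots,+)$.\<close>

definition lorentzian_form :: "('n::finite space \<Rightarrow> real) \<Rightarrow> bool" where
  "lorentzian_form q \<longleftrightarrow>
     (\<exists>L :: 'n space \<Rightarrow> 'n space. linear L \<and> bij L \<and> (\<forall>x. q x = mink (L x) (L x)))"

definition spherical_ellipsoid :: "('n::finite space \<Rightarrow> real) \<Rightarrow> 'n space set \<Rightarrow> bool" where
  "spherical_ellipsoid q E \<longleftrightarrow>
     lorentzian_form q \<and> E \<in> components {x \<in> sphere 0 1. q x = 0}"

definition hyperbolic_ellipsoid :: "('n::finite space \<Rightarrow> real) \<Rightarrow> 'n space set \<Rightarrow> bool" where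
  "hyperbolic_ellipsoid q E \<longleftrightarrow>
     lorentzian_form q \<and> (\<forall>x. q x = 0 \<and> x \<noteq> 0 \<longrightarrow> mink x x < 0) \<and>
     E = {x \<in> hyperboloid. q x = 0}"

definition inside_region :: "'v::topological_space set \<Rightarrow> ('v \<Rightarrow> real) \<Rightarrow> 'v set \<Rightarrow> 'v set" where
  "inside_region M q E =
     \<Union> {R \<in> components {x \<in> M. q x < 0}. (top_of_set M) frontier_of R = E}"

text \<open>
  An orthonormal basis for \<open>g\<close> is given by the linear isometry \<open>T\<close> which sends a point to its
  coordinates \<open>(x\<^sub>0, (x\<^sub>1, \<dots>, x\<^sub>n))\<close> in that basis.
\<close>

definition orthonormal_coordinates ::
  "('n::finite space \<Rightarrow> 'n space \<Rightarrow> real) \<Rightarrow> ('n space \<Rightarrow> 'n space) \<Rightarrow> bool" where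
  "orthonormal_coordinates g T \<longleftrightarrow> linear T \<and> (\<forall>x y. g (T x) (T y) = g x y)"

definition spherical_form :: "('n::finite \<Rightarrow> real) \<Rightarrow> real \<Rightarrow> real \<Rightarrow> 'n space \<Rightarrow> real" where
  "spherical_form a b l x = (\<Sum>i\<in>UNIV. (snd x $ i)\<^sup>2 / (a i - l)) - (fst x)\<^sup>2 / (b + l)"

definition hyperbolic_form :: "('n::finite \<Rightarrow> real) \<Rightarrow> real \<Rightarrow> real \<Rightarrow> 'n space \<Rightarrow> real" where
  "hyperbolic_form a b l x = (\<Sum>i\<in>UNIV. (snd x $ i)\<^sup>2 / (a i - l)) - (fst x)\<^sup>2 / (b - l)"

definition spherical_confocal ::
  "('n::finite space \<Rightarrow> 'n space) \<Rightarrow> ('n \<Rightarrow> real) \<Rightarrow> real \<Rightarrow> real \<Rightarrow> 'n space set" where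
  "spherical_confocal T a b l =
     {x \<in> sphere 0 1. spherical_form a b l (T x) = 0 \<and> fst (T x) > 0}"

definition hyperbolic_confocal ::
  "('n::finite space \<Rightarrow> 'n space) \<Rightarrow> ('n \<Rightarrow> real) \<Rightarrow> real \<Rightarrow> real \<Rightarrow> 'n space set" where
  "hyperbolic_confocal T a b l = {x \<in> hyperboloid. hyperbolic_form a b l (T x) = 0}"

text \<open>
  To first order the shell \<open>{\<epsilon>\<^sub>1 \<le> q \<le> \<epsilon>\<^sub>2}\<close> has at \<open>y \<in> E\<close> the thickness \<open>\<epsilon>\<^sub>2 - \<epsilon>\<^sub>1\<close> divided by the norm
  of the gradient of \<open>q\<close>. Since \<open>q\<close> is homogeneous and vanishes on \<open>E\<close>, its ambient gradient at
  points of \<open>E\<close> is tangent to the sphere or hyperboloid, hence is also the gradient there.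
\<close>

definition homeoidal_density ::
  "('v::real_normed_vector \<Rightarrow> 'v \<Rightarrow> real) \<Rightarrow> ('v \<Rightarrow> real) \<Rightarrow> 'v set \<Rightarrow> ('v \<Rightarrow> real) \<Rightarrow> bool" where
  "homeoidal_density g q E \<rho> \<longleftrightarrow>
     (\<exists>c. \<forall>y\<in>E. \<rho> y = c / sqrt (g (metric_gradient g q y) (metric_gradient g q y)))"

end

theory Submission
  imports Defs
begin

text \<open>
  Put \<open>e = 1\<close> on the sphere, \<open>e = -1\<close> on the hyperboloid, and let \<open>g\<close> be the ambient form. The map
  \<open>L = diag (sqrt b, sqrt a\<^sub>1, \<dots>, sqrt a\<^sub>n)\<close> carries the light cone onto the cone \<open>q = 0\<close>, so the
  stereographic parametrization \<open>X s\<close> of the light cone gives, with \<open>Z = L X\<close> and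
  \<open>|z| = sqrt (e g z z)\<close>, the chart \<open>Z / |Z|\<close> of the ellipsoid minus one point. In this chart the
  Riemannian volume times the homeoidal density is a constant multiple of \<open>|Z s|\<^sup>-\<^sup>k ds\<close>: the gradient of
  \<open>q\<close> cancels against the Gram determinant. The potential at \<open>p\<close> thus becomes
  \<open>\<Phi> p = \<integral> |Z|\<^sup>-\<^sup>k K (g p Z / (|p| |Z|)) ds\<close> with \<open>K' \<sigma> = (e (1 - \<sigma>\<^sup>2))\<^sup>-\<^sup>n\<^sup>/\<^sup>2\<close> in both geometries.

  Inside, Newton's argument applies: the integrand of the derivative of \<open>\<Phi>\<close> at \<open>p\<close> changes sign under
  the involution that exchanges the two points of the cone on each chord through \<open>p\<close>, and this
  involution is an inversion in the coordinate \<open>s\<close>. So \<open>\<Phi>\<close> is constant inside, and by dominated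
  convergence also on the ellipsoid. For the confocal ellipsoids, Ivory's symmetry
  \<open>g (L\<^sub>l x) (L y) = g (L x) (L\<^sub>l y)\<close>, together with \<open>|L\<^sub>l x| = |L x|\<close> for lightlike \<open>x\<close>, identifies the
  potential of \<open>E\<close> at \<open>L\<^sub>l y\<close> with that of \<open>E\<^sub>l\<close> at \<open>L y\<close>; for \<open>l > 0\<close> the point \<open>L\<^sub>l y\<close> is inside \<open>E\<close>,
  for \<open>l < 0\<close> the point \<open>L y\<close> is inside \<open>E\<^sub>l\<close>.
\<close>

section \<open>Determinants of low-rank updates\<close>

text \<open>The exponent of \<open>K'\<close> is forced by Coulomb's law: up to sign,
  \<open>u' r\<close> is the power \<open>1 - n\<close> of \<open>sin r\<close> or
  \<open>sinh r\<close>, and passing from the distance to the ambient product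
  \<open>\<sigma>\<close> costs one more such factor. This exponent is what makes Newton's argument
  close. Modulo \<open>p\<close>, the other end of the chord of \<open>Z\<close> through
  \<open>p\<close> is \<open>- (1 / r)\<close> times \<open>Z\<close>. The derivative integrand is
  linear in \<open>Z\<close> modulo \<open>p\<close>, times the power \<open>- n / 2\<close> of an
  expression quadratic in \<open>Z\<close> modulo \<open>p\<close>; so it picks up the factor
  \<open>- r ^ (n - 1)\<close>, up to sign the inverse Jacobian of the inversion in dimension
  \<open>k = n - 1\<close>.

  Normalizing \<open>p\<close> inside the kernel makes the potential homogeneous of degree 0, so it
  is studied on the open convex cone of interior vectors, along straight segments, instead of on the
  curved space.

  Points of the ellipsoid itself are the delicate case: the integrand then has a pole, and a
  majorant uniform along a segment ending at that point is required. Moreover the volume is given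
  only by its values on parametrizations, so the single point that the chart misses has to be shown
  to carry no mass.\<close>

lemma det_rows_replaced_by_rank_one:
  fixes u v :: "real ^ 'n::finite"
  assumes "finite S"
  shows "det (\<chi> i. if i \<in> S then axis i 1 + u $ i *s v else axis i 1) = 1 + (\<Sum>i\<in>S. u $ i * v $ i)"
  using assms
proof (induction S)
  case empty
  have "(\<chi> i. axis i 1) = (mat 1 :: real ^ 'n ^ 'n)"
    by (auto simp: vec_eq_iff mat_def axis_def)
  then show ?case by simp
next
  case (insert k S)
  let ?c = "\<lambda>i. if i \<in> S then axis i 1 + u $ i *s v else axis i (1::real)"
  have "det (\<chi> i. if i \<in> insert k S then axis i 1 + u $ i *s v else axis i 1)
      = det (\<chi> i. if i = k then axis k 1 + u $ k *s v else ?c i)"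
    by (rule arg_cong[where f=det]) (auto simp: vec_eq_iff)
  also have "\<dots> = det (\<chi> i. if i = k then axis k 1 else ?c i) + det (\<chi> i. if i = k then u $ k *s v else ?c i)"
    by (rule det_row_add)
  also have "det (\<chi> i. if i = k then axis k 1 else ?c i) = det (\<chi> i. ?c i)"
    by (rule arg_cong[where f=det]) (use insert in \<open>auto simp: vec_eq_iff\<close>)
  also have "det (\<chi> i. if i = k then u $ k *s v else ?c i) = u $ k * det (\<chi> i. if i = k then v else ?c i)"
    by (rule det_row_mul)
  \<comment> \<open>Once row \<open>k\<close> is \<open>v\<close>, row operations remove the
    multiples of \<open>v\<close> from the rows in \<open>S\<close>; what remains is the identity
    matrix with one row replaced by \<open>v\<close>.\<close>
  also have "det (\<chi> i. if i = k then v else ?c i) = v $ k"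
  proof -
    have "det (\<chi> i. if i = k then v else if i \<in> S then axis i 1 + u $ i *s v else axis i 1)
        = det (\<chi> i. if i = k then v else axis i 1)"
      using insert.hyps
    proof (induction S)
      case empty
      then show ?case by (simp cong: if_cong)
    next
      case (insert j S')
      let ?B = "\<chi> i. if i = k then v else if i \<in> insert j S' then axis i 1 + u $ i *s v else axis i (1::real)"
      let ?A = "\<chi> i. if i = k then v else if i \<in> S' then axis i 1 + u $ i *s v else axis i (1::real)"
      from insert have jk: "j \<noteq> k" "k \<notin> S'" "j \<notin> S'" by auto
      have "?B = (\<chi> i. if i = j then row j ?A + u $ j *s row k ?A else row i ?A)"
        using jk by (auto simp: vec_eq_iff row_def)
      then have "det ?B = det ?A"
        using det_row_operation[where i=j and j=k and c="u $ j" and A="?A"] jk by (simp add: )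
      then show ?case using insert.IH jk insert.hyps by auto
    qed
    also have "\<dots> = v $ k"
    proof -
      have "(\<chi> i. if i = k then v else axis i 1) = (\<chi> i. if i = k then (\<Sum>j\<in>UNIV. v $ j *s axis j 1) else axis i (1::real))"
        by (simp add: basis_expansion cong: if_cong)
      also have "det \<dots> = (\<Sum>j\<in>UNIV. det (\<chi> i. if i = k then v $ j *s axis j 1 else axis i (1::real)))"
        by (rule det_linear_row_sum) simp
      also have "\<dots> = (\<Sum>j\<in>UNIV. if j = k then v $ k else 0)"
      proof (rule sum.cong[OF refl])
        fix j :: 'n
        have "det (\<chi> i. if i = k then v $ j *s axis j 1 else axis i (1::real)) = v $ j * det (\<chi> i. if i = k then axis j 1 else axis i (1::real))"
          by (rule det_row_mul)
        moreover have "det (\<chi> i. if i = k then axis j 1 else axis i (1::real)) = (if j = k then 1 else 0)"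
        proof (cases "j = k")
          case True
          have "(\<chi> i. if i = k then axis k 1 else axis i 1) = (mat 1 :: real ^ 'n ^ 'n)"
            by (auto simp: vec_eq_iff mat_def axis_def) 
          then show ?thesis using True by (simp cong: if_cong)
        next
          case False
          then show ?thesis
            by (auto intro!: det_identical_rows[of j k] simp: row_def vec_eq_iff)
        qed
        ultimately show "det (\<chi> i. if i = k then v $ j *s axis j 1 else axis i (1::real)) = (if j = k then v $ k else 0)"
          by auto
      qed
      finally show ?thesis by simp
    qed
    finally show ?thesis .
  qed
  finally show ?case using insert by simp
qed

lemma det_identity_plus_rank_one:
  fixes u v :: "real ^ 'n::finite"
  shows "det (\<chi> i j. (if i = j then 1 else 0) + u $ i * v $ j) = 1 + u \<bullet> v"
proof -
  have "(\<chi> i j. (if i = j then 1 else 0) + u $ i * v $ j) = (\<chi> i. if i \<in> UNIV then axis i 1 + u $ i *s v else axis i 1)"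
    by (auto simp: vec_eq_iff axis_def)
  then show ?thesis
    using det_rows_replaced_by_rank_one[of UNIV u v] by (simp add: inner_vec_def)
qed

text \<open>The matrix factors into the identity plus \<open>u v\<close> and the identity plus
  \<open>w' z\<close>, where \<open>w'\<close> is the preimage of \<open>w\<close> under the first
  factor; the number \<open>1 + u \<bullet> v\<close> is the denominator in
  \<open>w'\<close>.\<close>

lemma det_identity_plus_rank_two:
  fixes u v w z :: "real ^ 'n::finite"
  assumes "1 + u \<bullet> v \<noteq> 0"
  shows "det (\<chi> i j. (if i = j then 1 else 0) + u $ i * v $ j + w $ i * z $ j)
    = (1 + u \<bullet> v) * (1 + w \<bullet> z) - (u \<bullet> z) * (v \<bullet> w)"
proof -
  define w' where "w' = w - ((v \<bullet> w) / (1 + u \<bullet> v)) *\<^sub>R u"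
  have vw': "v \<bullet> w' = (v \<bullet> w) / (1 + u \<bullet> v)"
    using assms by (simp add: w'_def inner_diff_right field_simps inner_commute)
  have w: "w $ i = w' $ i + u $ i * (v \<bullet> w')" for i
    unfolding vw' by (simp add: w'_def)
  let ?A = "\<chi> i j. (if i = j then 1 else 0) + u $ i * v $ j"
  let ?B = "\<chi> i j. (if i = j then 1 else 0) + w' $ i * z $ j"
  have "(\<chi> i j. (if i = j then 1 else 0) + u $ i * v $ j + w $ i * z $ j) = ?A ** ?B"
  proof -
    have "(\<Sum>k\<in>UNIV. ((if i = k then 1 else 0) + u $ i * v $ k) * ((if k = j then 1 else 0) + w' $ k * z $ j))
      = (\<Sum>k\<in>UNIV. (if k = i then (if i = j then 1 else 0) + w' $ i * z $ j else 0) + (if k = j then u $ i * v $ j else 0) + u $ i * z $ j * (v $ k * w' $ k))"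
      for i j by (rule sum.cong) (auto simp: algebra_simps)
    moreover have "(\<Sum>k\<in>UNIV. (if k = i then (if i = j then 1 else 0) + w' $ i * z $ j else 0) + (if k = j then u $ i * v $ j else 0) + u $ i * z $ j * (v $ k * w' $ k))
      = (if i = j then 1 else 0) + u $ i * v $ j + w $ i * z $ j" for i j
      by (simp add: sum.distrib sum_distrib_left[symmetric] inner_vec_def w) (simp add: algebra_simps)
    ultimately show ?thesis
      by (simp add: vec_eq_iff matrix_matrix_mult_def)
  qed
  then have "det (\<chi> i j. (if i = j then 1 else 0) + u $ i * v $ j + w $ i * z $ j) = (1 + u \<bullet> v) * (1 + w' \<bullet> z)"
    by (simp add: det_mul det_identity_plus_rank_one)
  also have "\<dots> = (1 + u \<bullet> v) * (1 + w \<bullet> z) - (u \<bullet> z) * (v \<bullet> w)"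
    using assms by (simp add: w'_def inner_diff_left field_simps)
  finally show ?thesis .
qed

text \<open>Dividing row \<open>i\<close> by \<open>d $ i\<close> reduces this to the preceding
  lemma. A positive coefficient makes the denominator there at least 1, and the formula is symmetric
  in the two rank-one terms, so either may come first. Both cases occur: for the Gram matrix the
  positive coefficient belongs to the first term on the sphere and to the second on the
  hyperboloid.\<close>

lemma det_diagonal_plus_rank_two:
  fixes d u w :: "real ^ 'n::finite" and \<alpha> \<gamma> :: real
  assumes d: "\<And>i. d $ i > 0"
    and sgn: "\<alpha> > 0 \<or> \<gamma> > 0"
  shows "det (\<chi> i j. (if i = j then d $ i else 0) + \<alpha> * (u $ i * u $ j) + \<gamma> * (w $ i * w $ j))
    = (\<Prod>i\<in>UNIV. d $ i) * ((1 + \<alpha> * (\<Sum>i\<in>UNIV. (u $ i)\<^sup>2 / d $ i)) * (1 + \<gamma> * (\<Sum>i\<in>UNIV. (w $ i)\<^sup>2 / d $ i))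
        - \<alpha> * \<gamma> * (\<Sum>i\<in>UNIV. u $ i * w $ i / d $ i)\<^sup>2)"
proof -
  have *: "det (\<chi> i j. (if i = j then d $ i else 0) + \<alpha> * (u $ i * u $ j) + \<gamma> * (w $ i * w $ j))
    = (\<Prod>i\<in>UNIV. d $ i) * ((1 + \<alpha> * (\<Sum>i\<in>UNIV. (u $ i)\<^sup>2 / d $ i)) * (1 + \<gamma> * (\<Sum>i\<in>UNIV. (w $ i)\<^sup>2 / d $ i))
        - \<alpha> * \<gamma> * (\<Sum>i\<in>UNIV. u $ i * w $ i / d $ i)\<^sup>2)" if a: "\<alpha> > 0" for u w and \<alpha> \<gamma> :: real
  proof -
    have [simp]: "d $ i \<noteq> 0" for i using d[of i] by simp
    define U where "U = (\<chi> i. \<alpha> * u $ i / d $ i)"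
    define W where "W = (\<chi> i. \<gamma> * w $ i / d $ i)"
    have Uu: "U \<bullet> u = \<alpha> * (\<Sum>i\<in>UNIV. (u $ i)\<^sup>2 / d $ i)"
      by (simp add: U_def inner_vec_def sum_distrib_left power2_eq_square mult_ac)
    have Ww: "W \<bullet> w = \<gamma> * (\<Sum>i\<in>UNIV. (w $ i)\<^sup>2 / d $ i)"
      by (simp add: W_def inner_vec_def sum_distrib_left power2_eq_square mult_ac)
    have Uw: "U \<bullet> w = \<alpha> * (\<Sum>i\<in>UNIV. u $ i * w $ i / d $ i)"
      by (simp add: U_def inner_vec_def sum_distrib_left mult_ac)
    have uW: "u \<bullet> W = \<gamma> * (\<Sum>i\<in>UNIV. u $ i * w $ i / d $ i)"
      by (simp add: W_def inner_vec_def sum_distrib_left mult_ac)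
    have "U \<bullet> u \<ge> 0" unfolding Uu using a d
      by (intro mult_nonneg_nonneg sum_nonneg) (auto simp: less_imp_le)
    then have nz: "1 + U \<bullet> u \<noteq> 0" by linarith
    let ?R = "\<chi> i j. (if i = j then 1 else 0) + U $ i * u $ j + W $ i * w $ j"
    have "(\<chi> i j. (if i = j then d $ i else 0) + \<alpha> * (u $ i * u $ j) + \<gamma> * (w $ i * w $ j))
        = (\<chi> i. d $ i *s ?R $ i)"
      by (auto simp: vec_eq_iff U_def W_def field_simps)
    then have "det (\<chi> i j. (if i = j then d $ i else 0) + \<alpha> * (u $ i * u $ j) + \<gamma> * (w $ i * w $ j))
        = (\<Prod>i\<in>UNIV. d $ i) * det ?R"
      by (simp add: det_rows_mul)
    also have "det ?R = (1 + U \<bullet> u) * (1 + W \<bullet> w) - (U \<bullet> w) * (u \<bullet> W)"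
      by (rule det_identity_plus_rank_two[OF nz])
    finally show ?thesis unfolding Uu Ww Uw uW by (simp add: power2_eq_square algebra_simps)
  qed
  show ?thesis
  proof (cases "\<alpha> > 0")
    case True
    then show ?thesis by (rule *)
  next
    case False
    with sgn have "\<gamma> > 0" by simp
    from *[OF this, of w \<alpha> u] show ?thesis
      by (simp add: algebra_simps)
  qed
qed

section \<open>Integrable majorants and inversions\<close>

text \<open>One coordinate factor of the majorant below: the exponent \<open>p - 1 > - 1\<close> is
  integrable at 0, and the decay at infinity is that of the power \<open>- 1 - p\<close>.\<close>

lemma integrable_powr_pole_decay:
  fixes p :: real
  assumes p: "0 < p" "p < 1"
  shows "integrable lborel (\<lambda>t::real. \<bar>t\<bar> powr (p - 1) * (1 + t\<^sup>2) powr - p)"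
proof -
  let ?g = "\<lambda>t::real. \<bar>t\<bar> powr (p - 1) * (1 + t\<^sup>2) powr - p"
  have 1: "integrable lborel (\<lambda>x::real. indicator {0..1} x * x powr (p - 1))"
    using nn_integral_has_integral_lebesgue[OF _ has_integral_powr_from_0[of "p - 1" 1]] p
    by (intro integrableI_nonneg) auto
  have 2: "integrable lborel (\<lambda>x::real. indicator {1..} x * x powr (- 1 - p))"
    using nn_integral_has_integral_lebesgue[OF _ has_integral_powr_to_inf[of "- 1 - p" 1]] p
    by (intro integrableI_nonneg) auto
  have "integrable lborel (\<lambda>x. indicator {0..} x *\<^sub>R ?g x)"
  proof (rule Bochner_Integration.integrable_bound[OF Bochner_Integration.integrable_add[OF 1 2]])
    show "AE x in lborel. norm (indicator {0..} x *\<^sub>R ?g x)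
        \<le> norm (indicator {0..1} x * x powr (p - 1) + indicator {1..} x * x powr (- 1 - p))"
    proof (intro AE_I2)
      fix x :: real
      have a: "?g x \<le> x powr (p - 1)" if "0 \<le> x"
      proof -
        have "(1 + x\<^sup>2) powr - p \<le> 1 powr - p"
          using p by (intro powr_mono2') auto
        then show ?thesis using that by (simp add: mult_left_le)
      qed
      have b: "?g x \<le> x powr (- 1 - p)" if "1 \<le> x"
      proof -
        have "(1 + x\<^sup>2) powr - p \<le> (x\<^sup>2) powr - p"
          using p that by (intro powr_mono2') auto
        also have "(x\<^sup>2) powr - p = x powr (- 2 * p)"
          using that by (simp add: powr_powr flip: powr_numeral)
        finally have "?g x \<le> x powr (p - 1) * x powr (- 2 * p)"
          using that by (simp add: mult_left_mono)
        also have "\<dots> = x powr (- 1 - p)"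
          by (simp add: algebra_simps flip: powr_add)
        finally show ?thesis .
      qed
      have "0 \<le> ?g x" by simp
      then show "norm (indicator {0..} x *\<^sub>R ?g x)
          \<le> norm (indicator {0..1} x * x powr (p - 1) + indicator {1..} x * x powr (- 1 - p))"
        using a b by (auto simp: indicator_def)
    qed
  qed simp
  then have "has_bochner_integral lborel ?g (2 *\<^sub>R integral\<^sup>L lborel (\<lambda>x. indicator {0..} x *\<^sub>R ?g x))"
    by (intro has_bochner_integral_even_function has_bochner_integral_integrable) auto
  then show ?thesis by (rule integrable.intros)
qed

lemma AE_lborel_coordinates_nonzero:
  "AE x in (lborel :: 'a::euclidean_space measure). \<forall>b\<in>Basis. x \<bullet> b \<noteq> 0"
proof (rule AE_finite_allI)
  fix b :: 'a assume b: "b \<in> Basis"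
  have "{x::'a. x \<bullet> b = 0} \<in> sets lborel"
    by (simp add: closed_Collect_eq continuous_on_inner)
  moreover have "{x. x \<bullet> b = 0} \<in> null_sets (completion lborel)"
    using negligible_standard_hyperplane[OF b, of 0] by (simp add: negligible_iff_null_sets)
  ultimately have "{x. x \<bullet> b = 0} \<in> null_sets lborel"
    by (simp add: null_sets_completion_iff)
  then show "AE x in lborel. x \<bullet> b \<noteq> 0"
    by (drule_tac AE_not_in) simp
qed simp

text \<open>Each coordinate is at most the norm and all exponents are negative, so the radial
  function lies below a product of functions of one coordinate, to which Tonelli applies. The choice
  of \<open>p\<close> shares both exponents equally among the coordinates. The pole of order
  \<open>DIM('a) - 1/2\<close> is the one met when the field point lies on the ellipsoid.\<close>

lemma integrable_norm_pole_decay: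
  "integrable lborel (\<lambda>d::'a::euclidean_space.
     norm d powr - (real DIM('a) - 1/2) * (1 + (norm d)\<^sup>2) powr - (1/2))"
proof -
  define p where "p = 1 / (2 * real DIM('a))"
  have D: "real DIM('a) \<ge> 1" by (simp add: DIM_positive Suc_leI)
  have "1 < 2 * real DIM('a)" using D by linarith
  then have p: "0 < p" "p < 1" by (simp_all add: p_def divide_less_eq)
  let ?g = "\<lambda>t::real. \<bar>t\<bar> powr (p - 1) * (1 + t\<^sup>2) powr - p"
  have "(\<integral>\<^sup>+d. (\<Prod>b\<in>Basis. ennreal (?g (d \<bullet> b))) \<partial>(lborel :: 'a measure)) = (\<Prod>b\<in>(Basis::'a set). \<integral>\<^sup>+t. ?g t \<partial>lborel)"
    by (rule nn_integral_lborel_prod) auto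
  also have "\<dots> < \<infinity>"
  proof -
    have "(\<integral>\<^sup>+t. ?g t \<partial>lborel) < top"
      using integrable_powr_pole_decay[OF p] by (auto simp: real_integrable_def less_top)
    then show ?thesis by (simp add: power_less_top_ennreal)
  qed
  finally have "(\<integral>\<^sup>+d. ennreal (\<Prod>b\<in>Basis. ?g (d \<bullet> b)) \<partial>(lborel :: 'a measure)) < \<infinity>"
    by (simp add: prod_ennreal)
  then have I: "integrable lborel (\<lambda>d::'a. \<Prod>b\<in>Basis. ?g (d \<bullet> b))"
    by (intro integrableI_nonneg) (auto intro!: prod_nonneg)
  show ?thesis
  proof (rule Bochner_Integration.integrable_bound[OF I])
    show "AE d in (lborel :: 'a measure). norm (norm d powr - (real DIM('a) - 1/2) * (1 + (norm d)\<^sup>2) powr - (1/2))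
        \<le> norm (\<Prod>b\<in>Basis. ?g (d \<bullet> b))"
      \<comment> \<open>If a coordinate vanishes, \<open>0 powr (p - 1)\<close> is 0 by convention
        and the bound can fail; such points form a null set.\<close>
      using AE_lborel_coordinates_nonzero
    proof eventually_elim
      fix d :: 'a assume nz: "\<forall>b\<in>Basis. d \<bullet> b \<noteq> 0"
      have "norm d powr - (real DIM('a) - 1/2) * (1 + (norm d)\<^sup>2) powr - (1/2)
          = (norm d powr (p - 1)) powr real DIM('a) * ((1 + (norm d)\<^sup>2) powr - p) powr real DIM('a)"
      proof -
        have "(p - 1) * real DIM('a) = - (real DIM('a) - 1/2)" "- p * real DIM('a) = - (1/2)"
          using D by (auto simp: p_def field_simps)
        then show ?thesis by (simp only: powr_powr)
      qed
      also have "\<dots> = (norm d powr (p - 1) * (1 + (norm d)\<^sup>2) powr - p) powr real DIM('a)"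
        by (simp add: powr_mult)
      also have "\<dots> = (\<Prod>b\<in>(Basis::'a set). norm d powr (p - 1) * (1 + (norm d)\<^sup>2) powr - p)"
      proof -
        have "norm d powr (p - 1) * (1 + (norm d)\<^sup>2) powr - p > 0"
        proof -
          obtain b :: 'a where "b \<in> Basis" using nonempty_Basis by blast
          then have "d \<noteq> 0" using nz by auto
          moreover have "1 + (norm d)\<^sup>2 > 0" by (simp add: add_pos_nonneg)
          ultimately show ?thesis by simp
        qed
        then show ?thesis by (simp add: powr_realpow)
      qed
      also have "\<dots> \<le> (\<Prod>b\<in>(Basis::'a set). ?g (d \<bullet> b))"
      proof (rule prod_mono, intro conjI)
        fix b :: 'a assume b: "b \<in> Basis"
        have le: "\<bar>d \<bullet> b\<bar> \<le> norm d" by (rule Basis_le_norm[OF b])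
        have "norm d powr (p - 1) \<le> \<bar>d \<bullet> b\<bar> powr (p - 1)"
          using nz b le p by (intro powr_mono2') auto
        moreover have "(1 + (norm d)\<^sup>2) powr - p \<le> (1 + (d \<bullet> b)\<^sup>2) powr - p"
          using le p power_mono[OF le, of 2] by (intro powr_mono2') (auto simp: add_pos_nonneg)
        ultimately show "norm d powr (p - 1) * (1 + (norm d)\<^sup>2) powr - p \<le> ?g (d \<bullet> b)"
          by (intro mult_mono) auto
      qed auto
      finally show "norm (norm d powr - (real DIM('a) - 1/2) * (1 + (norm d)\<^sup>2) powr - (1/2))
        \<le> norm (\<Prod>b\<in>Basis. ?g (d \<bullet> b))"
        by (simp add: prod_nonneg)
    qed
  qed simp
qed

lemma inversion_derivative:
  fixes c s :: "'a::real_inner"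
  assumes "s \<noteq> c"
  shows "((\<lambda>s. c - (h\<^sup>2 / (norm (s - c))\<^sup>2) *\<^sub>R (s - c)) has_derivative
    (\<lambda>v. - (h\<^sup>2 / (norm (s - c))\<^sup>2) *\<^sub>R (v - (2 * ((s - c) \<bullet> v) / (norm (s - c))\<^sup>2) *\<^sub>R (s - c)))) (at s)"
proof -
  have nz: "(s - c) \<bullet> (s - c) \<noteq> 0" using assms by simp
  have "((\<lambda>s. c - (h\<^sup>2 / ((s - c) \<bullet> (s - c))) *\<^sub>R (s - c)) has_derivative
    (\<lambda>v. - (h\<^sup>2 / ((s - c) \<bullet> (s - c))) *\<^sub>R (v - (2 * ((s - c) \<bullet> v) / ((s - c) \<bullet> (s - c))) *\<^sub>R (s - c)))) (at s)"
    using nz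
    by (auto intro!: derivative_eq_intros simp: fun_eq_iff inner_commute divide_inverse algebra_simps power2_eq_square)
  then show ?thesis by (simp add: power2_norm_eq_inner)
qed

text \<open>The map is \<open>- r\<close> times the reflection in the hyperplane orthogonal to
  \<open>d\<close>; as a rank-one update of the identity that reflection has determinant
  \<open>1 - 2\<close>.\<close>

lemma inversion_determinant:
  fixes d :: "real ^ 'k::finite"
  assumes "d \<noteq> 0"
  shows "\<bar>det (matrix (\<lambda>v. - r *\<^sub>R (v - (2 * (d \<bullet> v) / (norm d)\<^sup>2) *\<^sub>R d)))\<bar> = \<bar>r\<bar> ^ CARD('k)"
proof -
  have axis_nth_if: "axis j (1::real) $ i = (if i = j then 1 else 0)" for i j :: 'k
    by (simp add: axis_def)
  define w where "w = (- 2 / (norm d)\<^sup>2) *\<^sub>R d"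
  have "matrix (\<lambda>v. - r *\<^sub>R (v - (2 * (d \<bullet> v) / (norm d)\<^sup>2) *\<^sub>R d))
      = (\<chi> i. (- r) *s (\<chi> i j. (if i = j then 1 else 0) + d $ i * w $ j) $ i)"
    by (auto simp: matrix_def vec_eq_iff w_def inner_axis axis_nth_if algebra_simps)
  then have "det (matrix (\<lambda>v. - r *\<^sub>R (v - (2 * (d \<bullet> v) / (norm d)\<^sup>2) *\<^sub>R d)))
      = (- r) ^ CARD('k) * (1 + d \<bullet> w)"
    by (simp only: det_rows_mul prod_constant vec_lambda_eta det_identity_plus_rank_one)
  also have "d \<bullet> w = - 2"
    using assms by (simp add: w_def power2_norm_eq_inner)
  finally show ?thesis by (simp add: abs_mult power_abs)
qed

text \<open>The map \<open>\<psi>\<close>, inversion in the sphere of radius \<open>h\<close> about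
  \<open>c\<close> followed by the point reflection in \<open>c\<close>, is an involution of the
  complement of \<open>c\<close>. Its Jacobian cancels the factor in \<open>anti\<close>, so the
  change of variables equates the integral with its own negative.\<close>

lemma integral_eq_0_by_inversion:
  fixes f :: "real ^ 'k::{finite,wellorder} \<Rightarrow> real"
  assumes h: "h > 0"
    and f: "integrable lborel f"
    and anti: "\<And>s. s \<noteq> c \<Longrightarrow> f (c - (h\<^sup>2 / (norm (s - c))\<^sup>2) *\<^sub>R (s - c)) = - (((norm (s - c))\<^sup>2 / h\<^sup>2) ^ CARD('k) * f s)"
  shows "integral\<^sup>L lborel f = 0"
proof -
  define \<psi> where "\<psi> = (\<lambda>s. c - (h\<^sup>2 / (norm (s - c))\<^sup>2) *\<^sub>R (s - c))"
  define \<psi>' where "\<psi>' = (\<lambda>s v. - (h\<^sup>2 / (norm (s - c))\<^sup>2) *\<^sub>R (v - (2 * ((s - c) \<bullet> v) / (norm (s - c))\<^sup>2) *\<^sub>R (s - c)))"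
  \<comment> \<open>The change of variables is stated for vector-valued functions, hence the copy of
    \<open>f\<close> with values in \<open>real ^ 1\<close>.\<close>
  define F where "F = (\<lambda>s. vec (f s) :: real ^ 1)"
  let ?S = "- {c}"
  have invol: "\<psi> (\<psi> s) = s \<and> \<psi> s \<noteq> c" if "s \<noteq> c" for s
  proof -
    have "norm (\<psi> s - c) = h\<^sup>2 / norm (s - c)"
      using that h by (simp add: \<psi>_def power2_eq_square)
    then have "(h\<^sup>2 / (norm (\<psi> s - c))\<^sup>2) = (norm (s - c))\<^sup>2 / h\<^sup>2"
      using that h by (simp only:) (simp add: power2_eq_square field_simps)
    then have "\<psi> (\<psi> s) = c - ((norm (s - c))\<^sup>2 / h\<^sup>2) *\<^sub>R (\<psi> s - c)"
      using fun_cong[OF \<psi>_def, of "\<psi> s"] by simp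
    also have "\<dots> = s" using that h by (simp add: \<psi>_def)
    finally show ?thesis using that h by (simp add: \<psi>_def)
  qed
  have inj: "inj_on \<psi> ?S"
    by (metis inj_on_def invol ComplD singletonI)
  have im: "\<psi> ` ?S = ?S"
  proof
    show "\<psi> ` ?S \<subseteq> ?S" using invol by auto
    show "?S \<subseteq> \<psi> ` ?S" using invol by (metis Compl_iff image_eqI insertE singletonI subsetI empty_iff)
  qed
  have der: "(\<psi> has_derivative \<psi>' s) (at s within ?S)" if "s \<in> ?S" for s
    unfolding \<psi>_def \<psi>'_def using that inversion_derivative by (blast intro: has_derivative_at_withinI)
  have jac: "\<bar>det (matrix (\<psi>' s))\<bar> *\<^sub>R F (\<psi> s) = - F s" if "s \<in> ?S" for s
  proof -
    have "\<bar>det (matrix (\<psi>' s))\<bar> = (h\<^sup>2 / (norm (s - c))\<^sup>2) ^ CARD('k)"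
      unfolding \<psi>'_def using that by (subst inversion_determinant) auto
    moreover have "(h\<^sup>2 / (norm (s - c))\<^sup>2) ^ CARD('k) * ((norm (s - c))\<^sup>2 / h\<^sup>2) ^ CARD('k) = 1"
      using that h by (subst power_mult_distrib[symmetric]) simp
    ultimately have "\<bar>det (matrix (\<psi>' s))\<bar> * f (\<psi> s) = - f s"
      using anti[of s] that by (simp add: \<psi>_def algebra_simps)
    then show ?thesis by (simp add: F_def vec_eq_iff)
  qed
  have "f absolutely_integrable_on UNIV"
    using f by (simp add: set_integrable_def integrable_completion)
  then have "f absolutely_integrable_on ?S"
    by (rule set_integrable_subset) auto
  then have F: "F absolutely_integrable_on ?S"
    by (simp add: absolutely_integrable_on_1_iff F_def)
  have "integral ?S (\<lambda>s. \<bar>det (matrix (\<psi>' s))\<bar> *\<^sub>R F (\<psi> s)) = integral ?S F"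
    using has_absolute_integral_change_of_variables[OF _ der inj, of F "integral ?S F"] F
    by (simp add: im)
  also have "integral ?S (\<lambda>s. \<bar>det (matrix (\<psi>' s))\<bar> *\<^sub>R F (\<psi> s)) = - integral ?S F"
    by (subst integral_cong[where g="\<lambda>s. - F s", OF jac]) auto
  finally have "integral ?S F = 0" by (simp add: vec_eq_iff)
  then have "integral ?S f = 0"
    by (simp add: integral_on_1_eq F_def vec_eq_iff)
  moreover have "integral ?S f = integral UNIV f"
    by (rule integral_spike_set) (auto intro: negligible_subset[of "{c}"])
  ultimately show ?thesis
    using integral_lborel[OF f] by simp
qed

section \<open>The point potentials\<close>

lemma spherical_u_has_derivative:
  assumes r: "0 < r" "r < pi"
  shows "(spherical_u n has_real_derivative - (1 / sin r ^ (n - 1))) (at r)"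
proof -
  \<comment> \<open>A compact interval in \<open>(0, pi)\<close> around both \<open>r\<close> and
    the base point \<open>pi / 2\<close>, which may lie on either side of \<open>r\<close>.\<close>
  define a b where "a = min r (pi/2) / 2" and "b = (max r (pi/2) + pi) / 2"
  have ab: "0 < a" "a < r" "a < pi/2" "r < b" "pi/2 < b" "b < pi"
    using r by (auto simp: a_def b_def)
  let ?f = "\<lambda>t. 1 / sin t ^ (n - 1)"
  have "sin t \<noteq> 0" if "t \<in> {a..b}" for t
    using sin_gt_zero[of t] that ab by auto
  then have "continuous_on {a..b} ?f"
    by (intro continuous_intros) auto
  then have "((\<lambda>u. LBINT y=pi/2..u. ?f y) has_vector_derivative ?f r) (at r within {a..b})"
    using ab by (intro interval_integral_FTC2) auto
  then have "((\<lambda>u. LBINT y=pi/2..u. ?f y) has_vector_derivative ?f r) (at r)"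
    using ab at_within_Icc_at[of a r b] by simp
  then have "((\<lambda>u. LBINT y=pi/2..u. ?f y) has_real_derivative ?f r) (at r)"
    by (simp add: has_real_derivative_iff_has_vector_derivative)
  moreover have "spherical_u n = (\<lambda>u. - (LBINT y=pi/2..u. ?f y))"
    by (auto simp: spherical_u_def fun_eq_iff intro: interval_integral_endpoints_reverse)
  ultimately show ?thesis
    by (auto intro!: derivative_eq_intros)
qed

text \<open>The variable \<open>\<sigma>\<close> is the ambient product of the two points: the
  cosine of their distance here, minus its hyperbolic cosine in
  \<open>hyperbolic_kernel\<close>.\<close>

definition spherical_kernel :: "nat \<Rightarrow> real \<Rightarrow> real" where
  "spherical_kernel n \<sigma> = spherical_u n (arccos \<sigma>)"

definition hyperbolic_kernel :: "nat \<Rightarrow> real \<Rightarrow> real" where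
  "hyperbolic_kernel n \<sigma> = hyperbolic_u n (arcosh (- \<sigma>))"

lemma sqrt_power_inverse:
  assumes "x > 0" "n \<ge> 1"
  shows "1 / sqrt x ^ (n - 1) * (1 / sqrt x) = x powr - (real n / 2)"
proof -
  have "1 / sqrt x ^ (n - 1) * (1 / sqrt x) = 1 / sqrt x ^ n"
    using assms(2) by (cases n) auto
  also have "sqrt x ^ n = x powr (real n / 2)"
    using assms(1) by (simp add: powr_half_sqrt[symmetric] powr_power)
  finally show ?thesis by (simp add: powr_minus_divide)
qed

text \<open>The derivative of \<open>arccos\<close> contributes one more factor
  \<open>1 / sin r\<close>, which raises the exponent from \<open>n - 1\<close> to
  \<open>n\<close>.\<close>

lemma spherical_kernel_has_derivative:
  assumes s: "- 1 < \<sigma>" "\<sigma> < 1" and n: "n \<ge> 1"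
  shows "(spherical_kernel n has_real_derivative (1 - \<sigma>\<^sup>2) powr - (real n / 2)) (at \<sigma>)"
proof -
  have "arccos \<sigma> \<in> {0<..<pi}"
    using s arccos_lt_bounded by auto
  then have "((\<lambda>\<sigma>. spherical_u n (arccos \<sigma>)) has_real_derivative
      - (1 / sin (arccos \<sigma>) ^ (n - 1)) * inverse (- sqrt (1 - \<sigma>\<^sup>2))) (at \<sigma>)"
    using s by (intro DERIV_chain2[OF spherical_u_has_derivative DERIV_arccos]) auto
  moreover have "1 - \<sigma>\<^sup>2 > 0" using s by (simp add: abs_square_less_1)
  then have "- (1 / sin (arccos \<sigma>) ^ (n - 1)) * inverse (- sqrt (1 - \<sigma>\<^sup>2)) = (1 - \<sigma>\<^sup>2) powr - (real n / 2)"
    using sqrt_power_inverse[of "1 - \<sigma>\<^sup>2" n] s n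
    by (simp add: sin_arccos inverse_eq_divide)
  ultimately show ?thesis unfolding spherical_kernel_def[abs_def] by simp
qed

lemma spherical_kernel_0: "spherical_kernel n 0 = 0"
  by (simp add: spherical_kernel_def spherical_u_def interval_lebesgue_integral_def set_lebesgue_integral_def)

text \<open>Substitution of \<open>pi - t\<close>. It is an identity of Lebesgue integrals even
  where they diverge, both then having the default value 0; this covers coincident and antipodal
  points.\<close>

lemma spherical_u_reflect: "spherical_u n (pi - r) = - spherical_u n r"
proof -
  have *: "spherical_u n (pi - r) = - spherical_u n r" if r: "r \<le> pi/2" for r
  proof -
    let ?f = "\<lambda>t::real. 1 / sin t ^ (n - 1)"
    have "(LBINT t=pi/2..pi - r. ?f t) = (\<integral>t. indicator {pi/2<..<pi - r} t * ?f t \<partial>lborel)"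
      using r by (simp add: interval_lebesgue_integral_def set_lebesgue_integral_def)
    also have "\<dots> = (\<integral>t. indicator {pi/2<..<pi - r} (pi + - 1 * t) * ?f (pi + - 1 * t) \<partial>lborel)"
      by (subst lborel_integral_real_affine[of "- 1" _ pi]) auto
    also have "\<dots> = (\<integral>t. indicator {r<..<pi/2} t * ?f t \<partial>lborel)"
      by (intro Bochner_Integration.integral_cong) (auto simp: indicator_def)
    also have "\<dots> = spherical_u n r"
      using r by (simp add: spherical_u_def interval_lebesgue_integral_def set_lebesgue_integral_def)
    finally show ?thesis
      unfolding spherical_u_def by (subst interval_integral_endpoints_reverse) simp
  qed
  show ?thesis
    using *[of r] *[of "pi - r"] by (cases "r \<le> pi/2") auto
qed

lemma spherical_kernel_minus:
  assumes "- 1 \<le> \<sigma>" "\<sigma> \<le> 1"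
  shows "spherical_kernel n (- \<sigma>) = - spherical_kernel n \<sigma>"
  using assms by (simp add: spherical_kernel_def arccos_minus spherical_u_reflect)

text \<open>
  The true growth of the kernel at the singularity has exponent \<open>n/2 - 1\<close>, or is logarithmic if
  \<open>n = 2\<close>. The exponent \<open>(n - 3/2)/2\<close> covers both cases and is still small enough for integrability.
\<close>

lemma spherical_kernel_bound:
  assumes n: "n \<ge> 2"
  shows "\<exists>C. \<forall>\<sigma>. - 1 < \<sigma> \<and> \<sigma> < 1 \<longrightarrow> \<bar>spherical_kernel n \<sigma>\<bar> \<le> C * (1 - \<sigma>\<^sup>2) powr - ((real n - 3/2) / 2)"
proof -
  define \<beta> where "\<beta> = (real n - 3/2) / 2"
  have \<beta>: "\<beta> \<ge> 1/4" "real n / 2 = \<beta> + 3/4" using n by (auto simp: \<beta>_def field_simps)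
  let ?G = "\<lambda>\<sigma>::real. (1 - \<sigma>\<^sup>2) powr - \<beta>"
  define C where "C = max (1 / \<beta>) ((3/4) powr - (real n / 2))"
  have C: "C \<ge> 1 / \<beta>" "C \<ge> (3/4) powr - (real n / 2)" "C > 0"
    by (auto simp: C_def less_max_iff_disj)
  have sq: "x\<^sup>2 < 1" if "0 \<le> x" "x < 1" for x :: real
    using that by (simp add: abs_square_less_1)
  have K: "0 \<le> spherical_kernel n \<sigma> \<and> spherical_kernel n \<sigma> \<le> 2 * C * ?G \<sigma>" if s: "0 \<le> \<sigma>" "\<sigma> < 1" for \<sigma>
  proof
    have "spherical_kernel n 0 \<le> spherical_kernel n \<sigma>"
    proof (rule DERIV_nonneg_imp_nondecreasing[OF s(1)])
      fix x assume "0 \<le> x" "x \<le> \<sigma>"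
      then have "(spherical_kernel n has_real_derivative (1 - x\<^sup>2) powr - (real n / 2)) (at x)"
        using s n by (intro spherical_kernel_has_derivative) auto
      then show "\<exists>y. (spherical_kernel n has_real_derivative y) (at x) \<and> 0 \<le> y" by force
    qed
    then show "0 \<le> spherical_kernel n \<sigma>" by (simp add: spherical_kernel_0)
    \<comment> \<open>The summand \<open>\<sigma>\<close> supplies slope \<open>C\<close> near 0,
      where the derivative of \<open>?G\<close> vanishes but that of the kernel is 1; away from 0
      the term \<open>?G\<close> suffices, since \<open>n / 2 < \<beta> + 1\<close>.\<close>
    let ?H = "\<lambda>\<sigma>. C * (?G \<sigma> + \<sigma>) - spherical_kernel n \<sigma>"
    have "?H 0 \<le> ?H \<sigma>"
    proof (rule DERIV_nonneg_imp_nondecreasing[OF s(1)])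
      fix x assume x: "0 \<le> x" "x \<le> \<sigma>"
      have x1: "x < 1" "x\<^sup>2 < 1" using x s sq[of x] by auto
      have "((\<lambda>\<sigma>. ?G \<sigma>) has_real_derivative (2 * \<beta> * x * (1 - x\<^sup>2) powr (- \<beta> - 1))) (at x)"
        using x1 by (auto intro!: derivative_eq_intros simp: powr_diff field_simps)
      then have "(?H has_real_derivative C * (2 * \<beta> * x * (1 - x\<^sup>2) powr (- \<beta> - 1) + 1) - (1 - x\<^sup>2) powr - (real n / 2)) (at x)"
        using x x1 n by (auto intro!: derivative_intros DERIV_cmult DERIV_add spherical_kernel_has_derivative)
      moreover have "C * (2 * \<beta> * x * (1 - x\<^sup>2) powr (- \<beta> - 1) + 1) \<ge> (1 - x\<^sup>2) powr - (real n / 2)"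
      proof (cases "x \<le> 1/2")
        case True
        then have "x\<^sup>2 \<le> 1/4" using x power_mono[of x "1/2" 2] by (simp add: power2_eq_square)
        then have "(1 - x\<^sup>2) powr - (real n / 2) \<le> (3/4) powr - (real n / 2)"
          by (intro powr_mono2') auto
        also have "\<dots> \<le> C * 1" using C by simp
        also have "\<dots> \<le> C * (2 * \<beta> * x * (1 - x\<^sup>2) powr (- \<beta> - 1) + 1)"
          using C x \<beta> by (intro mult_left_mono) auto
        finally show ?thesis .
      next
        case False
        have "(1 - x\<^sup>2) powr - (real n / 2) \<le> (1 - x\<^sup>2) powr (- \<beta> - 1)"
          using x1 \<beta>(2) by (intro powr_mono') (linarith, auto)
        also have "1 \<le> C * (2 * \<beta> * x)"
        proof -
          have "1 = (1 / \<beta>) * (2 * \<beta> * (1/2))" using \<beta> by simp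
          also have "\<dots> \<le> C * (2 * \<beta> * x)" using C \<beta> False by (intro mult_mono) auto
          finally show ?thesis .
        qed
        then have "1 * (1 - x\<^sup>2) powr (- \<beta> - 1) \<le> C * (2 * \<beta> * x) * (1 - x\<^sup>2) powr (- \<beta> - 1)"
          by (intro mult_right_mono) auto
        then have "(1 - x\<^sup>2) powr (- \<beta> - 1) \<le> C * (2 * \<beta> * x * (1 - x\<^sup>2) powr (- \<beta> - 1) + 1)"
          using C(3) by (simp add: algebra_simps)
        finally show ?thesis .
      qed
      ultimately show "\<exists>y. (?H has_real_derivative y) (at x) \<and> 0 \<le> y" by force
    qed
    then have "spherical_kernel n \<sigma> \<le> C * (?G \<sigma> + \<sigma>)"
      using C(3) by (simp add: spherical_kernel_0)
    also have "?G \<sigma> \<ge> 1 powr - \<beta>"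
      using sq[OF s] \<beta> by (intro powr_mono2') auto
    then have "C * (?G \<sigma> + \<sigma>) \<le> C * (?G \<sigma> + ?G \<sigma>)"
      using C(3) s by (intro mult_left_mono add_left_mono) auto
    finally show "spherical_kernel n \<sigma> \<le> 2 * C * ?G \<sigma>" by simp
  qed
  have "\<bar>spherical_kernel n \<sigma>\<bar> \<le> 2 * C * ?G \<sigma>" if "- 1 < \<sigma>" "\<sigma> < 1" for \<sigma>
    using K[of \<sigma>] K[of "- \<sigma>"] spherical_kernel_minus[of \<sigma> n] that by (cases "\<sigma> \<ge> 0") auto
  then show ?thesis unfolding \<beta>_def by blast
qed

section \<open>Potential of a point charge in hyperbolic space\<close>

lemma sinh_lower_bound:
  fixes c t :: real
  assumes "0 < c" "c \<le> t"
  shows "(1 - exp (- 2 * c)) / 2 * exp t \<le> sinh t"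
proof -
  have "sinh t = (1 - exp (- 2 * t)) / 2 * exp t"
    by (simp add: sinh_field_def field_simps flip: exp_add)
  moreover have "exp (- 2 * t) \<le> exp (- 2 * c)" using assms by simp
  ultimately show ?thesis by simp
qed

text \<open>For \<open>t \<ge> c\<close> the function \<open>sinh\<close> is at least a multiple of
  \<open>exp\<close>, and \<open>n \<ge> 2\<close> leaves at least one factor
  \<open>exp (- t)\<close>. Uniformity in \<open>r\<close> shows that the potential tends to 0 at
  infinity.\<close>

lemma hyperbolic_u_tail:
  assumes c: "0 < c" and n: "n \<ge> 2"
  shows "\<exists>C. \<forall>r\<ge>c. set_integrable lborel {r<..} (\<lambda>t. 1 / sinh t ^ (n - 1)) \<and>
    0 \<le> hyperbolic_u n r \<and> hyperbolic_u n r \<le> C * exp (- r)"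
proof -
  let ?f = "\<lambda>t::real. 1 / sinh t ^ (n - 1)"
  define \<kappa> where "\<kappa> = (1 - exp (- 2 * c)) / 2"
  define C where "C = 1 / \<kappa> ^ (n - 1)"
  have \<kappa>: "\<kappa> > 0" using c by (simp add: \<kappa>_def)
  then have C0: "C \<ge> 0" by (simp add: C_def)
  have f: "0 \<le> ?f t \<and> ?f t \<le> C * exp (- t)" if "c \<le> t" for t
  proof
    show "0 \<le> ?f t" using that c by simp
    have "0 < \<kappa> * exp t" using \<kappa> by simp
    moreover have "\<kappa> * exp t \<le> sinh t" unfolding \<kappa>_def by (rule sinh_lower_bound[OF c that])
    ultimately have "?f t \<le> 1 / (\<kappa> * exp t) ^ (n - 1)"
      using that c \<kappa> by (intro divide_left_mono power_mono mult_pos_pos zero_less_power) auto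
    also have "\<dots> = C * exp (- t) ^ (n - 1)"
      by (simp add: C_def power_mult_distrib exp_minus field_simps)
    also have "exp (- t) ^ (n - 1) \<le> exp (- t) ^ 1"
      using n c that by (intro power_decreasing) auto
    then have "C * exp (- t) ^ (n - 1) \<le> C * exp (- t)"
      using \<kappa> by (intro mult_left_mono) (auto simp: C_def)
    finally show "?f t \<le> C * exp (- t)" .
  qed
  show ?thesis
  proof (intro exI[of _ C] allI impI)
    fix r assume r: "c \<le> r"
    have E: "((\<lambda>t. exp (- 1 * t)) has_integral exp (- 1 * r) / 1) {r..}"
      by (rule has_integral_exp_minus_to_infinity) simp
    have "integral\<^sup>N lborel (\<lambda>x. ennreal (indicator {r..} x * exp (- 1 * x))) = exp (- r)"
      using nn_integral_has_integral_lebesgue[OF _ E] by simp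
    moreover have ae: "AE x in lborel. indicator {r..} x * exp (- 1 * x) = indicator {r<..} x * exp (- x)"
      using AE_lborel_singleton[of r] by eventually_elim (auto simp: indicator_def)
    ultimately have nn: "integral\<^sup>N lborel (\<lambda>x. ennreal (indicator {r<..} x * exp (- x))) = exp (- r)"
      by (subst nn_integral_cong_AE[where v="\<lambda>x. ennreal (indicator {r..} x * exp (- 1 * x))"]) (auto elim: eventually_mono)
    have I: "integrable lborel (\<lambda>x. indicator {r<..} x * exp (- x))"
      using nn by (intro integrableI_nonneg) auto
    have II: "integral\<^sup>L lborel (\<lambda>x. indicator {r<..} x * exp (- x)) = exp (- r)"
      by (subst integral_eq_nn_integral) (auto simp: nn)
    have ms: "(\<lambda>x. indicator {r<..} x * ?f x) \<in> borel_measurable borel"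
      unfolding sinh_field_def by measurable
    have F: "integrable lborel (\<lambda>x. indicator {r<..} x * ?f x)"
      by (rule Bochner_Integration.integrable_bound[OF integrable_mult_right[OF I, of C]])
         (use f r ms C0 in \<open>auto simp: indicator_def abs_mult intro!: AE_I2\<close>)
    then show "set_integrable lborel {r<..} ?f \<and> 0 \<le> hyperbolic_u n r \<and> hyperbolic_u n r \<le> C * exp (- r)"
    proof (intro conjI)
      show "set_integrable lborel {r<..} ?f" using F by (simp add: set_integrable_def)
      have u: "hyperbolic_u n r = integral\<^sup>L lborel (\<lambda>x. indicator {r<..} x * ?f x)"
        by (simp add: hyperbolic_u_def interval_integral_to_infinity_eq set_lebesgue_integral_def)
      show "0 \<le> hyperbolic_u n r" unfolding u
        using f r by (intro Bochner_Integration.integral_nonneg) (auto simp: indicator_def)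
      have "hyperbolic_u n r \<le> integral\<^sup>L lborel (\<lambda>x. C * (indicator {r<..} x * exp (- x)))" unfolding u
        using f r F I by (intro integral_mono) (auto simp: indicator_def)
      then show "hyperbolic_u n r \<le> C * exp (- r)" by (simp add: II)
    qed
  qed
qed

lemma hyperbolic_u_has_derivative:
  assumes r: "0 < r" and n: "n \<ge> 2"
  shows "(hyperbolic_u n has_real_derivative - (1 / sinh r ^ (n - 1))) (at r)"
proof -
  let ?f = "\<lambda>t::real. 1 / sinh t ^ (n - 1)"
  define c where "c = r / 2"
  have c: "0 < c" "c < r" using r by (auto simp: c_def)
  have int: "set_integrable lborel {c<..} ?f" using hyperbolic_u_tail[OF c(1) n] by blast
  have "continuous_on {c..2 * r} ?f" using c by (intro continuous_intros) auto
  then have "((\<lambda>u. LBINT y=c..u. ?f y) has_vector_derivative ?f r) (at r within {c..2 * r})"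
    using c by (intro interval_integral_FTC2) auto
  then have "((\<lambda>u. LBINT y=c..u. ?f y) has_real_derivative ?f r) (at r)"
    using c at_within_Icc_at[of c r "2 * r"] by (simp add: has_real_derivative_iff_has_vector_derivative)
  then have "((\<lambda>u. hyperbolic_u n c - (LBINT y=c..u. ?f y)) has_real_derivative - ?f r) (at r)"
    by (auto intro!: derivative_eq_intros)
  moreover have "hyperbolic_u n u = hyperbolic_u n c - (LBINT y=c..u. ?f y)" if "u \<in> {c<..}" for u
  proof -
    have "(LBINT y=c..u. ?f y) + (LBINT y=u..\<infinity>. ?f y) = (LBINT y=c..\<infinity>. ?f y)"
      using that int by (intro interval_integral_sum) (auto simp: interval_integrable_to_infinity_eq min_def max_def)
    then show ?thesis by (simp add: hyperbolic_u_def)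
  qed
  ultimately show ?thesis
    using c by (subst DERIV_cong_ev[OF refl _ refl, of _ "\<lambda>u. hyperbolic_u n c - (LBINT y=c..u. ?f y)"])
      (auto simp: eventually_nhds intro!: exI[of _ "{c<..}"])
qed

lemma hyperbolic_kernel_has_derivative:
  assumes s: "\<sigma> < - 1" and n: "n \<ge> 2"
  shows "(hyperbolic_kernel n has_real_derivative (\<sigma>\<^sup>2 - 1) powr - (real n / 2)) (at \<sigma>)"
proof -
  have pos: "\<sigma>\<^sup>2 - 1 > 0" using one_less_power[of "- \<sigma>" 2] s by simp
  have "((\<lambda>\<sigma>. hyperbolic_u n (arcosh (- \<sigma>))) has_real_derivative
      - (1 / sinh (arcosh (- \<sigma>)) ^ (n - 1)) * (1 / sqrt ((- \<sigma>)\<^sup>2 - 1) * - 1)) (at \<sigma>)"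
    using s n
    by (intro DERIV_chain2[where f="hyperbolic_u n"] DERIV_chain2[where f=arcosh] hyperbolic_u_has_derivative arcosh_real_has_field_derivative)
      (auto intro!: derivative_eq_intros)
  moreover have "- (1 / sinh (arcosh (- \<sigma>)) ^ (n - 1)) * (1 / sqrt ((- \<sigma>)\<^sup>2 - 1) * - 1) = (\<sigma>\<^sup>2 - 1) powr - (real n / 2)"
    using sqrt_power_inverse[OF pos, of n] s n by (simp add: sinh_arcosh_real)
  ultimately show ?thesis unfolding hyperbolic_kernel_def[abs_def] by simp
qed

text \<open>The difference \<open>?H\<close> of comparison function and kernel is nondecreasing:
  with \<open>C = 1 / (2 * \<beta>)\<close> this amounts to
  \<open>(x\<^sup>2 - 1) powr (1/4) \<le> - x\<close>. At \<open>- cosh R\<close>, with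
  \<open>R\<close> tending to infinity, it is bounded below by a quantity tending to 0, because the
  potential vanishes at infinity; hence \<open>?H\<close> is nonnegative.\<close>

lemma hyperbolic_kernel_bound:
  assumes n: "n \<ge> 2"
  shows "\<exists>C. \<forall>\<sigma> < - 1. \<bar>hyperbolic_kernel n \<sigma>\<bar> \<le> C * (\<sigma>\<^sup>2 - 1) powr - ((real n - 3/2) / 2)"
proof -
  define \<beta> where "\<beta> = (real n - 3/2) / 2"
  have \<beta>: "\<beta> \<ge> 1/4" "real n / 2 = \<beta> + 3/4" using n by (auto simp: \<beta>_def field_simps)
  define C where "C = 1 / (2 * \<beta>)"
  have C: "C > 0" using \<beta> by (simp add: C_def)
  let ?H = "\<lambda>\<sigma>. C * (\<sigma>\<^sup>2 - 1) powr - \<beta> - hyperbolic_kernel n \<sigma>"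
  obtain C' where C': "\<And>r. r \<ge> 1 \<Longrightarrow> 0 \<le> hyperbolic_u n r \<and> hyperbolic_u n r \<le> C' * exp (- r)"
    using hyperbolic_u_tail[of 1 n] n by auto
  have pos: "x\<^sup>2 - 1 > 0" if "x < - 1" for x :: real
    using one_less_power[of "- x" 2] that by simp
  have mono: "?H \<tau> \<le> ?H \<sigma>" if "\<tau> \<le> \<sigma>" "\<sigma> < - 1" for \<sigma> \<tau>
  proof (rule DERIV_nonneg_imp_nondecreasing[OF that(1)])
    fix x assume x: "\<tau> \<le> x" "x \<le> \<sigma>"
    then have x1: "x < - 1" using that by simp
    note p = pos[OF x1]
    have "(?H has_real_derivative C * (- 2 * \<beta> * x * (x\<^sup>2 - 1) powr (- \<beta> - 1)) - (x\<^sup>2 - 1) powr - (real n / 2)) (at x)"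
      using p x1 n by (auto intro!: derivative_eq_intros hyperbolic_kernel_has_derivative simp: powr_diff field_simps)
    moreover have "C * (- 2 * \<beta> * x * (x\<^sup>2 - 1) powr (- \<beta> - 1)) \<ge> (x\<^sup>2 - 1) powr - (real n / 2)"
    proof -
      have "(x\<^sup>2 - 1) powr (1/4) \<le> (x ^ 4) powr (1/4)"
      proof (intro powr_mono2)
        have "1 * x\<^sup>2 \<le> x\<^sup>2 * x\<^sup>2" using p by (intro mult_right_mono) auto
        then show "x\<^sup>2 - 1 \<le> x ^ 4" by (simp add: power4_eq_xxxx power2_eq_square)
      qed (use p in auto)
      also have "(x ^ 4) powr (1/4) = ((- x) powr 4) powr (1/4)"
        using x1 powr_realpow[of "- x" 4] by simp
      also have "\<dots> = - x" using x1 by (simp only: powr_powr) simp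
      finally have "(x\<^sup>2 - 1) powr (- \<beta> - 1) * (x\<^sup>2 - 1) powr (1/4) \<le> (x\<^sup>2 - 1) powr (- \<beta> - 1) * (- x)"
        by (intro mult_left_mono) auto
      also have "(x\<^sup>2 - 1) powr (- \<beta> - 1) * (x\<^sup>2 - 1) powr (1/4) = (x\<^sup>2 - 1) powr - (real n / 2)"
        by (simp add: \<beta>(2) algebra_simps flip: powr_add)
      also have "(x\<^sup>2 - 1) powr (- \<beta> - 1) * (- x) = C * (- 2 * \<beta> * x * (x\<^sup>2 - 1) powr (- \<beta> - 1))"
        using \<beta> by (simp add: C_def)
      finally show ?thesis .
    qed
    ultimately show "\<exists>y. (?H has_real_derivative y) (at x) \<and> 0 \<le> y" by force
  qed
  have "\<bar>hyperbolic_kernel n \<sigma>\<bar> \<le> C * (\<sigma>\<^sup>2 - 1) powr - \<beta>" if s: "\<sigma> < - 1" for \<sigma>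
  proof -
    have ev: "eventually (\<lambda>R. - C' * exp (- R) \<le> ?H \<sigma> \<and> 0 \<le> hyperbolic_kernel n \<sigma>) at_top"
    proof (rule eventually_mono[OF eventually_ge_at_top[of "max 1 (arcosh (- \<sigma>))"]])
      fix R :: real assume R: "R \<ge> max 1 (arcosh (- \<sigma>))"
      have "cosh (arcosh (- \<sigma>)) \<le> cosh R"
        using R s by (subst cosh_real_nonneg_le_iff) auto
      then have le: "- cosh R \<le> \<sigma>" using s by simp
      have k: "hyperbolic_kernel n (- cosh R) = hyperbolic_u n R"
        using R by (simp add: hyperbolic_kernel_def arcosh_cosh_real)
      have "0 \<le> C * ((- cosh R)\<^sup>2 - 1) powr - \<beta>" using C by simp
      then have "- C' * exp (- R) \<le> ?H (- cosh R)"
        using C'[of R] R unfolding k by simp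
      also have "\<dots> \<le> ?H \<sigma>" by (rule mono[OF le s])
      finally show "- C' * exp (- R) \<le> ?H \<sigma> \<and> 0 \<le> hyperbolic_kernel n \<sigma>"
        using hyperbolic_u_tail[of "arcosh (- \<sigma>)" n] s n by (auto simp: hyperbolic_kernel_def)
    qed
    have "((\<lambda>R. - C' * exp (- R)) \<longlongrightarrow> - C' * 0) at_top"
      by (intro tendsto_intros filterlim_compose[OF exp_at_bot filterlim_uminus_at_bot_at_top])
    then have "- C' * 0 \<le> ?H \<sigma>"
      by (rule tendsto_upperbound) (use ev in \<open>auto elim: eventually_mono\<close>)
    moreover have "0 \<le> hyperbolic_kernel n \<sigma>"
      using eventually_happens[OF ev] by auto
    ultimately show ?thesis by simp
  qed
  then show ?thesis unfolding \<beta>_def by blast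
qed

section \<open>Light cone and stereographic parametrization\<close>

definition gform :: "real \<Rightarrow> 'n::finite space \<Rightarrow> 'n space \<Rightarrow> real" where
  "gform e x y = snd x \<bullet> snd y + e * (fst x * fst y)"

definition qform :: "('n::finite \<Rightarrow> real) \<Rightarrow> real \<Rightarrow> 'n space \<Rightarrow> real" where
  "qform A B x = (\<Sum>i\<in>UNIV. (snd x $ i)\<^sup>2 / A i) - (fst x)\<^sup>2 / B"

definition scl :: "('n::finite \<Rightarrow> real) \<Rightarrow> real \<Rightarrow> 'n space \<Rightarrow> 'n space" where
  "scl A B x = (sqrt B * fst x, \<chi> i. sqrt (A i) * snd x $ i)"

definition glen :: "real \<Rightarrow> 'n::finite space \<Rightarrow> real" where
  "glen e x = sqrt (e * gform e x x)"

text \<open>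
  \<open>qdet e p w\<close> is \<open>e\<close> times the Gram determinant of \<open>p\<close>, \<open>w\<close>. It is positive when \<open>p\<close> is timelike and
  \<open>w\<close> is not a multiple of \<open>p\<close>: for \<open>e = -1\<close> this is the reversed Cauchy-Schwarz inequality.
\<close>

definition qdet :: "real \<Rightarrow> 'n::finite space \<Rightarrow> 'n space \<Rightarrow> real" where
  "qdet e p w = e * (gform e p p * gform e w w - (gform e p w)\<^sup>2)"

text \<open>For \<open>e = - 1\<close> the last condition puts the cone \<open>qform A B = 0\<close>
  inside the light cone.\<close>

definition admissible :: "real \<Rightarrow> ('n::finite \<Rightarrow> real) \<Rightarrow> real \<Rightarrow> bool" where
  "admissible e A B \<longleftrightarrow> (e = 1 \<or> e = - 1) \<and> (\<forall>i. 0 < A i) \<and> 0 < B \<and> (e = - 1 \<longrightarrow> (\<forall>i. A i < B))"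

lemma gform_1: "gform 1 = (\<bullet>)"
  by (auto simp: gform_def inner_prod_def fun_eq_iff)

lemma gform_minus_1: "gform (- 1) = mink"
  by (auto simp: gform_def mink_def fun_eq_iff)

lemma gform_commute: "gform e x y = gform e y x"
  by (simp add: gform_def inner_commute mult.commute)

lemma gform_simps:
  "gform e (x + y) z = gform e x z + gform e y z"
  "gform e z (x + y) = gform e z x + gform e z y"
  "gform e (x - y) z = gform e x z - gform e y z"
  "gform e z (x - y) = gform e z x - gform e z y"
  "gform e (r *\<^sub>R x) z = r * gform e x z"
  "gform e z (r *\<^sub>R x) = r * gform e z x"
  "gform e (- x) z = - gform e x z"
  "gform e z (- x) = - gform e z x"
  "gform e 0 z = 0" "gform e z 0 = 0"
  by (simp_all add: gform_def algebra_simps inner_add_left inner_add_right inner_diff_left inner_diff_right)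

lemma continuous_on_gform [continuous_intros]:
  "continuous_on S f \<Longrightarrow> continuous_on S g \<Longrightarrow> continuous_on S (\<lambda>x. gform e (f x) (g x))"
  unfolding gform_def by (intro continuous_intros)

lemma continuous_on_glen [continuous_intros]:
  "continuous_on S f \<Longrightarrow> continuous_on S (\<lambda>x. glen e (f x))"
  unfolding glen_def by (intro continuous_intros)

lemma continuous_on_qdet [continuous_intros]:
  "continuous_on S f \<Longrightarrow> continuous_on S g \<Longrightarrow> continuous_on S (\<lambda>x. qdet e (f x) (g x))"
  unfolding qdet_def by (intro continuous_intros)

lemma abs_gform_le:
  assumes "e = 1 \<or> e = - 1"
  shows "\<bar>gform e x y\<bar> \<le> norm x * norm y"
proof -
  have "gform e x y = (e * fst x, snd x) \<bullet> y" by (simp add: gform_def inner_prod_def)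
  moreover have "norm (e * fst x, snd x) = norm x"
    using assms by (cases x) (auto simp: norm_Pair)
  ultimately show ?thesis by (metis Cauchy_Schwarz_ineq2)
qed

lemma linear_scl: "linear (scl A B)"
  by (rule linearI) (auto simp: scl_def prod_eq_iff vec_eq_iff algebra_simps)

lemma scl_simps:
  "scl A B (x + y) = scl A B x + scl A B y"
  "scl A B (r *\<^sub>R x) = r *\<^sub>R scl A B x"
  "scl A B (x - y) = scl A B x - scl A B y"
  using linear_scl[of A B] by (simp_all add: linear_add linear_scale linear_diff)

lemma continuous_on_scl [continuous_intros]:
  "continuous_on S f \<Longrightarrow> continuous_on S (\<lambda>x. scl A B (f x))"
  unfolding scl_def by (intro continuous_intros)

lemma qform_scl:
  assumes "\<And>i. A i > 0" "B > 0"
  shows "qform A B (scl A B x) = mink x x"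
proof -
  have "(sqrt (A i) * t)\<^sup>2 / A i = t\<^sup>2" "(sqrt B * t)\<^sup>2 / B = t\<^sup>2" for i t
    using assms(1)[of i] assms(2) by (simp_all add: power_mult_distrib)
  then show ?thesis
    by (simp add: qform_def scl_def mink_def inner_vec_def flip: power2_eq_square)
qed

lemma scl_surj:
  assumes "\<And>i. A i > 0" "B > 0"
  obtains x where "p = scl A B x"
proof
  have "sqrt (A i) \<noteq> 0" for i using assms(1)[of i] by simp
  then show "p = scl A B (fst p / sqrt B, \<chi> i. snd p $ i / sqrt (A i))"
    using assms by (auto simp: scl_def prod_eq_iff vec_eq_iff)
qed

lemma scl_eq_iff:
  assumes "\<And>i. A i > 0" "B > 0"
  shows "scl A B x = scl A B y \<longleftrightarrow> x = y"
  using assms by (auto simp: scl_def prod_eq_iff vec_eq_iff) (metis less_irrefl)+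

lemma fst_scl_pos: "B > 0 \<Longrightarrow> fst (scl A B x) > 0 \<longleftrightarrow> fst x > 0"
  by (simp add: scl_def zero_less_mult_iff)

lemma qform_scaleR: "qform A B (r *\<^sub>R x) = r\<^sup>2 * qform A B x"
  by (simp add: qform_def power_mult_distrib sum_distrib_left right_diff_distrib)

lemma continuous_on_qform [continuous_intros]:
  "continuous_on S f \<Longrightarrow> continuous_on S (\<lambda>x. qform A B (f x))"
  unfolding qform_def divide_inverse by (intro continuous_intros)

text \<open>For \<open>e = - 1\<close>, replacing each \<open>A i\<close> by the larger
  \<open>B\<close> decreases the sum of squares, strictly unless all spatial coordinates
  vanish.\<close>

lemma timelike_of_qform:
  assumes adm: "admissible e A B" and q: "qform A B p \<le> 0" and p: "p \<noteq> 0"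
  shows "e * gform e p p > 0"
proof (cases "e = 1")
  case True
  then show ?thesis using p by (simp add: gform_1)
next
  case False
  then have e: "e = - 1" and A: "\<And>i. 0 < A i" "\<And>i. A i < B" "B > 0" using adm by (auto simp: admissible_def)
  have le: "(snd p $ i)\<^sup>2 / B \<le> (snd p $ i)\<^sup>2 / A i" for i
    using A(1)[of i] A(2)[of i] A(3) by (intro divide_left_mono) (auto simp: less_imp_le)
  have nn: "(norm (snd p))\<^sup>2 = (\<Sum>i\<in>UNIV. (snd p $ i)\<^sup>2)"
    unfolding power2_norm_eq_inner inner_vec_def by (simp add: power2_eq_square)
  have sum: "(norm (snd p))\<^sup>2 / B \<le> (fst p)\<^sup>2 / B \<and> (snd p \<noteq> 0 \<longrightarrow> (norm (snd p))\<^sup>2 / B < (fst p)\<^sup>2 / B)"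
  proof (intro conjI impI)
    have 1: "(\<Sum>i\<in>UNIV. (snd p $ i)\<^sup>2 / A i) \<le> (fst p)\<^sup>2 / B" using q by (simp add: qform_def)
    show "(norm (snd p))\<^sup>2 / B \<le> (fst p)\<^sup>2 / B"
      unfolding nn sum_divide_distrib using 1 by (intro order_trans[OF sum_mono[OF le]]) auto
    assume "snd p \<noteq> 0"
    then obtain j where j: "snd p $ j \<noteq> 0" by (auto simp: vec_eq_iff)
    have "(\<Sum>i\<in>UNIV. (snd p $ i)\<^sup>2 / B) < (\<Sum>i\<in>UNIV. (snd p $ i)\<^sup>2 / A i)"
    proof (rule sum_strict_mono_ex1)
      have "(snd p $ j)\<^sup>2 / B < (snd p $ j)\<^sup>2 / A j"
        using A(1)[of j] A(2)[of j] A(3) j by (intro divide_strict_left_mono) auto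
      then show "\<exists>i\<in>UNIV. (snd p $ i)\<^sup>2 / B < (snd p $ i)\<^sup>2 / A i" by blast
    qed (use le in auto)
    then show "(norm (snd p))\<^sup>2 / B < (fst p)\<^sup>2 / B"
      unfolding nn sum_divide_distrib using 1 by linarith
  qed
  have "(norm (snd p))\<^sup>2 < (fst p)\<^sup>2"
  proof (cases "snd p = 0")
    case True
    then have "fst p \<noteq> 0" using p by (simp add: prod_eq_iff)
    then show ?thesis using True by simp
  next
    case False
    then show ?thesis using sum A(3) by (simp add: divide_less_cancel)
  qed
  then show ?thesis by (simp add: e gform_def power2_norm_eq_inner power2_eq_square[of "fst p"])
qed

text \<open>For \<open>e = - 1\<close>, orthogonality and Cauchy-Schwarz for the spatial parts make
  \<open>fst w\<close> smaller than \<open>norm (snd w)\<close> in absolute value, because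
  \<open>fst p\<close> exceeds \<open>norm (snd p)\<close> in absolute value.\<close>

lemma gform_orthogonal_pos:
  assumes e: "e = 1 \<or> e = - 1" and p: "e * gform e p p > 0" and w: "gform e p w = 0" "w \<noteq> 0"
  shows "gform e w w > 0"
proof (cases "e = 1")
  case True
  then show ?thesis using w by (simp add: gform_1)
next
  case False
  then have e: "e = - 1" using e by simp
  have sp: "(norm (snd p))\<^sup>2 < (fst p)\<^sup>2"
    using p by (simp add: e gform_def power2_norm_eq_inner power2_eq_square[of "fst p"])
  then have lt: "norm (snd p) < \<bar>fst p\<bar>"
    by (metis abs_norm_cancel power2_abs power2_less_imp_less abs_ge_zero)
  have "\<bar>fst p\<bar> * \<bar>fst w\<bar> = \<bar>snd p \<bullet> snd w\<bar>"
    using w by (simp add: e gform_def abs_mult)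
  also have "\<dots> \<le> norm (snd p) * norm (snd w)" by (rule Cauchy_Schwarz_ineq2)
  finally have le: "\<bar>fst p\<bar> * \<bar>fst w\<bar> \<le> norm (snd p) * norm (snd w)" .
  have "snd w \<noteq> 0"
  proof
    assume "snd w = 0"
    then have "fst w = 0" using le lt by (auto simp: mult_le_0_iff)
    then show False using w \<open>snd w = 0\<close> by (simp add: prod_eq_iff)
  qed
  then have "norm (snd p) * norm (snd w) < \<bar>fst p\<bar> * norm (snd w)" using lt by simp
  with le have "\<bar>fst p\<bar> * \<bar>fst w\<bar> < \<bar>fst p\<bar> * norm (snd w)" by linarith
  then have "\<bar>fst w\<bar> < norm (snd w)" by (simp add: mult_less_cancel_left)
  then have "(fst w)\<^sup>2 < (norm (snd w))\<^sup>2"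
    by (metis abs_ge_zero power2_abs power_strict_mono zero_less_numeral)
  then show ?thesis by (simp add: e gform_def power2_norm_eq_inner power2_eq_square[of "fst w"])
qed

lemma qdet_add_scaleR: "qdet e p (r *\<^sub>R p + w) = qdet e p w"
  by (simp add: qdet_def gform_simps gform_commute[of e w p] algebra_simps power2_eq_square)

lemma qdet_scaleR: "qdet e p (r *\<^sub>R w) = r\<^sup>2 * qdet e p w"
  by (simp add: qdet_def gform_simps algebra_simps power2_eq_square)

text \<open>Subtracting from \<open>w\<close> its projection to \<open>p\<close> does not change the
  Gram determinant, which then is the product of the two diagonal entries.\<close>

lemma qdet_pos:
  assumes e: "e = 1 \<or> e = - 1" and p: "e * gform e p p > 0" and w: "\<And>r. w \<noteq> r *\<^sub>R p"
  shows "qdet e p w > 0"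
proof -
  have pp: "gform e p p \<noteq> 0" using p by auto
  define r where "r = gform e p w / gform e p p"
  define w' where "w' = w - r *\<^sub>R p"
  have o: "gform e p w' = 0" using pp by (simp add: w'_def r_def gform_simps)
  have "w' \<noteq> 0" using w by (simp add: w'_def)
  then have "gform e w' w' > 0" by (rule gform_orthogonal_pos[OF e p o])
  then have "e * gform e p p * gform e w' w' > 0" using p by simp
  moreover have "qdet e p w = qdet e p w'"
    using qdet_add_scaleR[of e p r w'] by (simp add: w'_def)
  moreover have "qdet e p w' = e * gform e p p * gform e w' w'" by (simp add: qdet_def o)
  ultimately show ?thesis by simp
qed

lemma timelike_pair_negative:
  assumes p: "- gform (- 1) p p > 0" "fst p > 0" and w: "- gform (- 1) w w > 0" "fst w > 0"
  shows "gform (- 1) p w < 0"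
proof -
  have lt: "norm (snd x) < fst x" if "- gform (- 1) x x > 0" "fst x > 0" for x :: "'a space"
  proof -
    have "(norm (snd x))\<^sup>2 < (fst x)\<^sup>2"
      using that by (simp add: gform_def power2_norm_eq_inner power2_eq_square[of "fst x"])
    then show ?thesis using that by (metis less_imp_le power2_less_imp_less)
  qed
  have "snd p \<bullet> snd w \<le> norm (snd p) * norm (snd w)" by (rule norm_cauchy_schwarz)
  also have "\<dots> < fst p * fst w"
    using lt[OF p] lt[OF w] by (intro mult_strict_mono') auto
  finally show ?thesis by (simp add: gform_def)
qed

text \<open>The normalized products of pairs of points away from the singularities of the kernel:
  the open interval from -1 to 1 for \<open>e = 1\<close>, everything below -1 for
  \<open>e = - 1\<close>.\<close>

definition kernel_domain :: "real \<Rightarrow> real set" where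
  "kernel_domain e = {\<sigma>. 0 < e * (1 - \<sigma>\<^sup>2) \<and> (e = - 1 \<longrightarrow> \<sigma> < 0)}"

lemma glen_power2: "e * gform e x x \<ge> 0 \<Longrightarrow> (glen e x)\<^sup>2 = e * gform e x x"
  by (simp add: glen_def)

lemma glen_pos: "e * gform e x x > 0 \<Longrightarrow> glen e x > 0"
  by (simp add: glen_def)

text \<open>The left side is the squared \<open>sin\<close> or \<open>sinh\<close> of the distance
  between the normalized points; so the singularity of the kernel becomes a zero of the Gram
  determinant, which is homogeneous in both vectors.\<close>

lemma normalized_gform:
  assumes e: "e = 1 \<or> e = - 1" and p: "e * gform e p p > 0" and w: "e * gform e w w > 0"
  shows "e * (1 - (gform e p w / (glen e p * glen e w))\<^sup>2) = qdet e p w / (glen e p * glen e w)\<^sup>2"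
proof -
  have "(glen e p * glen e w)\<^sup>2 = (e * gform e p p) * (e * gform e w w)"
    using p w by (simp add: power_mult_distrib glen_power2)
  also have "\<dots> = gform e p p * gform e w w" using e by auto
  finally have *: "(glen e p * glen e w)\<^sup>2 = gform e p p * gform e w w" .
  have "(glen e p * glen e w)\<^sup>2 \<noteq> 0" using glen_pos[OF p] glen_pos[OF w] by simp
  then show ?thesis
    by (simp add: power_divide qdet_def * right_diff_distrib diff_divide_distrib)
qed

lemma normalized_gform_in_domain:
  assumes e: "e = 1 \<or> e = - 1"
    and p: "e * gform e p p > 0" "fst p > 0" and w: "e * gform e w w > 0" "fst w > 0"
    and nw: "\<And>r. w \<noteq> r *\<^sub>R p"
  shows "gform e p w / (glen e p * glen e w) \<in> kernel_domain e"
proof -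
  have "qdet e p w > 0" using qdet_pos[OF e p(1) nw] .
  then have "qdet e p w / (glen e p * glen e w)\<^sup>2 > 0" using glen_pos[OF p(1)] glen_pos[OF w(1)] by simp
  moreover have "gform e p w / (glen e p * glen e w) < 0" if "e = - 1"
    using timelike_pair_negative[of p w] p w that glen_pos[OF p(1)] glen_pos[OF w(1)]
    by (auto simp: divide_less_0_iff mult_pos_pos zero_less_mult_iff)
  ultimately show ?thesis
    by (simp add: kernel_domain_def normalized_gform[OF e p(1) w(1)])
qed

text \<open>
  \<open>chart_vector\<close> is the inverse stereographic projection, written homogeneously so that it takes values
  in the light cone; the index \<open>m\<close> is the projection axis and \<open>\<iota>\<close> enumerates the other ones.
\<close>

locale stereographic =
  fixes \<iota> :: "'k::{finite,wellorder} \<Rightarrow> 'n::{finite,wellorder}" and m :: 'n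
  assumes inj_\<iota>: "inj \<iota>" and range_\<iota>: "range \<iota> = - {m}"
begin

definition emb :: "(real, 'k) vec \<Rightarrow> 'n space" where
  "emb d = (0, \<chi> i. if i = m then 0 else d $ inv \<iota> i)"

text \<open>Lightlike vectors: \<open>copole\<close> is the value of the chart at
  \<open>s = 0\<close>, and \<open>pole\<close> spans its limit direction as \<open>s\<close> tends
  to infinity.\<close>

definition pole :: "'n space" where "pole = (1, axis m 1)"

definition copole :: "'n space" where "copole = (1, - axis m 1)"

definition chart_vector :: "(real, 'k) vec \<Rightarrow> 'n space" where
  "chart_vector s = copole + 2 *\<^sub>R emb s + (norm s)\<^sup>2 *\<^sub>R pole"

lemma \<iota>_neq_m [simp]: "\<iota> j \<noteq> m" "m \<noteq> \<iota> j"
  using range_\<iota> by blast+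

lemma inv_\<iota> [simp]: "inv \<iota> (\<iota> j) = j"
  using inj_\<iota> by simp

lemma sum_split: "(\<Sum>i\<in>UNIV. f i) = f m + (\<Sum>j\<in>UNIV. f (\<iota> j))" for f :: "'n \<Rightarrow> real"
proof -
  have "(\<Sum>i\<in>UNIV. f i) = f m + (\<Sum>i\<in>range \<iota>. f i)"
    unfolding range_\<iota> by (subst sum.remove[of UNIV m]) (auto simp: Compl_eq_Diff_UNIV)
  then show ?thesis using inj_\<iota> by (simp add: sum.reindex)
qed

lemma prod_split: "(\<Prod>i\<in>UNIV. f i) = f m * (\<Prod>j\<in>UNIV. f (\<iota> j))" for f :: "'n \<Rightarrow> real"
proof -
  have "(\<Prod>i\<in>UNIV. f i) = f m * (\<Prod>i\<in>range \<iota>. f i)"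
    unfolding range_\<iota> by (subst prod.remove[of UNIV m]) (auto simp: Compl_eq_Diff_UNIV)
  then show ?thesis using inj_\<iota> by (simp add: prod.reindex)
qed

lemma card_n: "CARD('n) = CARD('k) + 1"
proof -
  have "UNIV = insert m (range \<iota>)" by (auto simp: range_\<iota>)
  then have "CARD('n) = card (insert m (range \<iota>))" by metis
  also have "\<dots> = card (range \<iota>) + 1" by (subst card_insert_disjoint) auto
  finally show ?thesis using inj_\<iota> by (simp add: card_image)
qed

lemma emb_simps:
  "emb (x + y) = emb x + emb y" "emb (x - y) = emb x - emb y" "emb (r *\<^sub>R x) = r *\<^sub>R emb x" "emb 0 = 0"
  by (auto simp: emb_def prod_eq_iff vec_eq_iff)

lemma linear_emb: "linear emb"
  by (rule linearI) (simp_all add: emb_simps)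

lemma continuous_on_emb [continuous_intros]:
  "continuous_on S f \<Longrightarrow> continuous_on S (\<lambda>x. emb (f x))"
  by (rule bounded_linear.continuous_on[OF linear_conv_bounded_linear[THEN iffD1, OF linear_emb]])

lemma continuous_on_chart_vector [continuous_intros]:
  "continuous_on S f \<Longrightarrow> continuous_on S (\<lambda>x. chart_vector (f x))"
  unfolding chart_vector_def by (intro continuous_intros)

lemma gform_basis:
  "gform e (emb x) (emb y) = x \<bullet> y" "gform e (emb x) pole = 0" "gform e pole (emb x) = 0"
  "gform e (emb x) copole = 0" "gform e copole (emb x) = 0"
  "gform e pole pole = 1 + e" "gform e copole copole = 1 + e"
  "gform e pole copole = e - 1" "gform e copole pole = e - 1"
  by (auto simp: gform_def emb_def pole_def copole_def inner_vec_def sum_split axis_def)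

lemma coordinates:
  obtains \<alpha> d \<beta> where "x = \<alpha> *\<^sub>R copole + 2 *\<^sub>R emb d + \<beta> *\<^sub>R pole"
proof
  have *: "i = m \<or> (\<exists>j. i = \<iota> j)" for i using range_\<iota> by blast
  show "x = ((fst x - snd x $ m) / 2) *\<^sub>R copole + 2 *\<^sub>R emb (\<chi> j. snd x $ \<iota> j / 2) + ((fst x + snd x $ m) / 2) *\<^sub>R pole"
    using * by (auto simp: prod_eq_iff vec_eq_iff emb_def pole_def copole_def axis_def field_simps)
      (metis inv_\<iota>)+
qed

lemma coordinates_eq_0_iff:
  "\<alpha> *\<^sub>R copole + emb d + \<beta> *\<^sub>R pole = 0 \<longleftrightarrow> \<alpha> = 0 \<and> d = 0 \<and> \<beta> = 0"
proof
  assume z: "\<alpha> *\<^sub>R copole + emb d + \<beta> *\<^sub>R pole = 0"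
  have "mink (\<alpha> *\<^sub>R copole + emb d + \<beta> *\<^sub>R pole) v = 0" for v unfolding z by (simp add: mink_def)
  from this[of pole] this[of copole] this[of "emb d"]
  show "\<alpha> = 0 \<and> d = 0 \<and> \<beta> = 0"
    by (simp add: gform_minus_1[symmetric] gform_simps gform_basis)
qed (simp add: emb_simps)

lemma fst_basis [simp]: "fst (emb d) = 0" "fst pole = 1" "fst copole = 1"
  by (simp_all add: emb_def pole_def copole_def)

lemma mink_coordinates:
  "mink (\<alpha> *\<^sub>R copole + 2 *\<^sub>R emb d + \<beta> *\<^sub>R pole) (\<alpha> *\<^sub>R copole + 2 *\<^sub>R emb d + \<beta> *\<^sub>R pole)
    = 4 * ((norm d)\<^sup>2 - \<alpha> * \<beta>)"
  by (simp add: gform_minus_1[symmetric] gform_simps gform_basis power2_norm_eq_inner algebra_simps)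

lemma mink_chart_vector: "mink (chart_vector s) (chart_vector s) = 0"
  using mink_coordinates[of 1 s "(norm s)\<^sup>2"] by (simp add: chart_vector_def)

lemma fst_chart_vector: "fst (chart_vector s) = 1 + (norm s)\<^sup>2"
  by (simp add: chart_vector_def)

text \<open>Expansion around an arbitrary point of the line through \<open>chart_vector c\<close> in
  direction \<open>pole\<close>; near the boundary that point is the field point, and Gram
  determinants ignore it.\<close>

lemma chart_vector_shift:
  "chart_vector s = (chart_vector c + t *\<^sub>R pole) + 2 *\<^sub>R emb (s - c) + ((norm s)\<^sup>2 - (norm c)\<^sup>2 - t) *\<^sub>R pole"
  by (simp add: chart_vector_def emb_simps algebra_simps)

text \<open>The pair \<open>(c, h)\<close> is the upper half-space coordinate of the ray of
  \<open>x\<close>; it becomes centre and radius of the inversion in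
  \<open>chord_inversion\<close>.\<close>

lemma timelike_decomposition:
  assumes "mink x x < 0" "fst x > 0"
  obtains \<mu> c h where "\<mu> > 0" "h > 0" "x = \<mu> *\<^sub>R (chart_vector c + h\<^sup>2 *\<^sub>R pole)"
proof -
  obtain \<alpha> d \<beta> where x: "x = \<alpha> *\<^sub>R copole + 2 *\<^sub>R emb d + \<beta> *\<^sub>R pole" by (rule coordinates)
  have lt: "(norm d)\<^sup>2 < \<alpha> * \<beta>" using assms(1) by (simp add: x mink_coordinates)
  moreover have "\<alpha> + \<beta> > 0" using assms(2) by (simp add: x)
  moreover have "0 \<le> (norm d)\<^sup>2" by simp
  ultimately have a: "\<alpha> > 0" by (smt (verit) mult_le_0_iff zero_less_mult_iff)
  define h where "h = sqrt (\<beta> / \<alpha> - (norm (d /\<^sub>R \<alpha>))\<^sup>2)"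
  have "(norm (d /\<^sub>R \<alpha>))\<^sup>2 = (norm d)\<^sup>2 / \<alpha>\<^sup>2" using a by (simp add: power_divide divide_inverse power_mult_distrib power_inverse mult.commute)
  also have "\<dots> < \<alpha> * \<beta> / \<alpha>\<^sup>2" using lt a by (intro divide_strict_right_mono) auto
  also have "\<dots> = \<beta> / \<alpha>" using a by (simp add: power2_eq_square)
  finally have pos: "\<beta> / \<alpha> - (norm (d /\<^sub>R \<alpha>))\<^sup>2 > 0" by simp
  then have h2: "h\<^sup>2 = \<beta> / \<alpha> - (norm (d /\<^sub>R \<alpha>))\<^sup>2" and h: "h > 0" by (auto simp: h_def)
  have "x = \<alpha> *\<^sub>R (chart_vector (d /\<^sub>R \<alpha>) + h\<^sup>2 *\<^sub>R pole)"
    using a by (simp add: x chart_vector_def emb_simps algebra_simps h2)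
  then show ?thesis using that a h by blast
qed

lemma lightlike_decomposition:
  assumes "mink x x = 0" "fst x > 0"
  obtains \<mu> where "\<mu> > 0" "x = \<mu> *\<^sub>R pole" | \<mu> c where "\<mu> > 0" "x = \<mu> *\<^sub>R chart_vector c"
proof -
  obtain \<alpha> d \<beta> where x: "x = \<alpha> *\<^sub>R copole + 2 *\<^sub>R emb d + \<beta> *\<^sub>R pole" by (rule coordinates)
  have eq: "(norm d)\<^sup>2 = \<alpha> * \<beta>" using assms(1) by (simp add: x mink_coordinates)
  have sum: "\<alpha> + \<beta> > 0" using assms(2) by (simp add: x)
  have "\<alpha> * \<beta> \<ge> 0" using eq by (metis zero_le_power2)
  with sum have a: "\<alpha> \<ge> 0" by (smt (verit) zero_le_mult_iff)
  show ?thesis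
  proof (cases "\<alpha> = 0")
    case True
    then show ?thesis using that(1)[of \<beta>] eq sum by (simp add: x emb_simps)
  next
    case False
    with a have a: "\<alpha> > 0" by simp
    define d' where "d' = d /\<^sub>R \<alpha>"
    have d: "d = \<alpha> *\<^sub>R d'" using a by (simp add: d'_def)
    have "\<beta> = \<alpha> * (norm d')\<^sup>2" using eq a by (simp add: d power_mult_distrib power2_eq_square[of \<alpha>])
    then have "x = \<alpha> *\<^sub>R chart_vector d'"
      by (simp add: x d chart_vector_def emb_simps algebra_simps)
    then show ?thesis using that(2) a by blast
  qed
qed

text \<open>In the chart, the ends of a chord through the point with half-space coordinates
  \<open>(c, h)\<close> lie on a line through \<open>c\<close>, on opposite sides, with product of
  distances \<open>h\<^sup>2\<close>. With weights 1 and \<open>r\<close> their mean is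
  \<open>c\<close>, and the identity is then checked on the components along \<open>copole\<close>,
  \<open>emb\<close> and \<open>pole\<close>.\<close>

lemma chord_inversion:
  assumes s: "s \<noteq> c" and h: "h > 0" and r: "r = (norm (s - c))\<^sup>2 / h\<^sup>2"
  shows "chart_vector s + r *\<^sub>R chart_vector (c - (h\<^sup>2 / (norm (s - c))\<^sup>2) *\<^sub>R (s - c))
    = (1 + r) *\<^sub>R (chart_vector c + h\<^sup>2 *\<^sub>R pole)"
proof -
  define d where "d = s - c"
  have r0: "r > 0" using s h by (simp add: r)
  have r': "h\<^sup>2 / (norm (s - c))\<^sup>2 = 1 / r" by (simp add: r)
  have sq: "(norm (x + y))\<^sup>2 = (norm x)\<^sup>2 + 2 * (x \<bullet> y) + (norm y)\<^sup>2" for x y :: "(real, 'k) vec"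
    by (simp add: power2_norm_eq_inner inner_add_left inner_add_right inner_commute)
  have sqm: "(norm (x - y))\<^sup>2 = (norm x)\<^sup>2 - 2 * (x \<bullet> y) + (norm y)\<^sup>2" for x y :: "(real, 'k) vec"
    by (simp add: power2_norm_eq_inner inner_diff_left inner_diff_right inner_commute)
  have dd: "(norm d)\<^sup>2 = r * h\<^sup>2" using h by (simp add: r d_def)
  have n1: "(norm s)\<^sup>2 = (norm c)\<^sup>2 + 2 * (c \<bullet> d) + r * h\<^sup>2"
    using sq[of c d] by (simp add: d_def[symmetric] dd) (simp add: d_def)
  have n2: "r * (norm (c - (1 / r) *\<^sub>R d))\<^sup>2 = r * (norm c)\<^sup>2 - 2 * (c \<bullet> d) + h\<^sup>2"
    using r0 by (simp add: sqm power_mult_distrib power_divide dd power2_eq_square[of r] algebra_simps)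
  have "chart_vector s + r *\<^sub>R chart_vector (c - (1 / r) *\<^sub>R d) =
    (1 + r) *\<^sub>R copole + 2 *\<^sub>R emb (s + r *\<^sub>R (c - (1 / r) *\<^sub>R d)) + ((norm s)\<^sup>2 + r * (norm (c - (1 / r) *\<^sub>R d))\<^sup>2) *\<^sub>R pole"
    by (simp only: chart_vector_def emb_simps) (simp add: algebra_simps)
  also have "s + r *\<^sub>R (c - (1 / r) *\<^sub>R d) = (1 + r) *\<^sub>R c"
    using r0 by (simp add: d_def algebra_simps)
  also have "(norm s)\<^sup>2 + r * (norm (c - (1 / r) *\<^sub>R d))\<^sup>2 = (1 + r) * ((norm c)\<^sup>2 + h\<^sup>2)"
    by (simp only: n1 n2) (simp add: algebra_simps)
  finally have "chart_vector s + r *\<^sub>R chart_vector (c - (1 / r) *\<^sub>R d)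
    = (1 + r) *\<^sub>R copole + 2 *\<^sub>R emb ((1 + r) *\<^sub>R c) + ((1 + r) * ((norm c)\<^sup>2 + h\<^sup>2)) *\<^sub>R pole" .
  then show ?thesis
    unfolding r' unfolding d_def[symmetric] by (simp add: chart_vector_def emb_simps algebra_simps)
qed

end

section \<open>The potential inside an ellipsoid\<close>

lemma compact_pos_lower_bound:
  fixes f :: "'a::topological_space \<Rightarrow> real"
  assumes "compact S" "continuous_on S f" "\<And>x. x \<in> S \<Longrightarrow> f x > 0"
  obtains \<kappa> where "\<kappa> > 0" "\<And>x. x \<in> S \<Longrightarrow> \<kappa> \<le> f x"
proof (cases "S = {}")
  case True
  then show ?thesis using that[of 1] by simp
next
  case False
  then obtain x where "x \<in> S" "\<forall>y\<in>S. f x \<le> f y"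
    using continuous_attains_inf[OF assms(1) _ assms(2)] by blast
  then show ?thesis using that[of "f x"] assms(3) by blast
qed

text \<open>The mean value inequality on the convex set \<open>S\<close> dominates the difference
  quotients by \<open>w\<close>. The derivative is taken within \<open>S\<close>, so that the end
  points of a segment are included.\<close>

lemma has_derivative_integral_dominated:
  fixes F :: "real \<Rightarrow> 'a \<Rightarrow> real"
  assumes t0: "t0 \<in> S" and S: "convex S"
    and deriv: "\<And>t s. t \<in> S \<Longrightarrow> s \<in> space M \<Longrightarrow> ((\<lambda>t. F t s) has_real_derivative D t s) (at t within S)"
    and bound: "\<And>t s. t \<in> S \<Longrightarrow> s \<in> space M \<Longrightarrow> \<bar>D t s\<bar> \<le> w s"
    and w: "integrable M w" and F: "\<And>t. t \<in> S \<Longrightarrow> integrable M (F t)"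
    and D: "D t0 \<in> borel_measurable M"
  shows "((\<lambda>t. \<integral>s. F t s \<partial>M) has_real_derivative (\<integral>s. D t0 s \<partial>M)) (at t0 within S)"
  unfolding has_field_derivative_iff tendsto_at_iff_sequentially
proof (intro allI impI)
  fix X assume X: "\<forall>i. X i \<in> S - {t0}" "X \<longlonglongrightarrow> t0"
  let ?q = "\<lambda>t s. (F t s - F t0 s) / (t - t0)"
  have eq: "(((\<lambda>t. ((\<integral>s. F t s \<partial>M) - (\<integral>s. F t0 s \<partial>M)) / (t - t0)) \<circ> X) i) = (\<integral>s. ?q (X i) s \<partial>M)" for i
    using X F[of "X i"] F[OF t0] by (simp add: Bochner_Integration.integral_diff)
  have "(\<lambda>i. \<integral>s. ?q (X i) s \<partial>M) \<longlonglongrightarrow> (\<integral>s. D t0 s \<partial>M)"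
  proof (rule integral_dominated_convergence[where w=w])
    show "AE s in M. (\<lambda>i. ?q (X i) s) \<longlonglongrightarrow> D t0 s"
    proof (rule AE_I2)
      fix s assume "s \<in> space M"
      from deriv[OF t0 this] have "((\<lambda>t. ?q t s) \<longlongrightarrow> D t0 s) (at t0 within S)"
        by (simp add: has_field_derivative_iff)
      then show "(\<lambda>i. ?q (X i) s) \<longlonglongrightarrow> D t0 s"
        unfolding tendsto_at_iff_sequentially using X by (auto simp: o_def)
    qed
    show "AE s in M. norm (?q (X i) s) \<le> w s" for i
    proof (rule AE_I2)
      fix s assume s: "s \<in> space M"
      have "norm (F (X i) s - F t0 s) \<le> w s * norm (X i - t0)"
        using X t0 by (intro field_differentiable_bound[OF S, of "\<lambda>t. F t s" "\<lambda>t. D t s"]) (auto intro: deriv[OF _ s] bound[OF _ s])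
      then show "norm (?q (X i) s) \<le> w s"
        using X by (simp add: divide_le_eq)
    qed
    show "?q (X i) \<in> borel_measurable M" for i
      using X F[of "X i"] F[OF t0] by (intro borel_measurable_divide borel_measurable_diff) auto
  qed (use D w in auto)
  then show "((\<lambda>t. ((\<integral>s. F t s \<partial>M) - (\<integral>s. F t0 s \<partial>M)) / (t - t0)) \<circ> X) \<longlonglongrightarrow> (\<integral>s. D t0 s \<partial>M)"
    unfolding eq[abs_def, symmetric] by (simp add: o_def)
qed

lemma integrable_norm_pole_decay_shift:
  "integrable lborel (\<lambda>s::'a::euclidean_space.
     norm (s - c) powr - (real DIM('a) - 1/2) * (1 + (norm (s - c))\<^sup>2) powr - (1/2))"
proof -
  have "integrable (distr lborel borel ((+) (- c))) (\<lambda>s::'a. norm s powr - (real DIM('a) - 1/2) * (1 + (norm s)\<^sup>2) powr - (1/2))"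
    using integrable_norm_pole_decay[where 'a='a] by (simp add: lborel_distr_plus)
  then show ?thesis by (subst (asm) integrable_distr_eq) (auto simp: add.commute[of "- c"])
qed

text \<open>Comparison with the preceding majorant: the dimension is at least 1, hence at least
  \<open>(DIM('a) - 1/2) / 2 + 1/2\<close>. This function will dominate the force integrand.\<close>

lemma integrable_decay:
  "integrable lborel (\<lambda>s::'a::euclidean_space. (1 + (norm s)\<^sup>2) powr - real DIM('a))"
proof (rule Bochner_Integration.integrable_bound[OF integrable_norm_pole_decay[where 'a='a]])
  have D: "real DIM('a) \<ge> 1" by (simp add: DIM_positive Suc_leI)
  have ex: "- x \<le> - ((x - 1/2) / 2) + - (1/2)" "0 \<le> (x - 1/2) / 2" if "x \<ge> 1" for x :: real
    using that by (simp_all add: field_simps)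
  show "AE s in (lborel :: 'a measure). norm ((1 + (norm s)\<^sup>2) powr - real DIM('a))
      \<le> norm (norm s powr - (real DIM('a) - 1/2) * (1 + (norm s)\<^sup>2) powr - (1/2))"
    using AE_lborel_singleton[of 0]
  proof eventually_elim
    fix s :: 'a assume s: "s \<noteq> 0"
    have "(1 + (norm s)\<^sup>2) powr - real DIM('a) \<le> (1 + (norm s)\<^sup>2) powr (- ((real DIM('a) - 1/2) / 2) + - (1/2))"
    proof (rule powr_mono)
      show "- real DIM('a) \<le> - ((real DIM('a) - 1/2) / 2) + - (1/2)" by (rule ex(1)[OF D])
    qed simp
    also have "\<dots> = (1 + (norm s)\<^sup>2) powr - ((real DIM('a) - 1/2) / 2) * (1 + (norm s)\<^sup>2) powr - (1/2)"
      by (rule powr_add)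
    also have "\<dots> \<le> ((norm s)\<^sup>2) powr - ((real DIM('a) - 1/2) / 2) * (1 + (norm s)\<^sup>2) powr - (1/2)"
      using ex(2)[OF D] s by (intro mult_right_mono powr_mono2') auto
    also have "((norm s)\<^sup>2) powr - ((real DIM('a) - 1/2) / 2) = norm s powr - (real DIM('a) - 1/2)"
    proof -
      have "(norm s)\<^sup>2 = norm s powr 2" using s by simp
      moreover have "2 * - ((x - 1/2) / 2) = - (x - 1/2)" for x :: real by (simp add: field_simps)
      ultimately show ?thesis by (simp only: powr_powr)
    qed
    finally show "norm ((1 + (norm s)\<^sup>2) powr - real DIM('a))
      \<le> norm (norm s powr - (real DIM('a) - 1/2) * (1 + (norm s)\<^sup>2) powr - (1/2))" by simp
  qed
qed simp

text \<open>What the argument uses of a point potential in either geometry: \<open>K_deriv\<close>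
  drives the cancellation of forces, \<open>K_bound\<close> the integrability of the
  potential.\<close>

locale kernel_potential = stereographic \<iota> m
  for \<iota> :: "'k::{finite,wellorder} \<Rightarrow> 'n::{finite,wellorder}" and m :: 'n +
  fixes e :: real and K :: "real \<Rightarrow> real"
  assumes K_deriv: "\<And>\<sigma>. \<sigma> \<in> kernel_domain e \<Longrightarrow> (K has_real_derivative (e * (1 - \<sigma>\<^sup>2)) powr - (real CARD('n) / 2)) (at \<sigma>)"
    and K_bound: "\<exists>C. \<forall>\<sigma>\<in>kernel_domain e. \<bar>K \<sigma>\<bar> \<le> C * (e * (1 - \<sigma>\<^sup>2)) powr - ((real CARD('n) - 3/2) / 2)"
begin

definition Z :: "('n \<Rightarrow> real) \<Rightarrow> real \<Rightarrow> (real, 'k) vec \<Rightarrow> 'n space" where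
  "Z A B s = scl A B (chart_vector s)"

definition charge_kernel :: "('n \<Rightarrow> real) \<Rightarrow> real \<Rightarrow> 'n space \<Rightarrow> (real, 'k) vec \<Rightarrow> real" where
  "charge_kernel A B p s = K (gform e p (Z A B s) / (glen e p * glen e (Z A B s))) / glen e (Z A B s) ^ CARD('k)"

text \<open>Closed form of the derivative of \<open>charge_kernel\<close> at \<open>p\<close> in
  direction \<open>v\<close>; the bracket pairs \<open>Z A B s\<close> with the component of
  \<open>v\<close> orthogonal to \<open>p\<close>.\<close>

definition charge_kernel_deriv :: "('n \<Rightarrow> real) \<Rightarrow> real \<Rightarrow> 'n space \<Rightarrow> 'n space \<Rightarrow> (real, 'k) vec \<Rightarrow> real" where
  "charge_kernel_deriv A B p v s = glen e p ^ CARD('k) *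
     (gform e v (Z A B s) - gform e p (Z A B s) * gform e p v / gform e p p) * qdet e p (Z A B s) powr - (real CARD('n) / 2)"

definition inside :: "('n \<Rightarrow> real) \<Rightarrow> real \<Rightarrow> 'n space \<Rightarrow> bool" where
  "inside A B p \<longleftrightarrow> qform A B p < 0 \<and> fst p > 0"

lemma continuous_on_Z [continuous_intros]:
  "continuous_on S f \<Longrightarrow> continuous_on S (\<lambda>x. Z A B (f x))"
  unfolding Z_def by (intro continuous_intros)

text \<open>Since \<open>e * e = 1\<close>, passing from \<open>A\<close>, \<open>B\<close> to
  \<open>A i - l\<close>, \<open>B + e * l\<close> changes the squared length of the scaled vector
  by \<open>- l * mink x x\<close>, which is 0 on the light cone. This is why the confocal parameter
  enters \<open>B\<close> with the sign \<open>e\<close>.\<close>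

lemma ivory_symmetry:
  assumes adm: "admissible e A B" and adm': "admissible e (\<lambda>i. A i - l) (B + e * l)" and Y: "mink Y Y = 0"
  shows "charge_kernel A B (scl (\<lambda>i. A i - l) (B + e * l) Y) s = charge_kernel (\<lambda>i. A i - l) (B + e * l) (scl A B Y) s"
proof -
  have e: "e * e = 1" and A: "\<And>i. A i > 0" "B > 0" and A': "\<And>i. A i - l > 0" "B + e * l > 0"
    using adm adm' by (auto simp: admissible_def)
  have len: "glen e (scl (\<lambda>i. A i - l) (B + e * l) x) = glen e (scl A B x)" if "mink x x = 0" for x
  proof -
    have q: "gform e (scl A' B' x) (scl A' B' x) = (\<Sum>i\<in>UNIV. A' i * (snd x $ i)\<^sup>2) + e * (B' * (fst x)\<^sup>2)"
      if "\<And>i. A' i > 0" "B' > 0" for A' :: "'n \<Rightarrow> real" and B'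
    proof -
      have "sqrt (A' i) * t * (sqrt (A' i) * t) = A' i * t\<^sup>2" "sqrt B' * t * (sqrt B' * t) = B' * t\<^sup>2" for i t
        using that(1)[of i] that(2) by (auto simp: power2_eq_square mult_ac)
      then show ?thesis by (simp add: gform_def scl_def inner_vec_def)
    qed
    have "(\<Sum>i\<in>UNIV. (snd x $ i)\<^sup>2) = (fst x)\<^sup>2"
      using that by (simp add: mink_def inner_vec_def power2_eq_square)
    then have "gform e (scl (\<lambda>i. A i - l) (B + e * l) x) (scl (\<lambda>i. A i - l) (B + e * l) x) = gform e (scl A B x) (scl A B x)"
      using e by (simp add: q[OF A] q[OF A'] left_diff_distrib sum_subtractf sum_distrib_left[symmetric] algebra_simps)
    then show ?thesis by (simp add: glen_def)
  qed
  have sym: "gform e (scl A' B' x) (scl A B y) = gform e (scl A B x) (scl A' B' y)" for A' B' x y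
    by (simp add: gform_def scl_def inner_vec_def mult_ac)
  show ?thesis
    unfolding charge_kernel_def Z_def sym[of _ _ Y] len[OF Y] len[OF mink_chart_vector] ..
qed

end

locale ellipsoid_potential = kernel_potential \<iota> m e K
  for \<iota> :: "'k::{finite,wellorder} \<Rightarrow> 'n::{finite,wellorder}" and m :: 'n and e :: real and K :: "real \<Rightarrow> real" +
  fixes A :: "'n \<Rightarrow> real" and B :: real
  assumes adm: "admissible e A B"
begin

lemma eps: "e = 1 \<or> e = - 1" using adm by (simp add: admissible_def)

lemma A_pos: "A i > 0" and B_pos: "B > 0" using adm by (auto simp: admissible_def)

lemma qform_Z: "qform A B (Z A B s) = 0"
  by (simp add: Z_def qform_scl A_pos B_pos mink_chart_vector)

lemma fst_Z: "fst (Z A B s) = sqrt B * (1 + (norm s)\<^sup>2)"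
  by (simp add: Z_def scl_def fst_chart_vector)

lemma fst_Z_pos: "fst (Z A B s) > 0"
  using B_pos by (simp add: fst_Z add_pos_nonneg)

lemma Z_neq_0: "Z A B s \<noteq> 0"
  using fst_Z_pos[of s] by auto

lemma Z_timelike: "e * gform e (Z A B s) (Z A B s) > 0"
  by (rule timelike_of_qform[OF adm]) (simp_all add: qform_Z Z_neq_0)

lemma norm_Z_ge: "norm (Z A B s) \<ge> sqrt B * (1 + (norm s)\<^sup>2)"
proof -
  have "norm (fst (Z A B s)) \<le> norm (Z A B s)" by (metis norm_fst_le prod.collapse)
  then show ?thesis using fst_Z_pos[of s] by (simp add: fst_Z)
qed

text \<open>All \<open>Z A B s\<close>, normalized, stay in this compact set; inequalities
  homogeneous in \<open>Z\<close> therefore hold with constants uniform in \<open>s\<close>, also as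
  \<open>s\<close> tends to infinity.\<close>

lemma unit_cone_compact: "compact {w. norm w = 1 \<and> qform A B w = 0}"
proof -
  have "{w. norm w = 1 \<and> qform A B w = 0} = sphere 0 1 \<inter> {w. qform A B w = 0}" by auto
  moreover have "closed {w. qform A B w = 0}"
    by (intro closed_Collect_eq continuous_intros)
  ultimately show ?thesis by (simp add: compact_Int_closed)
qed

lemma unit_cone_Z: "(1 / norm (Z A B s)) *\<^sub>R Z A B s \<in> {w. norm w = 1 \<and> qform A B w = 0}"
  using Z_neq_0[of s] by (simp add: qform_scaleR qform_Z)

lemma glen_Z_ge: obtains \<kappa> where "\<kappa> > 0" "\<And>s. \<kappa> * norm (Z A B s) \<le> glen e (Z A B s)"
proof -
  let ?W = "{w. norm w = 1 \<and> qform A B w = 0}"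
  have pos: "glen e w > 0" if "w \<in> ?W" for w
    using that by (intro glen_pos timelike_of_qform[OF adm]) auto
  obtain \<kappa> where k: "\<kappa> > 0" "\<And>w. w \<in> ?W \<Longrightarrow> \<kappa> \<le> glen e w"
    using compact_pos_lower_bound[OF unit_cone_compact continuous_on_glen[OF continuous_on_id] pos] by blast
  have "\<kappa> * norm (Z A B s) \<le> glen e (Z A B s)" for s
  proof -
    let ?n = "norm (Z A B s)"
    have n: "?n > 0" using Z_neq_0 by simp
    have "\<kappa> \<le> glen e ((1 / ?n) *\<^sub>R Z A B s)" using k(2) unit_cone_Z by blast
    also have "\<dots> = (1 / ?n) * glen e (Z A B s)"
      using n by (simp add: glen_def gform_simps real_sqrt_mult real_sqrt_divide)
    finally show ?thesis using n by (simp add: field_simps)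
  qed
  then show ?thesis using that k by blast
qed

lemma qdet_Z_ge:
  assumes P: "compact P" "\<And>p. p \<in> P \<Longrightarrow> inside A B p"
  obtains \<kappa> where "\<kappa> > 0" "\<And>p s. p \<in> P \<Longrightarrow> \<kappa> * (norm (Z A B s))\<^sup>2 \<le> qdet e p (Z A B s)"
proof -
  let ?W = "{w. norm w = 1 \<and> qform A B w = 0}"
  have pos: "qdet e (fst x) (snd x) > 0" if "x \<in> P \<times> ?W" for x
  proof (rule qdet_pos[OF eps])
    have i: "inside A B (fst x)" using that P by auto
    then have "fst x \<noteq> 0" by (auto simp: inside_def)
    with i show "e * gform e (fst x) (fst x) > 0"
      by (intro timelike_of_qform[OF adm]) (auto simp: inside_def)
    fix r show "snd x \<noteq> r *\<^sub>R fst x"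
    proof
      assume eq: "snd x = r *\<^sub>R fst x"
      have "r\<^sup>2 * qform A B (fst x) = 0" using that by (auto simp: eq[symmetric] qform_scaleR[symmetric])
      then have "r = 0" using i by (simp add: inside_def)
      then show False using that eq by auto
    qed
  qed
  have cpt: "compact (P \<times> ?W)" by (intro compact_Times P unit_cone_compact)
  have cont: "continuous_on (P \<times> ?W) (\<lambda>x. qdet e (fst x) (snd x))" by (intro continuous_intros)
  obtain \<kappa> where k: "\<kappa> > 0" "\<And>x. x \<in> P \<times> ?W \<Longrightarrow> \<kappa> \<le> qdet e (fst x) (snd x)"
    using compact_pos_lower_bound[OF cpt cont pos] by blast
  have "\<kappa> * (norm (Z A B s))\<^sup>2 \<le> qdet e p (Z A B s)" if "p \<in> P" for p s
  proof -
    let ?n = "norm (Z A B s)"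
    have n: "?n > 0" using Z_neq_0 by simp
    have "\<kappa> \<le> qdet e p ((1 / ?n) *\<^sub>R Z A B s)" using k(2)[of "(p, (1 / ?n) *\<^sub>R Z A B s)"] unit_cone_Z that by simp
    then show ?thesis using n by (simp add: qdet_scaleR power_divide field_simps)
  qed
  then show ?thesis using that k by blast
qed

lemma inside_timelike: "inside A B p \<Longrightarrow> e * gform e p p > 0"
  by (rule timelike_of_qform[OF adm]) (auto simp: inside_def)

lemma inside_not_proportional: "inside A B p \<Longrightarrow> Z A B s \<noteq> r *\<^sub>R p"
proof
  assume i: "inside A B p" and eq: "Z A B s = r *\<^sub>R p"
  have "r\<^sup>2 * qform A B p = 0" using qform_Z[of s] by (simp add: eq qform_scaleR)
  then show False using i Z_neq_0[of s] eq by (simp add: inside_def)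
qed

lemma charge_kernel_continuous:
  assumes "continuous_on S p" "continuous_on S z"
    and p: "\<And>x. x \<in> S \<Longrightarrow> e * gform e (p x) (p x) > 0" "\<And>x. x \<in> S \<Longrightarrow> fst (p x) > 0"
    and n: "\<And>x r. x \<in> S \<Longrightarrow> Z A B (z x) \<noteq> r *\<^sub>R p x"
  shows "continuous_on S (\<lambda>x. charge_kernel A B (p x) (z x))"
proof -
  have K: "continuous_on (kernel_domain e) K"
    using K_deriv by (meson DERIV_isCont continuous_at_imp_continuous_on)
  have nz: "glen e (Z A B (z x)) \<noteq> 0" "glen e (p x) \<noteq> 0" if "x \<in> S" for x
    using glen_pos[OF Z_timelike[of "z x"]] glen_pos[OF p(1)[OF that]] by auto
  show ?thesis
    unfolding charge_kernel_def
  proof (intro continuous_intros continuous_on_compose2[OF K] assms(1,2))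
    show "(\<lambda>x. gform e (p x) (Z A B (z x)) / (glen e (p x) * glen e (Z A B (z x)))) ` S \<subseteq> kernel_domain e"
      using normalized_gform_in_domain[OF eps p(1) p(2) Z_timelike fst_Z_pos n] by auto
  qed (use nz in auto)
qed

end

lemma power2_powr: "0 < x \<Longrightarrow> x\<^sup>2 powr b = x powr (2 * b)" for x :: real
proof -
  assume "0 < x"
  then have "x\<^sup>2 = x powr 2" by simp
  then show ?thesis by (simp only: powr_powr)
qed

context ellipsoid_potential begin

text \<open>This is \<open>K_bound\<close> with \<open>normalized_gform\<close> inserted. Since
  \<open>n - 3/2 = k - 1/2\<close>, the kernel gives the power \<open>k - 1/2\<close> of
  \<open>glen e (Z A B s)\<close>, and the division by its power \<open>k\<close> leaves
  \<open>- 1/2\<close>.\<close>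

lemma charge_kernel_bound:
  obtains C where "C \<ge> 0" "\<And>p s. e * gform e p p > 0 \<Longrightarrow> fst p > 0 \<Longrightarrow> (\<And>r. Z A B s \<noteq> r *\<^sub>R p) \<Longrightarrow>
    \<bar>charge_kernel A B p s\<bar> \<le> C * glen e p powr (real CARD('k) - 1/2) * glen e (Z A B s) powr - (1/2)
      * qdet e p (Z A B s) powr - ((real CARD('k) - 1/2) / 2)"
proof -
  define \<beta> where "\<beta> = (real CARD('k) - 1/2) / 2"
  have \<beta>: "(real CARD('n) - 3/2) / 2 = \<beta>" by (simp add: card_n \<beta>_def)
  have two_\<beta>: "2 * \<beta> = real CARD('k) - 1/2" by (simp add: \<beta>_def)
  obtain C where C: "\<And>\<sigma>. \<sigma> \<in> kernel_domain e \<Longrightarrow> \<bar>K \<sigma>\<bar> \<le> C * (e * (1 - \<sigma>\<^sup>2)) powr - \<beta>"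
    using K_bound unfolding \<beta> by blast
  show ?thesis
  proof (rule that[of "\<bar>C\<bar>"])
    fix p s assume p: "e * gform e p p > 0" "fst p > 0" and n: "\<And>r. Z A B s \<noteq> r *\<^sub>R p"
    let ?z = "glen e (Z A B s)" and ?g = "glen e p" and ?q = "qdet e p (Z A B s)"
    let ?\<sigma> = "gform e p (Z A B s) / (?g * ?z)"
    have pos: "?z > 0" "?g > 0" "?q > 0"
      using glen_pos[OF Z_timelike[of s]] glen_pos[OF p(1)] qdet_pos[OF eps p(1) n] by auto
    have "?\<sigma> \<in> kernel_domain e" by (rule normalized_gform_in_domain[OF eps p Z_timelike fst_Z_pos n])
    then have "\<bar>K ?\<sigma>\<bar> \<le> C * (e * (1 - ?\<sigma>\<^sup>2)) powr - \<beta>" by (rule C)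
    also have "\<dots> \<le> \<bar>C\<bar> * (e * (1 - ?\<sigma>\<^sup>2)) powr - \<beta>" by (intro mult_right_mono) auto
    also have "e * (1 - ?\<sigma>\<^sup>2) = ?q / (?g * ?z)\<^sup>2" by (rule normalized_gform[OF eps p(1) Z_timelike])
    also have "(?q / (?g * ?z)\<^sup>2) powr - \<beta> = ?q powr - \<beta> * (?g powr (2 * \<beta>) * ?z powr (2 * \<beta>))"
    proof -
      have "(?g * ?z)\<^sup>2 powr - \<beta> = (?g * ?z) powr (2 * - \<beta>)"
        using pos by (intro power2_powr) simp
      then have "(?q / (?g * ?z)\<^sup>2) powr - \<beta> = ?q powr - \<beta> / (?g * ?z) powr (2 * - \<beta>)"
        using pos by (simp add: powr_divide)
      also have "(?g * ?z) powr (2 * - \<beta>) = inverse (?g powr (2 * \<beta>) * ?z powr (2 * \<beta>))"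
        using pos by (simp add: powr_minus powr_mult)
      finally show ?thesis by (simp add: divide_inverse)
    qed
    finally have "\<bar>charge_kernel A B p s\<bar> \<le> \<bar>C\<bar> * (?q powr - \<beta> * (?g powr (2 * \<beta>) * ?z powr (2 * \<beta>))) / ?z ^ CARD('k)"
      using pos by (simp add: charge_kernel_def divide_right_mono)
    also have "\<dots> = \<bar>C\<bar> * ?g powr (2 * \<beta>) * (?z powr (2 * \<beta>) / ?z powr real CARD('k)) * ?q powr - \<beta>"
      using pos by (simp add: powr_realpow)
    also have "?z powr (2 * \<beta>) / ?z powr real CARD('k) = ?z powr - (1/2)"
    proof -
      have "2 * \<beta> - real CARD('k) = - (1/2)" by (simp add: \<beta>_def field_simps)
      then show ?thesis by (simp only: powr_diff[symmetric])
    qed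
    finally show "\<bar>charge_kernel A B p s\<bar> \<le> \<bar>C\<bar> * ?g powr (real CARD('k) - 1/2) * ?z powr - (1/2)
      * ?q powr - ((real CARD('k) - 1/2) / 2)" unfolding two_\<beta> unfolding \<beta>_def .
  qed simp
qed

text \<open>The hypothesis on \<open>qdet\<close> is shaped for two uses: a single interior point,
  with \<open>c = 0\<close>, and a segment that ends at the boundary point over \<open>c\<close>,
  where a pole at \<open>s = c\<close> is genuine.\<close>

lemma charge_kernel_dominated:
  assumes p: "\<And>p. p \<in> P \<Longrightarrow> e * gform e p p > 0" "\<And>p. p \<in> P \<Longrightarrow> fst p > 0"
    and G: "\<And>p. p \<in> P \<Longrightarrow> glen e p \<le> G"
    and \<kappa>: "\<kappa> > 0" "\<And>p s. p \<in> P \<Longrightarrow> \<kappa> * (norm (s - c))\<^sup>2 \<le> qdet e p (Z A B s)"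
  obtains C where "\<And>p s. p \<in> P \<Longrightarrow> s \<noteq> c \<Longrightarrow> \<bar>charge_kernel A B p s\<bar>
    \<le> C * (norm (s - c) powr - (real CARD('k) - 1/2) * (1 + (norm (s - c))\<^sup>2) powr - (1/2))"
proof -
  define \<beta> where "\<beta> = (real CARD('k) - 1/2) / 2"
  have "real CARD('k) \<ge> 1" by (simp add: Suc_leI)
  moreover have "0 < (x - 1/2) / 2 \<and> x - 1/2 = 2 * ((x - 1/2) / 2)" if "x \<ge> 1" for x :: real
    using that by (simp add: field_simps)
  ultimately have \<beta>: "\<beta> > 0" "real CARD('k) - 1/2 = 2 * \<beta>" unfolding \<beta>_def by blast+
  obtain C0 where C0: "C0 \<ge> 0" and bound: "\<And>p s. e * gform e p p > 0 \<Longrightarrow> fst p > 0 \<Longrightarrow> (\<And>r. Z A B s \<noteq> r *\<^sub>R p) \<Longrightarrow>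
    \<bar>charge_kernel A B p s\<bar> \<le> C0 * glen e p powr (real CARD('k) - 1/2) * glen e (Z A B s) powr - (1/2)
      * qdet e p (Z A B s) powr - ((real CARD('k) - 1/2) / 2)"
    using charge_kernel_bound by blast
  obtain k where k: "k > 0" "\<And>s. k * norm (Z A B s) \<le> glen e (Z A B s)" using glen_Z_ge by blast
  \<comment> \<open>The denominator comes from comparing \<open>1 + (norm (s - c))\<^sup>2\<close>
    with \<open>(2 + 2 * (norm c)\<^sup>2) * (1 + (norm s)\<^sup>2)\<close>.\<close>
  define k' where "k' = k * sqrt B / (2 + 2 * (norm c)\<^sup>2)"
  have "2 + 2 * (norm c)\<^sup>2 > 0" by (simp add: add_pos_nonneg)
  then have k': "k' > 0" using k(1) B_pos by (simp add: k'_def)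
  have gz: "k' * (1 + (norm (s - c))\<^sup>2) \<le> glen e (Z A B s)" for s
  proof -
    have "norm (s - c) \<le> norm s + norm c" by (rule norm_triangle_ineq4)
    then have "(norm (s - c))\<^sup>2 \<le> (norm s + norm c)\<^sup>2" by (intro power_mono) auto
    also have "\<dots> \<le> 2 * (norm s)\<^sup>2 + 2 * (norm c)\<^sup>2"
      using sum_squares_ge_zero[of "norm s - norm c" 0] by (simp add: power2_eq_square algebra_simps)
    finally have "1 + (norm (s - c))\<^sup>2 \<le> 2 * (norm s)\<^sup>2 + 2 * (norm c)\<^sup>2 + 2" by simp
    also have "\<dots> \<le> (2 + 2 * (norm c)\<^sup>2) * (1 + (norm s)\<^sup>2)" by (simp add: algebra_simps)
    finally have "k' * (1 + (norm (s - c))\<^sup>2) \<le> k' * ((2 + 2 * (norm c)\<^sup>2) * (1 + (norm s)\<^sup>2))"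
      using k' by (intro mult_left_mono) auto
    also have "\<dots> = k * (sqrt B * (1 + (norm s)\<^sup>2))"
      using \<open>2 + 2 * (norm c)\<^sup>2 > 0\<close> by (simp add: k'_def)
    also have "\<dots> \<le> k * norm (Z A B s)" using k(1) norm_Z_ge[of s] by simp
    also have "\<dots> \<le> glen e (Z A B s)" by (rule k)
    finally show ?thesis .
  qed
  show ?thesis
  proof (rule that[of "C0 * G powr (2 * \<beta>) * k' powr - (1/2) * \<kappa> powr - \<beta>"])
    fix p s assume pP: "p \<in> P" and s: "s \<noteq> c"
    have d: "norm (s - c) > 0" using s by simp
    have "qdet e p (r *\<^sub>R p) = 0" for r using qdet_add_scaleR[of e p r 0] by (simp add: qdet_def gform_simps)
    moreover have "0 < \<kappa> * (norm (s - c))\<^sup>2" using \<kappa>(1) d by simp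
    ultimately have n: "Z A B s \<noteq> r *\<^sub>R p" for r
      using \<kappa>(2)[OF pP, of s] by (metis not_le)
    have "\<bar>charge_kernel A B p s\<bar> \<le> C0 * glen e p powr (2 * \<beta>) * glen e (Z A B s) powr - (1/2) * qdet e p (Z A B s) powr - \<beta>"
      using bound[OF p(1)[OF pP] p(2)[OF pP] n] unfolding \<beta>_def[symmetric] \<beta>(2) by simp
    also have "\<dots> \<le> C0 * G powr (2 * \<beta>) * (k' * (1 + (norm (s - c))\<^sup>2)) powr - (1/2) * (\<kappa> * (norm (s - c))\<^sup>2) powr - \<beta>"
    proof (intro mult_mono)
      show "glen e p powr (2 * \<beta>) \<le> G powr (2 * \<beta>)"
        using G[OF pP] glen_pos[OF p(1)[OF pP]] \<beta> by (intro powr_mono2) auto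
      show "glen e (Z A B s) powr - (1/2) \<le> (k' * (1 + (norm (s - c))\<^sup>2)) powr - (1/2)"
        using gz[of s] k' by (intro powr_mono2') (auto simp: add_pos_nonneg)
      show "qdet e p (Z A B s) powr - \<beta> \<le> (\<kappa> * (norm (s - c))\<^sup>2) powr - \<beta>"
        using \<kappa>(2)[OF pP, of s] \<kappa>(1) d \<beta> by (intro powr_mono2') auto
    qed (use C0 in auto)
    also have "(\<kappa> * (norm (s - c))\<^sup>2) powr - \<beta> = \<kappa> powr - \<beta> * norm (s - c) powr - (2 * \<beta>)"
    proof -
      have "(norm (s - c))\<^sup>2 powr - \<beta> = norm (s - c) powr (2 * - \<beta>)" using d by (rule power2_powr)
      then show ?thesis using \<kappa>(1) by (simp add: powr_mult)
    qed
    also have "(k' * (1 + (norm (s - c))\<^sup>2)) powr - (1/2) = k' powr - (1/2) * (1 + (norm (s - c))\<^sup>2) powr - (1/2)"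
      using k' by (simp add: powr_mult)
    finally show "\<bar>charge_kernel A B p s\<bar> \<le> C0 * G powr (2 * \<beta>) * k' powr - (1/2) * \<kappa> powr - \<beta> *
        (norm (s - c) powr - (real CARD('k) - 1/2) * (1 + (norm (s - c))\<^sup>2) powr - (1/2))"
      unfolding \<beta>(2) by (simp add: mult_ac)
  qed
qed

text \<open>The exponent \<open>n / 2\<close> with \<open>n = k + 1\<close> makes all powers of
  \<open>glen e (Z A B s)\<close> cancel, so the derivative involves \<open>Z\<close> only through
  one linear factor and the Gram determinant.\<close>

lemma charge_kernel_has_derivative:
  assumes p: "inside A B (p0 + t *\<^sub>R v)"
  shows "((\<lambda>t. charge_kernel A B (p0 + t *\<^sub>R v) s) has_real_derivative charge_kernel_deriv A B (p0 + t *\<^sub>R v) v s) (at t)"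
proof -
  define z where "z = Z A B s"
  define p where "p = p0 + t *\<^sub>R v"
  define N where "N = (\<lambda>t. gform e (p0 + t *\<^sub>R v) (p0 + t *\<^sub>R v))"
  have i: "inside A B p" using p by (simp add: p_def)
  have tp: "e * gform e p p > 0" and fp: "fst p > 0" using inside_timelike[OF i] i by (auto simp: inside_def)
  have tz: "e * gform e z z > 0" and fz: "fst z > 0" by (simp_all add: z_def Z_timelike fst_Z_pos)
  have gp: "glen e p > 0" and gz: "glen e z > 0" using glen_pos tp tz by blast+
  have nz: "z \<noteq> r *\<^sub>R p" for r unfolding z_def by (rule inside_not_proportional[OF i])
  let ?\<sigma> = "gform e p z / (glen e p * glen e z)"
  have dom: "?\<sigma> \<in> kernel_domain e" by (rule normalized_gform_in_domain[OF eps tp fp tz fz nz])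
  have q: "qdet e p z > 0" by (rule qdet_pos[OF eps tp nz])
  have dnum: "((\<lambda>t. gform e (p0 + t *\<^sub>R v) z) has_real_derivative gform e v z) (at t)"
    by (auto simp: gform_simps intro!: derivative_eq_intros)
  have dN: "((\<lambda>t. e * gform e (p0 + t *\<^sub>R v) (p0 + t *\<^sub>R v)) has_real_derivative e * (2 * gform e p v)) (at t)"
    by (auto simp: gform_simps gform_commute[of e v p0] p_def algebra_simps intro!: derivative_eq_intros)
  have half: "(inverse x / 2) * (e * (2 * y)) = e * y / x" for x y :: real
    by (cases "x = 0") (auto simp: field_simps)
  have dlen: "((\<lambda>t. glen e (p0 + t *\<^sub>R v)) has_real_derivative e * gform e p v / glen e p) (at t)"
  proof -
    have "((\<lambda>t. sqrt (e * gform e (p0 + t *\<^sub>R v) (p0 + t *\<^sub>R v))) has_real_derivative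
      (inverse (sqrt (e * gform e (p0 + t *\<^sub>R v) (p0 + t *\<^sub>R v))) / 2) * (e * (2 * gform e p v))) (at t)"
      using tp by (intro DERIV_chain2[OF DERIV_real_sqrt dN]) (simp add: p_def)
    moreover have "(inverse (sqrt (e * gform e p p)) / 2) * (e * (2 * gform e p v)) = e * gform e p v / sqrt (e * gform e p p)"
      using half[of "sqrt (e * gform e p p)" "gform e p v"] .
    ultimately show ?thesis unfolding glen_def p_def[symmetric] by (simp only:)
  qed
  have d\<sigma>: "((\<lambda>t. gform e (p0 + t *\<^sub>R v) z / (glen e (p0 + t *\<^sub>R v) * glen e z)) has_real_derivative
    (gform e v z * (glen e p * glen e z) - gform e p z * (e * gform e p v / glen e p * glen e z)) / ((glen e p * glen e z) * (glen e p * glen e z))) (at t)"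
    using DERIV_divide[OF dnum DERIV_cmult_right[OF dlen, of "glen e z"]] gp gz by (simp add: p_def[symmetric])
  have "((\<lambda>t. K (gform e (p0 + t *\<^sub>R v) z / (glen e (p0 + t *\<^sub>R v) * glen e z)) / glen e z ^ CARD('k)) has_real_derivative
    ((e * (1 - ?\<sigma>\<^sup>2)) powr - (real CARD('n) / 2) *
      ((gform e v z * (glen e p * glen e z) - gform e p z * (e * gform e p v / glen e p * glen e z)) / ((glen e p * glen e z) * (glen e p * glen e z)))) / glen e z ^ CARD('k)) (at t)"
    using K_deriv[OF dom] by (intro DERIV_cdivide DERIV_chain2[OF _ d\<sigma>]) (simp add: p_def)
  moreover have "((e * (1 - ?\<sigma>\<^sup>2)) powr - (real CARD('n) / 2) *
      ((gform e v z * (glen e p * glen e z) - gform e p z * (e * gform e p v / glen e p * glen e z)) / ((glen e p * glen e z) * (glen e p * glen e z)))) / glen e z ^ CARD('k)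
    = charge_kernel_deriv A B p v s"
  proof -
    have "(e * (1 - ?\<sigma>\<^sup>2)) powr - (real CARD('n) / 2) = (qdet e p z / (glen e p * glen e z)\<^sup>2) powr - (real CARD('n) / 2)"
      by (simp add: normalized_gform[OF eps tp tz])
    also have "\<dots> = qdet e p z powr - (real CARD('n) / 2) * (glen e p * glen e z) ^ (CARD('k) + 1)"
    proof -
      have "(glen e p * glen e z)\<^sup>2 powr (real CARD('n) / 2) = (glen e p * glen e z) powr (2 * (real CARD('n) / 2))"
        using gp gz by (intro power2_powr) simp
      also have "2 * (real CARD('n) / 2) = real (CARD('k) + 1)" by (simp add: card_n field_simps)
      also have "(glen e p * glen e z) powr real (CARD('k) + 1) = (glen e p * glen e z) ^ (CARD('k) + 1)" using gp gz by (intro powr_realpow) simp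
      finally show ?thesis using q gp gz by (simp add: powr_divide powr_minus_divide)
    qed
    finally have 1: "(e * (1 - ?\<sigma>\<^sup>2)) powr - (real CARD('n) / 2) = qdet e p z powr - (real CARD('n) / 2) * (glen e p * glen e z) ^ (CARD('k) + 1)" .
    have ee: "gform e p p = e * (glen e p)\<^sup>2"
      using glen_power2[of e p] tp eps by auto
    have 2: "gform e v z - gform e p z * gform e p v / gform e p p = gform e v z - e * gform e p z * gform e p v / (glen e p)\<^sup>2"
      unfolding ee using eps by auto
    have "Q * (x * y) ^ (j + 1) * ((V * (x * y) - P * (e * W / x * y)) / ((x * y) * (x * y))) / y ^ j
        = x ^ j * (V - e * P * W / x\<^sup>2) * Q" if "x > 0" "y > 0" for x y P W V Q :: real and j
      using that by (simp add: power_mult_distrib power2_eq_square field_simps)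
    from this[OF gp gz] show ?thesis unfolding 1 charge_kernel_deriv_def z_def[symmetric] 2 .
  qed
  ultimately show ?thesis
    unfolding charge_kernel_def z_def[symmetric] p_def[symmetric] by simp
qed

lemma charge_kernel_deriv_continuous:
  assumes "inside A B p"
  shows "continuous_on UNIV (charge_kernel_deriv A B p v)"
  unfolding charge_kernel_deriv_def
proof (intro continuous_intros)
  have "qdet e p (Z A B s) > 0" for s
    by (rule qdet_pos[OF eps inside_timelike[OF assms] inside_not_proportional[OF assms]])
  then show "\<forall>s\<in>UNIV. qdet e p (Z A B s) \<noteq> 0" by (metis less_irrefl)
qed (use inside_timelike[OF assms] in auto)

text \<open>The linear factor is at most a multiple of \<open>norm (Z A B s)\<close> and
  \<open>qdet\<close> at least a multiple of its square; together this gives the power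
  \<open>1 - n = - k\<close>, and \<open>norm (Z A B s)\<close> grows at least like
  \<open>1 + (norm s)\<^sup>2\<close>.\<close>

lemma charge_kernel_deriv_bound:
  assumes P: "compact P" "\<And>p. p \<in> P \<Longrightarrow> inside A B p"
  obtains C where "\<And>p s. p \<in> P \<Longrightarrow> \<bar>charge_kernel_deriv A B p v s\<bar> \<le> C * (1 + (norm s)\<^sup>2) powr - real CARD('k)"
proof -
  obtain \<kappa> where \<kappa>: "\<kappa> > 0" "\<And>p s. p \<in> P \<Longrightarrow> \<kappa> * (norm (Z A B s))\<^sup>2 \<le> qdet e p (Z A B s)"
    using qdet_Z_ge[OF P] by blast
  let ?u = "\<lambda>p. glen e p ^ CARD('k) * norm (v - (gform e p v / gform e p p) *\<^sub>R p)"
  have nz: "gform e p p \<noteq> 0" if "p \<in> P" for p using inside_timelike[OF P(2)[OF that]] by auto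
  have "continuous_on P ?u" using nz by (intro continuous_intros) auto
  then have "compact (?u ` P)" using P(1) by (rule compact_continuous_image)
  then obtain M where M: "\<And>p. p \<in> P \<Longrightarrow> \<bar>?u p\<bar> \<le> M"
    using compact_imp_bounded[of "?u ` P"] by (auto simp: bounded_iff)
  let ?c = "\<bar>M\<bar> * \<kappa> powr - (real CARD('n) / 2) * sqrt B powr - real CARD('k)"
  show ?thesis
  proof (rule that[of ?c])
    fix p s assume p: "p \<in> P"
    let ?z = "Z A B s"
    have n: "norm ?z > 0" using Z_neq_0 by simp
    have q: "qdet e p ?z powr - (real CARD('n) / 2) \<le> (\<kappa> * (norm ?z)\<^sup>2) powr - (real CARD('n) / 2)"
      using \<kappa>(2)[OF p, of s] \<kappa>(1) n by (intro powr_mono2') auto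
    also have "\<dots> = \<kappa> powr - (real CARD('n) / 2) * norm ?z powr (2 * - (real CARD('n) / 2))"
      using \<kappa>(1) power2_powr[OF n] by (simp add: powr_mult)
    also have "2 * - (real CARD('n) / 2) = - real CARD('k) - 1" by (simp add: card_n field_simps)
    finally have q: "qdet e p ?z powr - (real CARD('n) / 2) \<le> \<kappa> powr - (real CARD('n) / 2) * norm ?z powr (- real CARD('k) - 1)" .
    have "gform e v ?z - gform e p ?z * gform e p v / gform e p p = gform e (v - (gform e p v / gform e p p) *\<^sub>R p) ?z"
      by (simp add: gform_simps)
    then have g: "\<bar>gform e v ?z - gform e p ?z * gform e p v / gform e p p\<bar> \<le> norm (v - (gform e p v / gform e p p) *\<^sub>R p) * norm ?z"
      using abs_gform_le[OF eps] by simp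
    have gp: "glen e p > 0" by (rule glen_pos[OF inside_timelike[OF P(2)[OF p]]])
    have "\<bar>charge_kernel_deriv A B p v s\<bar> = glen e p ^ CARD('k) * \<bar>gform e v ?z - gform e p ?z * gform e p v / gform e p p\<bar>
        * qdet e p ?z powr - (real CARD('n) / 2)"
      using gp by (simp add: charge_kernel_deriv_def abs_mult)
    also have "\<dots> \<le> glen e p ^ CARD('k) * (norm (v - (gform e p v / gform e p p) *\<^sub>R p) * norm ?z)
        * (\<kappa> powr - (real CARD('n) / 2) * norm ?z powr (- real CARD('k) - 1))"
      using g q gp by (intro mult_mono mult_left_mono) auto
    also have "\<dots> = ?u p * \<kappa> powr - (real CARD('n) / 2) * (norm ?z * norm ?z powr (- real CARD('k) - 1))"
      by (simp add: mult_ac)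
    also have "norm ?z * norm ?z powr (- real CARD('k) - 1) = norm ?z powr - real CARD('k)"
      using n by (simp add: powr_diff)
    also have "?u p * \<kappa> powr - (real CARD('n) / 2) * norm ?z powr - real CARD('k)
      \<le> \<bar>M\<bar> * \<kappa> powr - (real CARD('n) / 2) * (sqrt B * (1 + (norm s)\<^sup>2)) powr - real CARD('k)"
    proof (intro mult_mono)
      show "?u p \<le> \<bar>M\<bar>" using M[OF p] by linarith
      show "norm ?z powr - real CARD('k) \<le> (sqrt B * (1 + (norm s)\<^sup>2)) powr - real CARD('k)"
        using norm_Z_ge[of s] B_pos by (intro powr_mono2') (auto simp: add_pos_nonneg)
    qed auto
    also have "(sqrt B * (1 + (norm s)\<^sup>2)) powr - real CARD('k) = sqrt B powr - real CARD('k) * (1 + (norm s)\<^sup>2) powr - real CARD('k)"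
      using B_pos by (simp add: powr_mult)
    finally show "\<bar>charge_kernel_deriv A B p v s\<bar> \<le> ?c * (1 + (norm s)\<^sup>2) powr - real CARD('k)"
      by (simp add: mult_ac)
  qed
qed

lemma integrable_decay_vec: "integrable lborel (\<lambda>s::(real, 'k) vec. (1 + (norm s)\<^sup>2) powr - real CARD('k))"
  using integrable_decay[where 'a="(real, 'k) vec"] by simp

lemma charge_kernel_deriv_integrable:
  assumes p: "inside A B p"
  shows "integrable lborel (charge_kernel_deriv A B p v)"
proof -
  obtain C where C: "\<And>p' s. p' \<in> {p} \<Longrightarrow> \<bar>charge_kernel_deriv A B p' v s\<bar> \<le> C * (1 + (norm s)\<^sup>2) powr - real CARD('k)"
    by (rule charge_kernel_deriv_bound[of "{p}" v]) (use p in auto)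
  show ?thesis
  proof (rule Bochner_Integration.integrable_bound[OF integrable_mult_right[OF integrable_decay_vec, of C]])
    show "charge_kernel_deriv A B p v \<in> borel_measurable lborel"
      using borel_measurable_continuous_onI[OF charge_kernel_deriv_continuous[OF p]] by simp
    show "AE s in lborel. norm (charge_kernel_deriv A B p v s) \<le> norm (C * (1 + (norm s)\<^sup>2) powr - real CARD('k))"
      using C[of p] by (intro AE_I2) (simp, meson abs_ge_self order_trans)
  qed
qed

text \<open>
  Each line through \<open>p\<close> meets the cone in two opposite charges whose contributions to the force at \<open>p\<close>
  cancel; in the chart the involution exchanging them is an inversion.
\<close>

lemma integral_charge_kernel_deriv:
  assumes p: "inside A B p"
  shows "integral\<^sup>L lborel (charge_kernel_deriv A B p v) = 0"
proof -
  obtain x where x: "p = scl A B x" using scl_surj[of A B p] A_pos B_pos by blast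
  have "mink x x < 0" "fst x > 0"
    using p fst_scl_pos[OF B_pos, of A x] qform_scl[of A B x] A_pos B_pos by (auto simp: inside_def x)
  then obtain \<mu> c h where mu: "\<mu> > 0" "h > 0" "x = \<mu> *\<^sub>R (chart_vector c + h\<^sup>2 *\<^sub>R pole)"
    by (rule timelike_decomposition)
  show ?thesis
  proof (rule integral_eq_0_by_inversion[OF mu(2) charge_kernel_deriv_integrable[OF p]])
    fix s assume s: "s \<noteq> c"
    define r where "r = (norm (s - c))\<^sup>2 / h\<^sup>2"
    have r: "r > 0" using s mu by (simp add: r_def)
    define s' where "s' = c - (h\<^sup>2 / (norm (s - c))\<^sup>2) *\<^sub>R (s - c)"
    have "chart_vector s + r *\<^sub>R chart_vector s' = ((1 + r) / \<mu>) *\<^sub>R x"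
      using chord_inversion[OF s mu(2) r_def] mu(1) by (simp add: s'_def mu(3))
    then have "scl A B (chart_vector s + r *\<^sub>R chart_vector s') = scl A B (((1 + r) / \<mu>) *\<^sub>R x)" by simp
    then have "Z A B s + r *\<^sub>R Z A B s' = ((1 + r) / \<mu>) *\<^sub>R p"
      by (simp add: Z_def x scl_simps)
    then have "r *\<^sub>R Z A B s' = ((1 + r) / \<mu>) *\<^sub>R p - Z A B s"
      by (metis add_diff_cancel_left')
    then have "(1 / r) *\<^sub>R (r *\<^sub>R Z A B s') = (1 / r) *\<^sub>R (((1 + r) / \<mu>) *\<^sub>R p - Z A B s)"
      by simp
    \<comment> \<open>Modulo \<open>p\<close>, the other end of the chord is
      \<open>- (1 / r)\<close> times \<open>Z A B s\<close>, and both factors of the integrand see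
      \<open>Z\<close> only modulo \<open>p\<close>.\<close>
    then have Z': "Z A B s' = ((1 / r) * ((1 + r) / \<mu>)) *\<^sub>R p + (- (1 / r)) *\<^sub>R Z A B s"
      using r by (simp add: scaleR_diff_right)
    have q: "qdet e p (Z A B s') = (1 / r)\<^sup>2 * qdet e p (Z A B s)"
      unfolding Z' qdet_add_scaleR qdet_scaleR by simp
    have pp: "gform e p p \<noteq> 0" using inside_timelike[OF p] by auto
    have lin: "gform e v (Z A B s') - gform e p (Z A B s') * gform e p v / gform e p p
      = - (1 / r) * (gform e v (Z A B s) - gform e p (Z A B s) * gform e p v / gform e p p)"
      unfolding Z' gform_simps using pp r by (simp add: gform_commute[of e v p] field_simps)
    have "qdet e p (Z A B s) > 0"
      by (rule qdet_pos[OF eps inside_timelike[OF p] inside_not_proportional[OF p]])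
    have recip: "(1 / r) powr - y = r powr y" for y
      using r by (simp add: powr_minus powr_divide)
    from \<open>qdet e p (Z A B s) > 0\<close> have qp: "qdet e p (Z A B s') powr - (real CARD('n) / 2) = r ^ (CARD('k) + 1) * qdet e p (Z A B s) powr - (real CARD('n) / 2)"
    proof -
      have "((1 / r)\<^sup>2) powr - (real CARD('n) / 2) = (1 / r) powr (2 * - (real CARD('n) / 2))"
        using r by (intro power2_powr) simp
      also have "2 * - (real CARD('n) / 2) = - real (CARD('k) + 1)"
        by (simp add: card_n field_simps)
      also have "(1 / r) powr - real (CARD('k) + 1) = r powr real (CARD('k) + 1)"
        using recip by blast
      also have "\<dots> = r ^ (CARD('k) + 1)" using r by (rule powr_realpow)
      finally show ?thesis using r by (simp add: q powr_mult)
    qed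
    \<comment> \<open>The factor \<open>- (1 / r)\<close> of the linear part and
      \<open>r ^ (k + 1)\<close> of the Gram determinant combine to \<open>- r ^ k\<close>.\<close>
    have "charge_kernel_deriv A B p v s' = - (r ^ CARD('k) * charge_kernel_deriv A B p v s)"
      unfolding charge_kernel_deriv_def lin qp using r by simp
    then show "charge_kernel_deriv A B p v (c - (h\<^sup>2 / (norm (s - c))\<^sup>2) *\<^sub>R (s - c)) =
      - (((norm (s - c))\<^sup>2 / h\<^sup>2) ^ CARD('k) * charge_kernel_deriv A B p v s)"
      by (simp add: s'_def r_def)
  qed
qed

definition \<Phi> :: "'n space \<Rightarrow> real" where
  "\<Phi> p = (\<integral>s. charge_kernel A B p s \<partial>lborel)"

lemma integrable_dominator:
  "integrable lborel (\<lambda>s::(real, 'k) vec. norm (s - c) powr - (real CARD('k) - 1/2) * (1 + (norm (s - c))\<^sup>2) powr - (1/2))"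
  using integrable_norm_pole_decay_shift[where 'a="(real, 'k) vec" and c=c] by simp

text \<open>The linear map \<open>scl A B\<close> carries the open future light cone, which is
  convex, onto the interior vectors.\<close>

lemma inside_convex: "convex {p. inside A B p}"
proof -
  have eq: "inside A B (scl A B x) \<longleftrightarrow> norm (snd x) < fst x" for x
  proof -
    have "inside A B (scl A B x) \<longleftrightarrow> (norm (snd x))\<^sup>2 < (fst x)\<^sup>2 \<and> fst x > 0"
      by (simp add: inside_def qform_scl A_pos B_pos fst_scl_pos mink_def power2_norm_eq_inner power2_eq_square[of "fst x"])
    also have "\<dots> \<longleftrightarrow> norm (snd x) < fst x"
      by (smt (verit) norm_ge_zero power2_less_imp_less power_strict_mono zero_less_numeral)
    finally show ?thesis .
  qed
  have "convex {x :: 'n space. norm (snd x) < fst x}"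
  proof (rule convexI)
    fix x y :: "'n space" and u v :: real
    assume xy: "x \<in> {x. norm (snd x) < fst x}" "y \<in> {x. norm (snd x) < fst x}" and uv: "0 \<le> u" "0 \<le> v" "u + v = 1"
    have "norm (snd (u *\<^sub>R x + v *\<^sub>R y)) \<le> u * norm (snd x) + v * norm (snd y)"
      using norm_triangle_ineq[of "u *\<^sub>R snd x" "v *\<^sub>R snd y"] uv by simp
    also have "\<dots> < u * fst x + v * fst y"
    proof (cases "u = 0")
      case True
      then show ?thesis using xy uv by simp
    next
      case False
      then have "u * norm (snd x) < u * fst x" using xy uv by simp
      moreover have "v * norm (snd y) \<le> v * fst y" using xy uv by (intro mult_left_mono) auto
      ultimately show ?thesis by simp
    qed
    finally show "u *\<^sub>R x + v *\<^sub>R y \<in> {x. norm (snd x) < fst x}" by simp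
  qed
  then have "convex (scl A B ` {x. norm (snd x) < fst x})"
    by (rule convex_linear_image[OF linear_scl])
  also have "scl A B ` {x. norm (snd x) < fst x} = {p. inside A B p}"
    using eq scl_surj[of A B] A_pos B_pos by (auto simp: image_iff) (metis eq)
  finally show ?thesis .
qed

lemma charge_kernel_integrable_inside:
  assumes p: "inside A B p"
  shows "integrable lborel (charge_kernel A B p)"
proof -
  have t: "e * gform e p p > 0" "fst p > 0" using inside_timelike[OF p] p by (auto simp: inside_def)
  obtain \<kappa> where \<kappa>: "\<kappa> > 0" "\<And>p' s. p' \<in> {p} \<Longrightarrow> \<kappa> * (norm (Z A B s))\<^sup>2 \<le> qdet e p' (Z A B s)"
    by (rule qdet_Z_ge[of "{p}"]) (use p in auto)
  have B: "sqrt B > 0" using B_pos by simp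
  \<comment> \<open>Deliberately weakened by \<open>norm s \<le> 1 + (norm s)\<^sup>2\<close> to fit
    \<open>charge_kernel_dominated\<close>; the resulting pole of the majorant at 0 is
    artificial.\<close>
  have q: "\<kappa> * B * (norm (s - 0))\<^sup>2 \<le> qdet e p (Z A B s)" for s
  proof -
    have "norm s \<le> 1 + (norm s)\<^sup>2" using sum_squares_ge_zero[of "norm s - 1/2" 0]
      by (simp add: power2_eq_square algebra_simps)
    then have "sqrt B * norm s \<le> sqrt B * (1 + (norm s)\<^sup>2)" using B by (intro mult_left_mono) auto
    also have "\<dots> \<le> norm (Z A B s)" by (rule norm_Z_ge)
    finally have "(sqrt B * norm s)\<^sup>2 \<le> (norm (Z A B s))\<^sup>2" using B by (intro power_mono) auto
    then have "\<kappa> * (B * (norm s)\<^sup>2) \<le> \<kappa> * (norm (Z A B s))\<^sup>2"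
      using \<kappa>(1) B_pos by (intro mult_left_mono) (auto simp: power_mult_distrib)
    also have "\<dots> \<le> qdet e p (Z A B s)" using \<kappa>(2) by simp
    finally show ?thesis by (simp add: mult_ac)
  qed
  obtain C where C: "\<And>p' s. p' \<in> {p} \<Longrightarrow> s \<noteq> 0 \<Longrightarrow> \<bar>charge_kernel A B p' s\<bar>
    \<le> C * (norm (s - 0) powr - (real CARD('k) - 1/2) * (1 + (norm (s - 0))\<^sup>2) powr - (1/2))"
    by (rule charge_kernel_dominated[of "{p}" "glen e p" "\<kappa> * B" 0]) (use t \<kappa>(1) B_pos q in auto)
  show ?thesis
  proof (rule Bochner_Integration.integrable_bound[OF integrable_mult_right[OF integrable_dominator[of 0], of C]])
    have "continuous_on UNIV (\<lambda>s. charge_kernel A B p s)"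
      using t inside_not_proportional[OF p] by (intro charge_kernel_continuous continuous_on_const continuous_on_id) auto
    then show "charge_kernel A B p \<in> borel_measurable lborel"
      by (simp add: borel_measurable_continuous_onI)
    show "AE s in lborel. norm (charge_kernel A B p s)
        \<le> norm (C * (norm (s - 0) powr - (real CARD('k) - 1/2) * (1 + (norm (s - 0))\<^sup>2) powr - (1/2)))"
      using AE_lborel_singleton[of 0]
    proof eventually_elim
      fix s :: "(real, 'k) vec" assume "s \<noteq> 0"
      from C[OF _ this, of p] show "norm (charge_kernel A B p s)
        \<le> norm (C * (norm (s - 0) powr - (real CARD('k) - 1/2) * (1 + (norm (s - 0))\<^sup>2) powr - (1/2)))"
        unfolding real_norm_def by (meson abs_ge_self order_trans singletonI)
    qed
  qed
qed

lemma \<Phi>_inside_constant: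
  assumes p: "inside A B p" and p': "inside A B p'"
  shows "\<Phi> p = \<Phi> p'"
proof -
  define v where "v = p' - p"
  have seg: "inside A B (p + t *\<^sub>R v)" if "t \<in> {0..1}" for t
  proof -
    have "(1 - t) *\<^sub>R p + t *\<^sub>R p' \<in> {p. inside A B p}"
      using that p p' by (intro convexD[OF inside_convex]) auto
    then show ?thesis by (simp add: v_def algebra_simps)
  qed
  let ?P = "(\<lambda>t. p + t *\<^sub>R v) ` {0..1}"
  have "compact ?P" by (intro compact_continuous_image continuous_intros) auto
  then obtain C where C: "\<And>q s. q \<in> ?P \<Longrightarrow> \<bar>charge_kernel_deriv A B q v s\<bar> \<le> C * (1 + (norm s)\<^sup>2) powr - real CARD('k)"
    by (rule charge_kernel_deriv_bound[of ?P v]) (use seg in auto)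
  have C': "\<bar>charge_kernel_deriv A B (p + t *\<^sub>R v) v s\<bar> \<le> C * (1 + (norm s)\<^sup>2) powr - real CARD('k)" if "t \<in> {0..1}" for t s
    using that by (intro C imageI)
  have "((\<lambda>t. \<Phi> (p + t *\<^sub>R v)) has_real_derivative 0) (at t within {0..1})" if t: "t \<in> {0..1}" for t
  proof -
    have "((\<lambda>t. \<Phi> (p + t *\<^sub>R v)) has_real_derivative (\<integral>s. charge_kernel_deriv A B (p + t *\<^sub>R v) v s \<partial>lborel)) (at t within {0..1})"
      unfolding \<Phi>_def
    proof (rule has_derivative_integral_dominated[OF t, where w="\<lambda>s. C * (1 + (norm s)\<^sup>2) powr - real CARD('k)"])
      show "charge_kernel_deriv A B (p + t *\<^sub>R v) v \<in> borel_measurable lborel"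
        using charge_kernel_deriv_integrable[OF seg[OF t]] by (rule borel_measurable_integrable)
    qed (use C' seg integrable_decay_vec charge_kernel_integrable_inside in
          \<open>auto intro: has_field_derivative_at_within[OF charge_kernel_has_derivative]\<close>)
    then show ?thesis using integral_charge_kernel_deriv[OF seg[OF t]] by simp
  qed
  then have "\<exists>c. \<forall>t\<in>{0..1}. \<Phi> (p + t *\<^sub>R v) = c"
    by (intro has_field_derivative_zero_constant) auto
  then obtain c where "\<And>t. t \<in> {0..1} \<Longrightarrow> \<Phi> (p + t *\<^sub>R v) = c" by blast
  from this[of 0] this[of 1] show ?thesis by (simp add: v_def)
qed

section \<open>The potential on the confocal ellipsoids\<close>

text \<open>Modulo the field point, \<open>Z A B s\<close> is the image of a vector \<open>y\<close>
  under a linear map whose nonzero values are never proportional to the field point, down to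
  \<open>t = 0\<close>. Compactness of the interval times the unit sphere of the \<open>y\<close>
  gives a bound by \<open>(norm y)\<^sup>2\<close>, and \<open>s - c\<close> is a component of
  \<open>y\<close>.\<close>

lemma boundary_segment_qdet_ge:
  obtains \<kappa> where "\<kappa> > 0" "\<And>t s. t \<in> {0..1} \<Longrightarrow>
    \<kappa> * (norm (s - c))\<^sup>2 \<le> qdet e (scl A B (chart_vector c + t *\<^sub>R pole)) (Z A B s)"
proof -
  let ?p = "\<lambda>t. scl A B (chart_vector c + t *\<^sub>R pole)"
  let ?w = "\<lambda>y. scl A B (2 *\<^sub>R emb (fst y) + snd y *\<^sub>R pole)"
  let ?S = "{0..1::real} \<times> sphere (0 :: (real, 'k) vec \<times> real) 1"
  have p: "e * gform e (?p t) (?p t) > 0" if "t \<in> {0..1}" for t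
  proof (rule timelike_of_qform[OF adm])
    have "chart_vector c + t *\<^sub>R pole = 1 *\<^sub>R copole + 2 *\<^sub>R emb c + ((norm c)\<^sup>2 + t) *\<^sub>R pole"
      by (simp add: chart_vector_def algebra_simps)
    then show "qform A B (?p t) \<le> 0"
      using that by (simp only: qform_scl A_pos B_pos mink_coordinates) simp
    have "fst (chart_vector c + t *\<^sub>R pole) > 0" using that by (simp add: fst_chart_vector add_pos_nonneg)
    then have "fst (?p t) > 0" by (simp only: fst_scl_pos[OF B_pos])
    then show "?p t \<noteq> 0" by auto
  qed
  have pos: "qdet e (?p (fst x)) (?w (snd x)) > 0" if x: "x \<in> ?S" for x
  proof (rule qdet_pos[OF eps])
    show "e * gform e (?p (fst x)) (?p (fst x)) > 0" using x by (intro p) auto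
    fix r show "?w (snd x) \<noteq> r *\<^sub>R ?p (fst x)"
    proof
      assume "?w (snd x) = r *\<^sub>R ?p (fst x)"
      then have "scl A B (2 *\<^sub>R emb (fst (snd x)) + snd (snd x) *\<^sub>R pole) = scl A B (r *\<^sub>R (chart_vector c + fst x *\<^sub>R pole))"
        by (simp only: scl_simps)
      then have eq: "2 *\<^sub>R emb (fst (snd x)) + snd (snd x) *\<^sub>R pole = r *\<^sub>R (chart_vector c + fst x *\<^sub>R pole)"
        using A_pos B_pos by (simp only: scl_eq_iff)
      then have "r *\<^sub>R copole + emb (2 *\<^sub>R (r *\<^sub>R c - fst (snd x))) + (r * ((norm c)\<^sup>2 + fst x) - snd (snd x)) *\<^sub>R pole = 0"
        by (simp add: chart_vector_def emb_simps algebra_simps)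
      then have "r = 0" and "r *\<^sub>R c - fst (snd x) = 0" and "r * ((norm c)\<^sup>2 + fst x) - snd (snd x) = 0"
        unfolding coordinates_eq_0_iff by auto
      then have "snd x = 0" by (simp add: prod_eq_iff)
      then show False using x by auto
    qed
  qed
  have cpt: "compact ?S" by (intro compact_Times) auto
  have cont: "continuous_on ?S (\<lambda>x. qdet e (?p (fst x)) (?w (snd x)))" by (intro continuous_intros)
  obtain \<kappa> where k: "\<kappa> > 0" "\<And>x. x \<in> ?S \<Longrightarrow> \<kappa> \<le> qdet e (?p (fst x)) (?w (snd x))"
    using compact_pos_lower_bound[OF cpt cont pos] by blast
  have "\<kappa> * (norm (s - c))\<^sup>2 \<le> qdet e (?p t) (Z A B s)" if t: "t \<in> {0..1}" for t s
  proof (cases "s = c")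
    case True
    have "qdet e (?p t) (Z A B s) \<ge> 0"
    proof (cases "\<exists>r. Z A B s = r *\<^sub>R ?p t")
      case True
      then show ?thesis by (auto simp: qdet_def gform_simps power2_eq_square algebra_simps)
    next
      case False
      then show ?thesis using qdet_pos[OF eps p[OF t]] by (simp add: less_imp_le)
    qed
    then show ?thesis using True by simp
  next
    case False
    define y where "y = (s - c, (norm s)\<^sup>2 - (norm c)\<^sup>2 - t)"
    have le: "norm (s - c) \<le> norm y" using norm_fst_le[of "s - c" "(norm s)\<^sup>2 - (norm c)\<^sup>2 - t"] by (simp add: y_def)
    then have n: "norm y > 0" using False by auto
    have "Z A B s = scl A B ((chart_vector c + t *\<^sub>R pole) + (2 *\<^sub>R emb (fst y) + snd y *\<^sub>R pole))"
      unfolding Z_def by (subst chart_vector_shift[of s c t]) (simp add: y_def add.assoc)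
    also have "\<dots> = 1 *\<^sub>R ?p t + ?w y" by (simp only: scl_simps) simp
    finally have "qdet e (?p t) (Z A B s) = qdet e (?p t) (?w y)" by (simp only: qdet_add_scaleR)
    also have "?w y = norm y *\<^sub>R ?w ((1 / norm y) *\<^sub>R y)"
    proof -
      have "norm y *\<^sub>R ?w ((1 / norm y) *\<^sub>R y) = scl A B (norm y *\<^sub>R (2 *\<^sub>R emb ((1 / norm y) *\<^sub>R fst y) + ((1 / norm y) * snd y) *\<^sub>R pole))"
        by (simp add: scl_simps)
      also have "norm y *\<^sub>R (2 *\<^sub>R emb ((1 / norm y) *\<^sub>R fst y) + ((1 / norm y) * snd y) *\<^sub>R pole) = 2 *\<^sub>R emb (fst y) + snd y *\<^sub>R pole"
        using n by (simp add: emb_simps algebra_simps)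
      finally show ?thesis by simp
    qed
    also have "qdet e (?p t) (norm y *\<^sub>R ?w ((1 / norm y) *\<^sub>R y)) = (norm y)\<^sup>2 * qdet e (?p t) (?w ((1 / norm y) *\<^sub>R y))"
      by (rule qdet_scaleR)
    finally have eq: "qdet e (?p t) (Z A B s) = (norm y)\<^sup>2 * qdet e (?p t) (?w ((1 / norm y) *\<^sub>R y))" .
    have "\<kappa> \<le> qdet e (?p t) (?w ((1 / norm y) *\<^sub>R y))"
      using k(2)[of "(t, (1 / norm y) *\<^sub>R y)"] t n by simp
    then have "(norm y)\<^sup>2 * \<kappa> \<le> qdet e (?p t) (Z A B s)"
      unfolding eq by (rule mult_left_mono) simp
    moreover have "\<kappa> * (norm (s - c))\<^sup>2 \<le> (norm y)\<^sup>2 * \<kappa>"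
      using k(1) le by (subst mult.commute) (intro mult_right_mono power_mono, auto)
    ultimately show ?thesis by linarith
  qed
  then show ?thesis using that k(1) by blast
qed

lemma boundary_segment_inside:
  assumes "0 < t"
  shows "inside A B (scl A B (chart_vector c + t *\<^sub>R pole))"
proof -
  have "chart_vector c + t *\<^sub>R pole = 1 *\<^sub>R copole + 2 *\<^sub>R emb c + ((norm c)\<^sup>2 + t) *\<^sub>R pole"
    by (simp add: chart_vector_def algebra_simps)
  then have "qform A B (scl A B (chart_vector c + t *\<^sub>R pole)) < 0"
    using assms by (simp only: qform_scl A_pos B_pos mink_coordinates) simp
  moreover have "fst (chart_vector c + t *\<^sub>R pole) > 0" using assms by (simp add: fst_chart_vector add_pos_pos add_pos_nonneg)
  then have "fst (scl A B (chart_vector c + t *\<^sub>R pole)) > 0" by (simp only: fst_scl_pos[OF B_pos])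
  ultimately show ?thesis by (simp add: inside_def)
qed

text \<open>The points with \<open>t = 1 / (j + 1)\<close> are inside and tend to the boundary
  point. One majorant serves the whole segment; its only pole, at \<open>c\<close>, has order
  \<open>k - 1/2\<close> and is integrable, so dominated convergence carries over the interior
  constant.\<close>

lemma potential_boundary:
  "integrable lborel (charge_kernel A B (scl A B (chart_vector c)))"
  "\<Phi> (scl A B (chart_vector c)) = \<Phi> (scl A B (chart_vector c + pole))"
proof -
  let ?p = "\<lambda>t. scl A B (chart_vector c + t *\<^sub>R pole)"
  obtain \<kappa> where \<kappa>: "\<kappa> > 0" "\<And>t s. t \<in> {0..1} \<Longrightarrow> \<kappa> * (norm (s - c))\<^sup>2 \<le> qdet e (?p t) (Z A B s)"
    using boundary_segment_qdet_ge[of c] by blast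
  have p0: "?p 0 = Z A B c" by (simp add: Z_def)
  have tp: "e * gform e (?p t) (?p t) > 0 \<and> fst (?p t) > 0" if "t \<in> {0..1}" for t
  proof (cases "t = 0")
    case True
    then show ?thesis using Z_timelike[of c] fst_Z_pos[of c] p0 by (simp only:)
  next
    case False
    then have "inside A B (?p t)" using that by (intro boundary_segment_inside) auto
    then show ?thesis using inside_timelike by (auto simp: inside_def)
  qed
  have "continuous_on {0..1} (\<lambda>t. glen e (?p t))" by (intro continuous_intros)
  then have "compact ((\<lambda>t. glen e (?p t)) ` {0..1})" by (rule compact_continuous_image) simp
  then obtain G where G: "\<And>t. t \<in> {0..1} \<Longrightarrow> \<bar>glen e (?p t)\<bar> \<le> G"
    using compact_imp_bounded[of "(\<lambda>t. glen e (?p t)) ` {0..1}"] unfolding bounded_iff real_norm_def by (meson imageI)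
  let ?w = "\<lambda>s. norm (s - c) powr - (real CARD('k) - 1/2) * (1 + (norm (s - c))\<^sup>2) powr - (1/2)"
  obtain C where C0: "\<And>p s. p \<in> ?p ` {0..1} \<Longrightarrow> s \<noteq> c \<Longrightarrow> \<bar>charge_kernel A B p s\<bar> \<le> C * ?w s"
  proof (rule charge_kernel_dominated[of "?p ` {0..1}" G \<kappa> c])
    show "e * gform e p p > 0" "fst p > 0" "glen e p \<le> G" if "p \<in> ?p ` {0..1}" for p
      using that tp G by (auto simp: abs_le_iff)
    show "\<kappa> * (norm (s - c))\<^sup>2 \<le> qdet e p (Z A B s)" if "p \<in> ?p ` {0..1}" for p s
      using that \<kappa>(2) by auto
  qed (use \<kappa>(1) in auto)
  have C: "\<bar>charge_kernel A B (?p t) s\<bar> \<le> C * ?w s" if "t \<in> {0..1}" "s \<noteq> c" for t s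
    using that by (intro C0 imageI)
  have np: "Z A B s \<noteq> r *\<^sub>R ?p t" if "t \<in> {0..1}" "s \<noteq> c" for s r t
  proof
    assume "Z A B s = r *\<^sub>R ?p t"
    then have "qdet e (?p t) (Z A B s) = 0" by (simp add: qdet_def gform_simps power2_eq_square)
    moreover have "\<kappa> * (norm (s - c))\<^sup>2 > 0" using \<kappa>(1) that by simp
    ultimately show False using \<kappa>(2)[OF that(1), of s] by simp
  qed
  have cont: "continuous_on {0..1} (\<lambda>t. charge_kernel A B (?p t) s)" if "s \<noteq> c" for s
    using tp np[OF _ that] by (intro charge_kernel_continuous continuous_intros) auto
  have meas: "charge_kernel A B (?p t) \<in> borel_measurable lborel" if "t \<in> {0..1}" for t
  proof -
    have "continuous_on (- {c}) (charge_kernel A B (?p t))"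
      using tp[OF that] np[OF that] by (intro charge_kernel_continuous continuous_on_const continuous_on_id) auto
    then have "charge_kernel A B (?p t) \<in> borel_measurable borel"
      by (intro borel_measurable_continuous_countable_exceptions[of "{c}"]) auto
    then show ?thesis by simp
  qed
  have int: "integrable lborel (\<lambda>s. C * ?w s)" by (intro integrable_mult_right integrable_dominator)
  define X where "X = (\<lambda>j. inverse (real (Suc j)))"
  have X: "X j \<in> {0<..1}" for j by (simp add: X_def inverse_eq_divide)
  then have X': "X j \<in> {0..1}" for j using less_imp_le by (metis atLeastAtMost_iff greaterThanAtMost_iff)
  have X0: "X \<longlonglongrightarrow> 0" unfolding X_def by (rule LIMSEQ_inverse_real_of_nat)
  have a1: "AE s in lborel. (\<lambda>j. charge_kernel A B (?p (X j)) s) \<longlonglongrightarrow> charge_kernel A B (?p 0) s"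
    using AE_lborel_singleton[of c]
  proof eventually_elim
    fix s :: "(real, 'k) vec" assume s: "s \<noteq> c"
    show "(\<lambda>j. charge_kernel A B (?p (X j)) s) \<longlonglongrightarrow> charge_kernel A B (?p 0) s"
      by (rule continuous_on_tendsto_compose[OF cont[OF s] X0]) (use X' in \<open>auto intro: always_eventually\<close>)
  qed
  have a2: "AE s in lborel. norm (charge_kernel A B (?p (X j)) s) \<le> C * ?w s" for j
    using AE_lborel_singleton[of c]
  proof eventually_elim
    fix s :: "(real, 'k) vec" assume s: "s \<noteq> c"
    from C[OF X' s] show "norm (charge_kernel A B (?p (X j)) s) \<le> C * ?w s" by simp
  qed
  have m: "charge_kernel A B (?p 0) \<in> borel_measurable lborel" "\<And>j. charge_kernel A B (?p (X j)) \<in> borel_measurable lborel"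
    by (rule meas, simp, rule meas, rule X')
  have "integrable lborel (charge_kernel A B (?p 0))"
    by (rule integrable_dominated_convergence[OF m int a1 a2])
  then show "integrable lborel (charge_kernel A B (scl A B (chart_vector c)))" by simp
  have "(\<lambda>j. \<Phi> (?p (X j))) \<longlonglongrightarrow> \<Phi> (?p 0)"
    unfolding \<Phi>_def by (rule integral_dominated_convergence[OF m int a1 a2])
  moreover have "\<Phi> (?p (X j)) = \<Phi> (?p 1)" for j
    using X[of j] by (intro \<Phi>_inside_constant boundary_segment_inside) auto
  ultimately show "\<Phi> (scl A B (chart_vector c)) = \<Phi> (scl A B (chart_vector c + pole))"
    using LIMSEQ_unique[of "\<lambda>j. \<Phi> (?p 1)" "\<Phi> (?p 0)" "\<Phi> (?p 1)"] by simp
qed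

end

context kernel_potential begin

lemma charge_kernel_scaleR:
  assumes "\<mu> > 0"
  shows "charge_kernel A B (\<mu> *\<^sub>R p) s = charge_kernel A B p s"
proof -
  have "glen e (\<mu> *\<^sub>R p) = \<mu> * glen e p"
  proof -
    have "e * gform e (\<mu> *\<^sub>R p) (\<mu> *\<^sub>R p) = \<mu>\<^sup>2 * (e * gform e p p)" by (simp add: gform_simps power2_eq_square)
    then show ?thesis unfolding glen_def using assms by (simp only: real_sqrt_mult) simp
  qed
  then show ?thesis using assms by (simp add: charge_kernel_def gform_simps)
qed

text \<open>On the light cone the spatial squares sum to \<open>(fst Y)\<^sup>2\<close>, so the sign
  is settled by comparing the ratios \<open>C i / A i\<close> with \<open>D / B\<close> term by
  term; some spatial coordinate is nonzero.\<close>

lemma inside_scl_lightlike: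
  assumes A: "\<And>i. A i > 0" and B: "B > 0" and C: "\<And>i. C i > 0" and D: "D > 0"
    and lt: "\<And>i. C i * B < D * A i" and Y: "mink Y Y = 0" "fst Y > 0"
  shows "inside A B (scl C D Y)"
proof -
  have sq: "(\<Sum>i\<in>UNIV. (snd Y $ i)\<^sup>2) = (fst Y)\<^sup>2"
    using Y(1) by (simp add: mink_def inner_vec_def power2_eq_square)
  have "snd Y \<noteq> 0" using Y sq by auto
  then obtain j where j: "snd Y $ j \<noteq> 0" by (auto simp: vec_eq_iff)
  have r: "C i / A i < D / B" for i using lt[of i] A[of i] B by (simp add: field_simps)
  have "qform A B (scl C D Y) = (\<Sum>i\<in>UNIV. C i / A i * (snd Y $ i)\<^sup>2) - D / B * (fst Y)\<^sup>2"
    using C D by (simp add: qform_def scl_def power_mult_distrib less_imp_le)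
  also have "(\<Sum>i\<in>UNIV. C i / A i * (snd Y $ i)\<^sup>2) < (\<Sum>i\<in>UNIV. D / B * (snd Y $ i)\<^sup>2)"
  proof (rule sum_strict_mono_ex1)
    show "\<forall>i\<in>UNIV. C i / A i * (snd Y $ i)\<^sup>2 \<le> D / B * (snd Y $ i)\<^sup>2"
      using r by (intro ballI mult_right_mono) (auto simp: less_imp_le)
    show "\<exists>i\<in>UNIV. C i / A i * (snd Y $ i)\<^sup>2 < D / B * (snd Y $ i)\<^sup>2"
      using j r[of j] by (intro bexI[of _ j] mult_strict_right_mono) auto
  qed simp
  also have "\<dots> = D / B * (fst Y)\<^sup>2" by (simp only: sq sum_distrib_left[symmetric])
  finally have "qform A B (scl C D Y) < 0" by simp
  then show ?thesis using Y D by (simp add: inside_def fst_scl_pos)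
qed

lemma inside_equipotential:
  assumes adm: "admissible e A B"
  shows "\<exists>c. \<forall>p. inside A B p \<longrightarrow> integrable lborel (charge_kernel A B p) \<and> (\<integral>s. charge_kernel A B p s \<partial>lborel) = c"
proof -
  interpret ellipsoid_potential \<iota> m e K A B by unfold_locales (rule adm)
  show ?thesis using charge_kernel_integrable_inside \<Phi>_inside_constant unfolding \<Phi>_def by metis
qed

lemma confocal_equipotential:
  assumes adm: "admissible e A B" and adm': "admissible e (\<lambda>i. A i - l) (B + e * l)" and l: "l \<noteq> 0"
  shows "\<exists>c. \<forall>p. qform (\<lambda>i. A i - l) (B + e * l) p = 0 \<and> fst p > 0 \<longrightarrow>
    integrable lborel (charge_kernel A B p) \<and> (\<integral>s. charge_kernel A B p s \<partial>lborel) = c"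
proof -
  let ?A' = "\<lambda>i. A i - l" and ?B' = "B + e * l"
  have e: "e = 1 \<or> e = - 1" and A: "\<And>i. A i > 0" "B > 0" and A': "\<And>i. A i - l > 0" "B + e * l > 0"
    using adm adm' by (auto simp: admissible_def)
  \<comment> \<open>Which ellipsoid is the inner one is decided by
    \<open>A i * (B + e * l) - B * (A i - l) = l * (e * A i + B)\<close>; for \<open>e = - 1\<close>
    the last factor is positive because \<open>A i < B\<close>.\<close>
  have eAB: "e * A i + B > 0" for i
    using adm A(1)[of i] by (auto simp: admissible_def add_pos_pos)
  have Y: "\<exists>Y. p = scl ?A' ?B' Y \<and> mink Y Y = 0 \<and> fst Y > 0" if "qform ?A' ?B' p = 0 \<and> fst p > 0" for p
  proof -
    obtain Y where Y: "p = scl ?A' ?B' Y" using scl_surj[of ?A' ?B' p] A' by blast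
    then have "mink Y Y = 0" "fst Y > 0"
      using that fst_scl_pos[OF A'(2), of ?A' Y] qform_scl[of ?A' ?B' Y] A' by simp_all
    then show ?thesis using Y by blast
  qed
  consider "l < 0" | "l > 0" using l by linarith
  then show ?thesis
  proof cases
    case 1
    obtain c where c: "\<And>p. inside ?A' ?B' p \<Longrightarrow> integrable lborel (charge_kernel ?A' ?B' p) \<and> (\<integral>s. charge_kernel ?A' ?B' p s \<partial>lborel) = c"
      using inside_equipotential[OF adm'] by blast
    show ?thesis
    proof (intro exI[of _ c] allI impI)
      fix p assume p: "qform ?A' ?B' p = 0 \<and> fst p > 0"
      then obtain Y where Y: "p = scl ?A' ?B' Y" "mink Y Y = 0" "fst Y > 0" using Y by blast
      have lt: "A i * ?B' < B * (A i - l)" for i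
      proof -
        have "l * (e * A i + B) < 0" using 1 eAB[of i] by (simp add: mult_less_0_iff)
        then show ?thesis by (simp add: algebra_simps)
      qed
      have "inside ?A' ?B' (scl A B Y)"
        by (rule inside_scl_lightlike[OF A' A lt Y(2,3)])
      moreover have "charge_kernel A B p = charge_kernel ?A' ?B' (scl A B Y)"
        using ivory_symmetry[OF adm adm' Y(2)] by (auto simp: Y(1))
      ultimately show "integrable lborel (charge_kernel A B p) \<and> (\<integral>s. charge_kernel A B p s \<partial>lborel) = c"
        using c by simp
    qed
  next
    case 2
    obtain c where c: "\<And>p. inside A B p \<Longrightarrow> integrable lborel (charge_kernel A B p) \<and> (\<integral>s. charge_kernel A B p s \<partial>lborel) = c"
      using inside_equipotential[OF adm] by blast
    show ?thesis
    proof (intro exI[of _ c] allI impI)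
      fix p assume p: "qform ?A' ?B' p = 0 \<and> fst p > 0"
      then obtain Y where Y: "p = scl ?A' ?B' Y" "mink Y Y = 0" "fst Y > 0" using Y by blast
      have lt: "(A i - l) * B < ?B' * A i" for i
      proof -
        have "l * (e * A i + B) > 0" using 2 eAB[of i] by simp
        then show ?thesis by (simp add: algebra_simps)
      qed
      have "inside A B p" unfolding Y(1)
        by (rule inside_scl_lightlike[OF A A' lt Y(2,3)])
      then show "integrable lborel (charge_kernel A B p) \<and> (\<integral>s. charge_kernel A B p s \<partial>lborel) = c"
        using c by simp
    qed
  qed
qed

end

section \<open>Volume and homeoidal density in the chart\<close>

text \<open>Half the gradient of \<open>qform A B\<close> at \<open>z\<close> with respect to
  \<open>gform e\<close>; the factor \<open>- e\<close> offsets the sign of the form in the time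
  direction.\<close>

definition conormal :: "real \<Rightarrow> ('n::finite \<Rightarrow> real) \<Rightarrow> real \<Rightarrow> 'n space \<Rightarrow> 'n space" where
  "conormal e A B z = (- e * fst z / B, \<chi> i. snd z $ i / A i)"

lemma gform_conormal:
  assumes "e = 1 \<or> e = - 1"
  shows "gform e (conormal e A B z) w = (\<Sum>i\<in>UNIV. snd z $ i * snd w $ i / A i) - fst z * fst w / B"
  using assms by (auto simp: gform_def conormal_def inner_vec_def)

lemma gform_conormal_self:
  assumes "e = 1 \<or> e = - 1"
  shows "gform e (conormal e A B z) z = qform A B z"
  by (simp add: gform_conormal[OF assms] qform_def power2_eq_square)

lemma qform_has_derivative:
  assumes "e = 1 \<or> e = - 1"
  shows "(qform A B has_derivative (\<lambda>w. 2 * gform e (conormal e A B z) w)) (at z)"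
proof -
  have "((\<lambda>x. (\<Sum>i\<in>UNIV. (snd x $ i)\<^sup>2 / A i) - (fst x)\<^sup>2 / B) has_derivative
      (\<lambda>w. (\<Sum>i\<in>UNIV. 2 * (snd z $ i * snd w $ i) / A i) - 2 * (fst z * fst w) / B)) (at z)"
    unfolding divide_inverse
    by (rule derivative_eq_intros refl bounded_linear.has_derivative[OF bounded_linear_vec_nth] | simp add: mult_ac)+
  then show ?thesis
    unfolding qform_def[abs_def] gform_conormal[OF assms]
    by (simp add: sum_distrib_left right_diff_distrib mult_ac)
qed

lemma gform_nondegenerate:
  assumes "e = 1 \<or> e = - 1" and "\<And>w. gform e v w = gform e v' w"
  shows "v = v'"
proof -
  have "gform e (v - v') (e * fst (v - v'), snd (v - v')) = 0"
    using assms(2) by (simp add: gform_simps)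
  then have "(v - v') \<bullet> (v - v') = 0"
    using assms(1) by (auto simp: gform_def inner_prod_def algebra_simps)
  then show ?thesis by simp
qed

lemma metric_gradient_eqI:
  assumes e: "e = 1 \<or> e = - 1" and "(f has_derivative (\<lambda>w. gform e v w)) (at x)"
  shows "metric_gradient (gform e) f x = v"
  unfolding metric_gradient_def frechet_derivative_at[OF assms(2), symmetric]
  by (rule the_equality) (auto intro: gform_nondegenerate[OF e])

locale isometric_frame =
  fixes e :: real and T :: "'n::finite space \<Rightarrow> 'n space"
  assumes e: "e = 1 \<or> e = - 1" and linear_T: "linear T" and gform_T: "gform e (T x) (T y) = gform e x y"
begin

lemma inj_T: "inj T"
proof (rule injI)
  fix x y assume "T x = T y"
  then have "gform e x w = gform e y w" for w by (metis gform_T)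
  then show "x = y" by (rule gform_nondegenerate[OF e])
qed

lemma surj_T: "surj T"
  using linear_injective_imp_surjective[OF linear_T inj_T] by simp

lemma T_inv [simp]: "T (inv T y) = y"
  using surj_T by (rule surj_f_inv_f)

lemma inv_T [simp]: "inv T (T x) = x"
  using inj_T by (rule inv_f_f)

lemma linear_inv_T: "linear (inv T)"
  by (rule linearI; rule injD[OF inj_T]) (simp_all add: linear_add[OF linear_T] linear_scale[OF linear_T])

lemma gform_inv_T: "gform e (inv T x) (inv T y) = gform e x y"
  by (metis T_inv gform_T)

lemma gform_inv_T_left: "gform e (inv T x) y = gform e x (T y)"
  by (metis T_inv gform_T)

lemma bounded_linear_inv_T: "bounded_linear (inv T)"
  using linear_inv_T by (simp add: linear_conv_bounded_linear)

lemma bounded_linear_T: "bounded_linear T"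
  using linear_T by (simp add: linear_conv_bounded_linear)

lemma metric_gradient_qform:
  "metric_gradient (gform e) (\<lambda>x. qform A B (T x)) y = 2 *\<^sub>R inv T (conormal e A B (T y))"
proof (rule metric_gradient_eqI[OF e])
  have "((\<lambda>x. qform A B (T x)) has_derivative (\<lambda>w. 2 * gform e (conormal e A B (T y)) (T w))) (at y)"
    by (rule has_derivative_compose[OF bounded_linear_imp_has_derivative[OF bounded_linear_T] qform_has_derivative[OF e]])
  moreover have "gform e (2 *\<^sub>R inv T (conormal e A B (T y))) = (\<lambda>w. 2 * gform e (conormal e A B (T y)) (T w))"
    by (simp add: fun_eq_iff gform_simps gform_inv_T_left)
  ultimately show "((\<lambda>x. qform A B (T x)) has_derivative gform e (2 *\<^sub>R inv T (conormal e A B (T y)))) (at y)"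
    by (simp only:)
qed

end

locale ellipsoid_chart = ellipsoid_potential \<iota> m e K A B + isometric_frame e T
  for \<iota> :: "'k::{finite,wellorder} \<Rightarrow> 'n::{finite,wellorder}" and m :: 'n and e :: real and K :: "real \<Rightarrow> real"
    and A :: "'n \<Rightarrow> real" and B :: real and T :: "'n space \<Rightarrow> 'n space"
begin

text \<open>The equation \<open>e * gform e x x = 1\<close> is the sphere for \<open>e = 1\<close>
  and the two-sheeted hyperboloid for \<open>e = - 1\<close>; the last condition selects one half of
  the cone.\<close>

definition ellipsoid :: "'n space set" where
  "ellipsoid = {x. e * gform e x x = 1 \<and> qform A B (T x) = 0 \<and> fst (T x) > 0}"

definition chart :: "(real, 'k) vec \<Rightarrow> 'n space" where
  "chart s = inv T ((1 / glen e (Z A B s)) *\<^sub>R Z A B s)"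

definition dZ :: "(real, 'k) vec \<Rightarrow> (real, 'k) vec \<Rightarrow> 'n space" where
  "dZ s v = scl A B (2 *\<^sub>R emb v + (2 * (s \<bullet> v)) *\<^sub>R pole)"

text \<open>The derivative of a normalized vector: the component of \<open>dZ s v\<close> orthogonal
  to \<open>Z A B s\<close>, divided by the length.\<close>

definition dchart :: "(real, 'k) vec \<Rightarrow> (real, 'k) vec \<Rightarrow> 'n space" where
  "dchart s v = (1 / glen e (Z A B s)) *\<^sub>R inv T (dZ s v - (gform e (Z A B s) (dZ s v) / gform e (Z A B s) (Z A B s)) *\<^sub>R Z A B s)"

lemma glen_Z_pos: "glen e (Z A B s) > 0"
  by (rule glen_pos[OF Z_timelike])

lemma gform_Z_Z: "gform e (Z A B s) (Z A B s) = e * (glen e (Z A B s))\<^sup>2"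
  using glen_power2[of e "Z A B s"] Z_timelike[of s] eps by auto

lemma Z_has_derivative: "(Z A B has_derivative dZ s) (at s)"
proof -
  have b: "bounded_linear (scl A B)" "bounded_linear emb"
    using linear_scl[of A B] linear_emb by (simp_all add: linear_conv_bounded_linear)
  have "((\<lambda>s. copole + 2 *\<^sub>R emb s + (s \<bullet> s) *\<^sub>R pole) has_derivative (\<lambda>v. 2 *\<^sub>R emb v + (2 * (s \<bullet> v)) *\<^sub>R pole)) (at s)"
    by (rule derivative_eq_intros refl bounded_linear_imp_has_derivative[OF b(2)] | simp add: inner_commute)+
  from bounded_linear.has_derivative[OF b(1) this] show ?thesis
    unfolding Z_def[abs_def] dZ_def[abs_def] chart_vector_def power2_norm_eq_inner .
qed

lemma chart_has_derivative: "(chart has_derivative dchart s) (at s)"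
proof -
  let ?Z = "Z A B s" and ?g = "glen e (Z A B s)"
  note g = glen_Z_pos[of s]
  have blin: "bounded_bilinear (gform e :: 'n space \<Rightarrow> 'n space \<Rightarrow> real)"
  proof (rule bounded_bilinear.intro)
    show "\<exists>K. \<forall>a b :: 'n space. norm (gform e a b) \<le> norm a * norm b * K"
      using abs_gform_le[OF eps] by (intro exI[of _ 1] allI) (simp only: real_norm_def mult_1_right)
  qed (simp_all add: gform_simps)
  have dg: "((\<lambda>s. e * gform e (Z A B s) (Z A B s)) has_derivative (\<lambda>v. e * (2 * gform e ?Z (dZ s v)))) (at s)"
  proof -
    have "((\<lambda>s. e * gform e (Z A B s) (Z A B s)) has_derivative (\<lambda>v. e * (gform e ?Z (dZ s v) + gform e (dZ s v) ?Z))) (at s)"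
      by (rule has_derivative_mult_right[OF bounded_bilinear.FDERIV[OF blin Z_has_derivative Z_has_derivative]])
    moreover have "gform e ?Z (dZ s v) + gform e (dZ s v) ?Z = 2 * gform e ?Z (dZ s v)" for v
      by (simp add: gform_commute[of e "dZ s v" ?Z])
    ultimately show ?thesis by (simp only:)
  qed
  have dlen: "((\<lambda>s. glen e (Z A B s)) has_derivative (\<lambda>v. e * gform e ?Z (dZ s v) / ?g)) (at s)"
  proof -
    have "((\<lambda>s. sqrt (e * gform e (Z A B s) (Z A B s))) has_derivative
      (\<lambda>v. inverse (sqrt (e * gform e ?Z ?Z)) / 2 * (e * (2 * gform e ?Z (dZ s v))))) (at s)"
      by (rule has_derivative_compose[OF dg, of sqrt "(*) (inverse (sqrt (e * gform e ?Z ?Z)) / 2)"])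
         (use DERIV_real_sqrt[OF Z_timelike[of s]] in \<open>simp add: has_field_derivative_def\<close>)
    moreover have "inverse x / 2 * (e * (2 * y)) = e * y / x" for x y :: real
      by (cases "x = 0") (auto simp: field_simps)
    ultimately show ?thesis unfolding glen_def by (simp only:)
  qed
  have dinv: "((\<lambda>s. 1 / glen e (Z A B s)) has_derivative (\<lambda>v. - (e * gform e ?Z (dZ s v) / ?g ^ 3))) (at s)"
    using g by (auto intro!: derivative_eq_intros dlen simp: power3_eq_cube field_simps)
  have "((\<lambda>s. inv T ((1 / glen e (Z A B s)) *\<^sub>R Z A B s)) has_derivative
    (\<lambda>v. inv T ((1 / ?g) *\<^sub>R dZ s v + (- (e * gform e ?Z (dZ s v) / ?g ^ 3)) *\<^sub>R ?Z))) (at s)"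
    by (intro bounded_linear.has_derivative[OF bounded_linear_inv_T] has_derivative_scaleR[OF dinv Z_has_derivative])
  moreover have "inv T ((1 / ?g) *\<^sub>R dZ s v + (- (e * gform e ?Z (dZ s v) / ?g ^ 3)) *\<^sub>R ?Z) = dchart s v" for v
  proof -
    have "e * gform e ?Z (dZ s v) / ?g ^ 3 = (1 / ?g) * (gform e ?Z (dZ s v) / gform e ?Z ?Z)"
      unfolding gform_Z_Z using eps g by (auto simp: power3_eq_cube power2_eq_square field_simps)
    then have "(1 / ?g) *\<^sub>R dZ s v + (- (e * gform e ?Z (dZ s v) / ?g ^ 3)) *\<^sub>R ?Z =
      (1 / ?g) *\<^sub>R (dZ s v - (gform e ?Z (dZ s v) / gform e ?Z ?Z) *\<^sub>R ?Z)"
      by (simp add: scaleR_diff_right)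
    then show ?thesis unfolding dchart_def by (simp add: linear_scale[OF linear_inv_T])
  qed
  ultimately show ?thesis unfolding chart_def[abs_def] by simp
qed

section \<open>The Gram determinant of the chart\<close>

lemma gform_dchart:
  "gform e (dchart s u) (dchart s v) = (gform e (dZ s u) (dZ s v) - gform e (Z A B s) (dZ s u) * gform e (Z A B s) (dZ s v) / gform e (Z A B s) (Z A B s)) / (glen e (Z A B s))\<^sup>2"
proof -
  let ?N = "gform e (Z A B s) (Z A B s)"
  have N: "?N \<noteq> 0" using Z_timelike[of s] by auto
  show ?thesis
    unfolding dchart_def gform_simps gform_inv_T gform_commute[of e "dZ s u" "Z A B s"] using N
    by (simp add: power2_eq_square field_simps)
qed

text \<open>In terms of the scaled projection pole, \<open>\<alpha>\<close> is its product with
  itself and \<open>\<beta> s\<close> is its product with \<open>Z A B s\<close>.\<close>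

definition \<alpha> :: real where "\<alpha> = A m + e * B"

definition \<beta> :: "(real, 'k) vec \<Rightarrow> real" where
  "\<beta> s = A m * ((norm s)\<^sup>2 - 1) + e * B * ((norm s)\<^sup>2 + 1)"

lemma gform_scl_basis:
  "gform e (scl A B (emb u)) (scl A B (emb v)) = (\<Sum>j\<in>UNIV. A (\<iota> j) * (u $ j * v $ j))"
  "gform e (scl A B (emb u)) (scl A B pole) = 0" "gform e (scl A B pole) (scl A B (emb u)) = 0"
  "gform e (scl A B (emb u)) (scl A B copole) = 0" "gform e (scl A B copole) (scl A B (emb u)) = 0"
  "gform e (scl A B pole) (scl A B pole) = \<alpha>" "gform e (scl A B copole) (scl A B copole) = \<alpha>"
  "gform e (scl A B pole) (scl A B copole) = e * B - A m" "gform e (scl A B copole) (scl A B pole) = e * B - A m"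
proof -
  have sq: "sqrt (A i) * t * (sqrt (A i) * t') = A i * (t * t')" "sqrt (A i) * sqrt (A i) = A i" "sqrt B * sqrt B = B" for i t t'
    using A_pos[of i] B_pos by (auto simp: algebra_simps)
  show "gform e (scl A B (emb u)) (scl A B (emb v)) = (\<Sum>j\<in>UNIV. A (\<iota> j) * (u $ j * v $ j))"
    by (simp add: gform_def scl_def emb_def inner_vec_def sum_split sq)
  show "gform e (scl A B (emb u)) (scl A B pole) = 0" "gform e (scl A B pole) (scl A B (emb u)) = 0"
    "gform e (scl A B (emb u)) (scl A B copole) = 0" "gform e (scl A B copole) (scl A B (emb u)) = 0"
    "gform e (scl A B pole) (scl A B pole) = \<alpha>" "gform e (scl A B copole) (scl A B copole) = \<alpha>"
    "gform e (scl A B pole) (scl A B copole) = e * B - A m" "gform e (scl A B copole) (scl A B pole) = e * B - A m"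
    by (simp_all add: gform_def scl_def emb_def pole_def copole_def inner_vec_def sum_split axis_def sq \<alpha>_def abs_of_pos[OF B_pos] abs_of_pos[OF A_pos])
qed

lemma gform_dZ_dZ:
  "gform e (dZ s (axis i 1)) (dZ s (axis j 1)) = 4 * ((if i = j then A (\<iota> i) else 0) + \<alpha> * (s $ i * s $ j))"
proof -
  have "(\<Sum>l\<in>UNIV. A (\<iota> l) * (axis i 1 $ l * axis j 1 $ l)) = (if i = j then A (\<iota> i) else 0)"
    by (simp add: axis_def if_distrib[of "\<lambda>x. _ * x"] cong: if_cong)
  then show ?thesis
    by (simp add: dZ_def scl_simps gform_simps gform_scl_basis inner_axis algebra_simps)
qed

lemma gform_Z_dZ: "gform e (Z A B s) (dZ s (axis i 1)) = 2 * (s $ i * (2 * A (\<iota> i) + \<beta> s))"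
proof -
  have "(\<Sum>l\<in>UNIV. A (\<iota> l) * (s $ l * axis i 1 $ l)) = A (\<iota> i) * s $ i"
    by (simp add: axis_def if_distrib[of "\<lambda>x. _ * x"] cong: if_cong)
  then show ?thesis
    by (simp add: Z_def chart_vector_def dZ_def scl_simps gform_simps gform_scl_basis inner_axis)
      (simp add: \<beta>_def \<alpha>_def algebra_simps)
qed

lemma gform_Z_Z_expand:
  "gform e (Z A B s) (Z A B s) = 4 * (\<Sum>j\<in>UNIV. A (\<iota> j) * (s $ j)\<^sup>2) + A m * ((norm s)\<^sup>2 - 1)\<^sup>2 + e * B * ((norm s)\<^sup>2 + 1)\<^sup>2"
  by (simp add: Z_def chart_vector_def scl_simps gform_simps gform_scl_basis power2_eq_square[of "_ $ _"])
    (simp add: \<alpha>_def algebra_simps power2_eq_square[of "_ + _"] power2_eq_square[of "_ - _"])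

lemma conormal_norm:
  "gform e (conormal e A B (Z A B s)) (conormal e A B (Z A B s)) =
    4 * (\<Sum>j\<in>UNIV. (s $ j)\<^sup>2 / A (\<iota> j)) + ((norm s)\<^sup>2 - 1)\<^sup>2 / A m + e * ((norm s)\<^sup>2 + 1)\<^sup>2 / B"
proof -
  have Zm: "snd (Z A B s) $ m = sqrt (A m) * ((norm s)\<^sup>2 - 1)"
    by (simp add: Z_def scl_def chart_vector_def emb_def pole_def copole_def axis_def algebra_simps)
  have Zj: "snd (Z A B s) $ \<iota> j = sqrt (A (\<iota> j)) * (2 * s $ j)" for j
    by (simp add: Z_def scl_def chart_vector_def emb_def pole_def copole_def axis_def algebra_simps)
  have "gform e (conormal e A B (Z A B s)) (conormal e A B (Z A B s)) =
    (\<Sum>i\<in>UNIV. (snd (Z A B s) $ i)\<^sup>2 / (A i)\<^sup>2) + e * (fst (Z A B s))\<^sup>2 / B\<^sup>2"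
    using eps by (auto simp: gform_def conormal_def inner_vec_def power2_eq_square)
  also have "\<dots> = 4 * (\<Sum>j\<in>UNIV. (s $ j)\<^sup>2 / A (\<iota> j)) + ((norm s)\<^sup>2 - 1)\<^sup>2 / A m + e * ((norm s)\<^sup>2 + 1)\<^sup>2 / B"
  proof -
    have "(sqrt x * y)\<^sup>2 / x\<^sup>2 = y\<^sup>2 / x" if "x > 0" for x y :: real
      using that by (simp add: power_mult_distrib power2_eq_square[of x])
    from this[OF A_pos] this[OF B_pos] have h: "(sqrt (A i) * y)\<^sup>2 / (A i)\<^sup>2 = y\<^sup>2 / A i" "e * (sqrt B * y)\<^sup>2 / B\<^sup>2 = e * y\<^sup>2 / B" for i y
      by (simp_all only: times_divide_eq_right[symmetric])
    show ?thesis
      unfolding sum_split Zm Zj fst_Z h by (simp add: sum_distrib_left power_mult_distrib add.commute)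
  qed
  finally show ?thesis .
qed

lemma conormal_norm_pos:
  "gform e (conormal e A B (Z A B s)) (conormal e A B (Z A B s)) > 0"
proof (rule gform_orthogonal_pos[OF eps Z_timelike])
  show "gform e (Z A B s) (conormal e A B (Z A B s)) = 0"
    using gform_conormal_self[OF eps, of A B "Z A B s"] by (simp add: gform_commute qform_Z)
  show "conormal e A B (Z A B s) \<noteq> 0"
    using fst_Z_pos[of s] B_pos eps by (auto simp: conormal_def prod_eq_iff)
qed

text \<open>
  The Gram matrix is a diagonal matrix plus two rank-one terms. Its determinant is proportional to
  \<open>g (conormal, conormal)\<close>, which is what the homeoidal density cancels.
\<close>

lemma det_gram:
  "det (\<chi> i j. gform e (dchart s (axis i 1)) (dchart s (axis j 1))) =
    (4 / (glen e (Z A B s))\<^sup>2) ^ CARD('k) * ((\<Prod>i\<in>UNIV. A i) * B)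
      * (gform e (conormal e A B (Z A B s)) (conormal e A B (Z A B s)) / (glen e (Z A B s))\<^sup>2)"
proof -
  let ?l = "glen e (Z A B s)" and ?S = "(norm s)\<^sup>2"
  define N where "N = gform e (Z A B s) (Z A B s)"
  define d where "d = (\<chi> i. A (\<iota> i))"
  define w where "w = (\<chi> i. s $ i * (2 * A (\<iota> i) + \<beta> s))"
  define S0 where "S0 = (\<Sum>j\<in>UNIV. (s $ j)\<^sup>2 / A (\<iota> j))"
  define S2 where "S2 = (\<Sum>j\<in>UNIV. A (\<iota> j) * (s $ j)\<^sup>2)"
  have ns: "?S = (\<Sum>j\<in>UNIV. (s $ j)\<^sup>2)"
    unfolding power2_norm_eq_inner inner_vec_def by (simp add: power2_eq_square)
  have l: "?l > 0" by (rule glen_Z_pos)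
  have N_eq: "N = e * ?l\<^sup>2" unfolding N_def by (rule gform_Z_Z)
  have N0: "N \<noteq> 0" using N_eq l eps by auto
  have d: "d $ i > 0" "d $ i \<noteq> 0" for i using A_pos[of "\<iota> i"] by (auto simp: d_def)
  \<comment> \<open>For \<open>e = 1\<close> the number \<open>\<alpha> = A m + B\<close> is
    positive; for \<open>e = - 1\<close> it is negative, but then so is \<open>N\<close>.\<close>
  have sgn: "\<alpha> > 0 \<or> - 1 / N > 0"
    using eps l A_pos[of m] B_pos by (auto simp: N_eq \<alpha>_def divide_less_0_iff)
  let ?M = "\<chi> i j. (if i = j then d $ i else 0) + \<alpha> * (s $ i * s $ j) + (- 1 / N) * (w $ i * w $ j)"
  have "(\<chi> i j. gform e (dchart s (axis i 1)) (dchart s (axis j 1))) = (\<chi> i. (4 / ?l\<^sup>2) *s ?M $ i)"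
  proof -
    have "gform e (dchart s (axis i 1)) (dchart s (axis j 1)) = 4 / ?l\<^sup>2 * (?M $ i $ j)" for i j
      unfolding gform_dchart gform_dZ_dZ gform_Z_dZ N_def[symmetric]
      using N0 by (simp add: d_def w_def field_simps)
    then show ?thesis by (simp add: vec_eq_iff)
  qed
  then have "det (\<chi> i j. gform e (dchart s (axis i 1)) (dchart s (axis j 1))) = (4 / ?l\<^sup>2) ^ CARD('k) * det ?M"
    by (simp only: det_rows_mul prod_constant vec_lambda_eta)
  also have "det ?M = (\<Prod>i\<in>UNIV. d $ i) * ((1 + \<alpha> * (\<Sum>i\<in>UNIV. (s $ i)\<^sup>2 / d $ i)) * (1 + (- 1 / N) * (\<Sum>i\<in>UNIV. (w $ i)\<^sup>2 / d $ i))
        - \<alpha> * (- 1 / N) * (\<Sum>i\<in>UNIV. s $ i * w $ i / d $ i)\<^sup>2)"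
    by (rule det_diagonal_plus_rank_two[OF d(1) sgn])
  also have "(\<Sum>i\<in>UNIV. (s $ i)\<^sup>2 / d $ i) = S0" by (simp add: S0_def d_def)
  also have "(\<Sum>i\<in>UNIV. (w $ i)\<^sup>2 / d $ i) = 4 * S2 + 4 * \<beta> s * ?S + (\<beta> s)\<^sup>2 * S0"
  proof -
    have "(w $ i)\<^sup>2 / d $ i = 4 * (A (\<iota> i) * (s $ i)\<^sup>2) + 4 * \<beta> s * (s $ i)\<^sup>2 + (\<beta> s)\<^sup>2 * ((s $ i)\<^sup>2 / A (\<iota> i))" for i
      using d[of i] by (simp add: d_def w_def power2_eq_square field_simps)
    then show ?thesis
      by (simp only: sum.distrib sum_distrib_left[symmetric] S0_def S2_def ns)
  qed
  also have "(\<Sum>i\<in>UNIV. s $ i * w $ i / d $ i) = 2 * ?S + \<beta> s * S0"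
  proof -
    have "s $ i * w $ i / d $ i = 2 * (s $ i)\<^sup>2 + \<beta> s * ((s $ i)\<^sup>2 / A (\<iota> i))" for i
      using d[of i] by (simp add: d_def w_def power2_eq_square field_simps)
    then show ?thesis
      by (simp only: sum.distrib sum_distrib_left[symmetric] S0_def ns)
  qed
  also have "(1 + \<alpha> * S0) * (1 + (- 1 / N) * (4 * S2 + 4 * \<beta> s * ?S + (\<beta> s)\<^sup>2 * S0)) - \<alpha> * (- 1 / N) * (2 * ?S + \<beta> s * S0)\<^sup>2
    = ((1 + \<alpha> * S0) * (N - (4 * S2 + 4 * \<beta> s * ?S + (\<beta> s)\<^sup>2 * S0)) + \<alpha> * (2 * ?S + \<beta> s * S0)\<^sup>2) / N"
    using N0 by (simp add: field_simps)
  \<comment> \<open>The sum \<open>S2\<close> cancels against the expansion of \<open>N\<close>, and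
    the terms quadratic in \<open>S0\<close> cancel each other; the linear remainder is
    \<open>e * A m * B\<close> times the squared length of the conormal.\<close>
  also have "(1 + \<alpha> * S0) * (N - (4 * S2 + 4 * \<beta> s * ?S + (\<beta> s)\<^sup>2 * S0)) + \<alpha> * (2 * ?S + \<beta> s * S0)\<^sup>2
    = 4 * A m * (e * B) * S0 + e * B * (?S - 1)\<^sup>2 + A m * (?S + 1)\<^sup>2"
    unfolding N_def gform_Z_Z_expand S2_def[symmetric] \<alpha>_def \<beta>_def by algebra
  also have "(4 * A m * (e * B) * S0 + e * B * (?S - 1)\<^sup>2 + A m * (?S + 1)\<^sup>2) / N
    = A m * B * (gform e (conormal e A B (Z A B s)) (conormal e A B (Z A B s)) / ?l\<^sup>2)"
  proof -
    have "4 * A m * (e * B) * S0 + e * B * (?S - 1)\<^sup>2 + A m * (?S + 1)\<^sup>2 = e * (A m * B * gform e (conormal e A B (Z A B s)) (conormal e A B (Z A B s)))"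
      unfolding conormal_norm S0_def[symmetric] using A_pos[of m] B_pos eps by (auto simp: field_simps)
    then show ?thesis unfolding N_eq using eps by auto
  qed
  also have "(\<Prod>i\<in>UNIV. d $ i) * (A m * B * (gform e (conormal e A B (Z A B s)) (conormal e A B (Z A B s)) / ?l\<^sup>2))
    = (\<Prod>i\<in>UNIV. A i) * B * (gform e (conormal e A B (Z A B s)) (conormal e A B (Z A B s)) / ?l\<^sup>2)"
    by (simp add: prod_split d_def)
  finally show ?thesis by (simp only: mult.assoc)
qed

lemma bounded_linear_dchart: "bounded_linear (dchart s)"
  using chart_has_derivative by (rule has_derivative_bounded_linear)

lemma blinfun_dchart [simp]: "blinfun_apply (Blinfun (dchart s)) = dchart s"
  by (rule bounded_linear_Blinfun_apply[OF bounded_linear_dchart])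

definition chart_density :: "(real, 'k) vec \<Rightarrow> real" where
  "chart_density s = gram_density (gform e) (Blinfun (dchart s))"

lemma chart_density_eq:
  "chart_density s = 2 ^ CARD('k) * sqrt ((\<Prod>i\<in>UNIV. A i) * B)
    * sqrt (gform e (conormal e A B (Z A B s)) (conormal e A B (Z A B s))) / glen e (Z A B s) ^ (CARD('k) + 1)"
proof -
  have l: "glen e (Z A B s) > 0" by (rule glen_Z_pos)
  have sqrt_4: "sqrt ((4 / (glen e (Z A B s))\<^sup>2) ^ CARD('k)) = (2 / glen e (Z A B s)) ^ CARD('k)"
  proof -
    have "(4 / (glen e (Z A B s))\<^sup>2) = (2 / glen e (Z A B s))\<^sup>2" by (simp add: power_divide)
    then show ?thesis using l by (simp add: real_sqrt_power)
  qed
  have sqrt_prod: "sqrt (x * y * (z / l\<^sup>2)) = sqrt x * sqrt y * sqrt z / l" if "l > 0" for x y z l :: real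
    using that by (simp add: real_sqrt_mult real_sqrt_divide)
  show ?thesis
    unfolding chart_density_def gram_density_def blinfun_dchart det_gram sqrt_prod[OF l] sqrt_4
    by (simp add: power_divide)
qed

text \<open>A vector in the kernel would also be in the kernel of the Gram matrix, whose determinant
  is positive. Injectivity is the regularity that \<open>riemannian_volume\<close> demands of a
  parametrization.\<close>

lemma inj_dchart: "inj (dchart s)"
proof -
  note lin = bounded_linear.linear[OF bounded_linear_dchart[of s]]
  let ?M = "\<chi> i j. gform e (dchart s (axis i 1)) (dchart s (axis j 1))"
  have "(\<Prod>i\<in>UNIV. A i) > 0" using A_pos by (intro prod_pos) auto
  then have "det ?M > 0"
    unfolding det_gram using glen_Z_pos[of s] B_pos conormal_norm_pos[of s]
    by (intro mult_pos_pos divide_pos_pos zero_less_power) auto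
  then have "det ?M \<noteq> 0" by simp
  then have ker: "\<forall>x. ?M *v x = 0 \<longrightarrow> x = 0"
    unfolding matrix_left_invertible_ker[symmetric] invertible_det_nz[symmetric] invertible_def by blast
  show ?thesis
    unfolding linear_injective_0[OF lin]
  proof (intro allI impI)
    fix v assume v: "dchart s v = 0"
    have "(?M *v v) $ i = 0" for i
    proof -
      have "(?M *v v) $ i = gform e (dchart s (axis i 1)) (\<Sum>j\<in>UNIV. v $ j *\<^sub>R dchart s (axis j 1))"
      proof -
        have "gform e x (\<Sum>j\<in>UNIV. f j) = (\<Sum>j\<in>UNIV. gform e x (f j))" for x and f :: "'k \<Rightarrow> 'n space"
          by (rule linear_sum[of "gform e x" f UNIV]) (rule linearI, simp_all add: gform_simps)
        then show ?thesis by (simp add: matrix_vector_mult_def gform_simps mult.commute)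
      qed
      also have "(\<Sum>j\<in>UNIV. v $ j *\<^sub>R dchart s (axis j 1)) = dchart s (\<Sum>j\<in>UNIV. v $ j *\<^sub>R axis j 1)"
        by (simp add: linear_sum[OF lin] linear_scale[OF lin])
      also have "(\<Sum>j\<in>UNIV. v $ j *\<^sub>R axis j 1) = v"
        using basis_expansion[of v] by (simp add: scalar_mult_eq_scaleR)
      finally show ?thesis by (simp add: v gform_simps)
    qed
    then have "?M *v v = 0" by (simp add: vec_eq_iff)
    then show "v = 0" using ker by blast
  qed
qed

lemma continuous_on_dchart: "continuous_on UNIV (\<lambda>s. Blinfun (dchart s))"
proof (rule continuous_on_blinfun_componentwise)
  fix v :: "(real, 'k) vec"
  have "glen e (Z A B s) \<noteq> 0" "gform e (Z A B s) (Z A B s) \<noteq> 0" for s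
    using glen_Z_pos[of s] Z_timelike[of s] by auto
  then have "continuous_on UNIV (\<lambda>s. dchart s v)"
    unfolding dchart_def dZ_def
    by (intro continuous_intros bounded_linear.continuous_on[OF bounded_linear_inv_T]) auto
  then show "continuous_on UNIV (\<lambda>s. blinfun_apply (Blinfun (dchart s)) v)" by simp
qed

section \<open>The range of the chart\<close>

lemma inj_chart: "inj chart"
proof (rule injI)
  fix s s' assume "chart s = chart s'"
  then have "(1 / glen e (Z A B s)) *\<^sub>R Z A B s = (1 / glen e (Z A B s')) *\<^sub>R Z A B s'"
    unfolding chart_def by (metis T_inv)
  then have "scl A B ((1 / glen e (Z A B s)) *\<^sub>R chart_vector s) = scl A B ((1 / glen e (Z A B s')) *\<^sub>R chart_vector s')"
    by (simp add: Z_def scl_simps)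
  then have eq: "(1 / glen e (Z A B s)) *\<^sub>R chart_vector s = (1 / glen e (Z A B s')) *\<^sub>R chart_vector s'"
    using A_pos B_pos by (simp only: scl_eq_iff)
  \<comment> \<open>All chart vectors have the same product with \<open>pole\<close>, so
    proportional ones are equal.\<close>
  have "mink (chart_vector s) pole = - 2" for s
    by (simp add: chart_vector_def gform_minus_1[symmetric] gform_simps gform_basis)
  then have "1 / glen e (Z A B s) = 1 / glen e (Z A B s')"
    using arg_cong[OF eq, of "\<lambda>x. mink x pole"] by (simp add: gform_minus_1[symmetric] gform_simps)
  then have "chart_vector s = chart_vector s'"
    using eq glen_Z_pos[of s'] by simp
  then have "0 *\<^sub>R copole + emb (2 *\<^sub>R (s - s')) + ((norm s)\<^sup>2 - (norm s')\<^sup>2) *\<^sub>R pole = 0"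
    by (simp add: chart_vector_def emb_simps algebra_simps)
  then show "s = s'" unfolding coordinates_eq_0_iff by simp
qed

definition chart_pole :: "'n space" where
  "chart_pole = inv T ((1 / glen e (scl A B pole)) *\<^sub>R scl A B pole)"

lemma chart_in_ellipsoid: "chart s \<in> ellipsoid"
proof -
  have "gform e (chart s) (chart s) = (1 / glen e (Z A B s))\<^sup>2 * gform e (Z A B s) (Z A B s)"
    by (simp add: chart_def gform_inv_T gform_simps power2_eq_square)
  also have "e * \<dots> = 1"
    unfolding gform_Z_Z using eps glen_Z_pos[of s] by (auto simp: power_divide)
  finally show ?thesis
    using glen_Z_pos[of s] fst_Z_pos[of s] by (simp add: ellipsoid_def chart_def qform_scaleR qform_Z)
qed

lemma ellipsoid_eq: "ellipsoid \<subseteq> insert chart_pole (range chart)"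
proof
  fix x assume x: "x \<in> ellipsoid"
  obtain Y where Y: "T x = scl A B Y" using scl_surj[of A B "T x"] A_pos B_pos by blast
  have "mink Y Y = 0" "fst Y > 0"
    using x fst_scl_pos[OF B_pos, of A Y] qform_scl[of A B Y] A_pos B_pos by (simp_all add: ellipsoid_def Y)
  have g: "e * gform e (T x) (T x) = 1" using x by (simp add: ellipsoid_def gform_T)
  have x_eq: "x = inv T ((1 / glen e w) *\<^sub>R w)" if "T x = \<mu> *\<^sub>R w" "\<mu> > 0" for \<mu> w
  proof -
    have "\<mu>\<^sup>2 * (e * gform e w w) = 1"
      using g that(1) by (simp add: gform_simps power2_eq_square mult_ac)
    then have "sqrt (\<mu>\<^sup>2 * (e * gform e w w)) = 1" by simp
    then have "\<mu> * glen e w = 1" using that(2) by (simp add: glen_def real_sqrt_mult)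
    then have "1 / glen e w = \<mu>" using that(2) by (metis nonzero_eq_divide_eq mult_zero_right zero_neq_one)
    then show ?thesis using that(1) by (metis inv_T)
  qed
  from \<open>mink Y Y = 0\<close> \<open>fst Y > 0\<close> show "x \<in> insert chart_pole (range chart)"
  proof (rule lightlike_decomposition)
    fix \<mu> assume "\<mu> > 0" "Y = \<mu> *\<^sub>R pole"
    then have "x = chart_pole" unfolding chart_pole_def by (intro x_eq[of \<mu>]) (simp_all add: Y scl_simps)
    then show ?thesis by simp
  next
    fix \<mu> c assume "\<mu> > 0" "Y = \<mu> *\<^sub>R chart_vector c"
    then have "x = chart c" unfolding chart_def by (intro x_eq[of \<mu>]) (simp_all add: Y Z_def scl_simps)
    then show ?thesis by simp
  qed
qed

lemma chart_pole_not_in_range: "chart_pole \<notin> range chart"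
proof
  assume "chart_pole \<in> range chart"
  then obtain s where "chart_pole = chart s" by auto
  then have "(1 / glen e (scl A B pole)) *\<^sub>R scl A B pole = (1 / glen e (Z A B s)) *\<^sub>R Z A B s"
    unfolding chart_pole_def chart_def by (metis T_inv)
  then have "scl A B ((1 / glen e (scl A B pole)) *\<^sub>R pole) = scl A B ((1 / glen e (Z A B s)) *\<^sub>R chart_vector s)"
    by (simp add: Z_def scl_simps)
  then have eq: "(1 / glen e (scl A B pole)) *\<^sub>R pole = (1 / glen e (Z A B s)) *\<^sub>R chart_vector s"
    using A_pos B_pos by (simp only: scl_eq_iff)
  have "mink (chart_vector s) pole = - 2" "mink pole pole = 0"
    by (simp_all add: chart_vector_def gform_minus_1[symmetric] gform_simps gform_basis)
  then show False
    using arg_cong[OF eq, of "\<lambda>x. mink x pole"] glen_Z_pos[of s] by (simp add: gform_minus_1[symmetric] gform_simps)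
qed

end

definition reflect_axis :: "'n \<Rightarrow> 'n::finite space \<Rightarrow> 'n space" where
  "reflect_axis m x = (fst x, \<chi> i. if i = m then - (snd x $ i) else snd x $ i)"

lemma linear_reflect_axis: "linear (reflect_axis m)"
  by (rule linearI) (auto simp: reflect_axis_def prod_eq_iff vec_eq_iff)

lemma gform_reflect_axis: "gform e (reflect_axis m x) (reflect_axis m y) = gform e x y"
  by (simp add: reflect_axis_def gform_def inner_vec_def) (rule sum.cong, auto)

lemma qform_reflect_axis: "qform A B (reflect_axis m x) = qform A B x"
  by (simp add: reflect_axis_def qform_def) (rule sum.cong, auto)

context ellipsoid_chart begin

lemma chart_pole_in_ellipsoid: "chart_pole \<in> ellipsoid"
proof -
  have q: "qform A B (scl A B pole) = 0"
    using gform_basis(6)[of "- 1"] by (simp add: qform_scl A_pos B_pos gform_minus_1)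
  have f: "fst (scl A B pole) > 0" using B_pos by (simp add: scl_def)
  then have "scl A B pole \<noteq> 0" by auto
  then have t: "e * gform e (scl A B pole) (scl A B pole) > 0"
    using timelike_of_qform[OF adm, of "scl A B pole"] q by simp
  have l: "glen e (scl A B pole) > 0" by (rule glen_pos[OF t])
  have "e * gform e chart_pole chart_pole = (1 / glen e (scl A B pole))\<^sup>2 * (e * gform e (scl A B pole) (scl A B pole))"
    by (simp add: chart_pole_def gform_inv_T gform_simps power2_eq_square)
  also have "e * gform e (scl A B pole) (scl A B pole) = (glen e (scl A B pole))\<^sup>2"
    using glen_power2[of e "scl A B pole"] t by simp
  also have "(1 / glen e (scl A B pole))\<^sup>2 * (glen e (scl A B pole))\<^sup>2 = 1"
    using l by (simp add: power_divide)
  finally show ?thesis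
    using l f q by (simp add: ellipsoid_def chart_pole_def qform_scaleR)
qed

lemma range_chart: "range chart = ellipsoid - {chart_pole}"
  using chart_in_ellipsoid ellipsoid_eq chart_pole_not_in_range by blast

lemma ellipsoid_borel: "ellipsoid \<in> sets borel"
proof -
  have T: "continuous_on UNIV T"
    using bounded_linear_T by (rule linear_continuous_on)
  have sets: "closed {x. e * gform e x x = 1}" "closed {x. qform A B (T x) = 0}" "open {x. fst (T x) > 0}"
    using T by (auto intro!: closed_Collect_eq open_Collect_less continuous_intros)
  have eq: "ellipsoid = {x. e * gform e x x = 1} \<inter> {x. qform A B (T x) = 0} \<inter> {x. fst (T x) > 0}"
    by (auto simp: ellipsoid_def)
  show ?thesis
    unfolding eq by (intro sets.Int borel_closed[OF sets(1)] borel_closed[OF sets(2)] borel_open[OF sets(3)])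
qed

lemma range_chart_borel: "range chart \<in> sets borel"
  unfolding range_chart using ellipsoid_borel by auto

lemma continuous_on_chart: "continuous_on UNIV chart"
  using has_derivative_continuous[OF chart_has_derivative] by (simp add: continuous_at_imp_continuous_on)

lemma chart_measurable [measurable]: "chart \<in> borel_measurable borel"
  using continuous_on_chart by (rule borel_measurable_continuous_onI)

lemma continuous_on_conormal: "continuous_on UNIV (\<lambda>s. conormal e A B (Z A B s))"
  unfolding conormal_def divide_inverse by (intro continuous_intros)

lemma chart_density_measurable [measurable]: "chart_density \<in> borel_measurable borel"
proof -
  have "glen e (Z A B s) \<noteq> 0" for s using glen_Z_pos[of s] by simp
  then have "continuous_on UNIV (\<lambda>s. 2 ^ CARD('k) * sqrt ((\<Prod>i\<in>UNIV. A i) * B)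
    * sqrt (gform e (conormal e A B (Z A B s)) (conormal e A B (Z A B s))) / glen e (Z A B s) ^ (CARD('k) + 1))"
    by (intro continuous_intros continuous_on_conormal) auto
  then show ?thesis unfolding chart_density_eq[abs_def] by (rule borel_measurable_continuous_onI)
qed

lemma chart_density_nonneg: "0 \<le> chart_density s"
proof -
  have "0 \<le> (\<Prod>i\<in>UNIV. A i)" using A_pos by (intro prod_nonneg) (auto simp: less_imp_le)
  then show ?thesis
    unfolding chart_density_eq using glen_Z_pos[of s] conormal_norm_pos[of s] B_pos by simp
qed

section \<open>The volume as an image measure under the chart\<close>

lemma emeasure_vol_range:
  assumes vol: "riemannian_volume TYPE('k) (gform e) ellipsoid vol"
    and S: "S \<in> sets borel" "S \<subseteq> range chart"
  shows "emeasure vol S = (\<integral>\<^sup>+s. ennreal (chart_density s) * indicator S (chart s) \<partial>lborel)"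
proof -
  have "open (UNIV :: (real, 'k) vec set) \<and> inj_on chart UNIV \<and> chart ` UNIV \<subseteq> ellipsoid \<and> continuous_on UNIV (\<lambda>s. Blinfun (dchart s)) \<and>
        (\<forall>s\<in>UNIV. (chart has_derivative blinfun_apply (Blinfun (dchart s))) (at s) \<and> inj (blinfun_apply (Blinfun (dchart s)))) \<and>
        S \<in> sets borel \<and> S \<subseteq> chart ` UNIV"
    using inj_chart chart_in_ellipsoid continuous_on_dchart chart_has_derivative inj_dchart S by auto
  then have "emeasure vol S = (\<integral>\<^sup>+s\<in>UNIV. ennreal (gram_density (gform e) (Blinfun (dchart s))) * indicator S (chart s) \<partial>lborel)"
    using vol unfolding riemannian_volume_def by blast
  then show ?thesis by (simp add: chart_density_def)
qed

lemma emeasure_vol_singleton: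
  assumes vol: "riemannian_volume TYPE('k) (gform e) ellipsoid vol" and y: "y \<in> range chart"
  shows "emeasure vol {y} = 0"
proof -
  obtain c where c: "y = chart c" using y by auto
  have "emeasure vol {y} = (\<integral>\<^sup>+s. ennreal (chart_density s) * indicator {y} (chart s) \<partial>lborel)"
    by (rule emeasure_vol_range[OF vol]) (use y in auto)
  also have "\<dots> = (\<integral>\<^sup>+(s :: (real, 'k) vec). 0 \<partial>lborel)"
  proof (rule nn_integral_cong_AE)
    show "AE s in lborel. ennreal (chart_density s) * indicator {y} (chart s) = 0"
      using AE_lborel_singleton[of c]
      by eventually_elim (use inj_chart in \<open>auto simp: c indicator_def inj_def\<close>)
  qed
  finally show ?thesis by simp
qed

text \<open>After reflecting the projection axis, the chart reaches the point that it missed.\<close>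

lemma chart_reflected: "ellipsoid_chart \<iota> m e K A B (reflect_axis m \<circ> T)"
proof -
  have lin: "linear (reflect_axis m \<circ> T)"
    using linear_T linear_reflect_axis by (rule linear_compose)
  have iso: "gform e ((reflect_axis m \<circ> T) x) ((reflect_axis m \<circ> T) y) = gform e x y" for x y
    by (simp add: gform_reflect_axis gform_T)
  show ?thesis
    by unfold_locales (rule eps linear_add[OF lin] linear_scale[OF lin] iso)+
qed

lemma ellipsoid_reflected: "ellipsoid_chart.ellipsoid e A B (reflect_axis m \<circ> T) = ellipsoid"
proof -
  interpret E: ellipsoid_chart \<iota> m e K A B "reflect_axis m \<circ> T" by (rule chart_reflected)
  show ?thesis
    unfolding E.ellipsoid_def ellipsoid_def by (simp add: qform_reflect_axis) (simp add: reflect_axis_def)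
qed

lemma chart_pole_reflected: "chart_pole \<in> range (ellipsoid_chart.chart \<iota> m e A B (reflect_axis m \<circ> T))"
proof -
  interpret E: ellipsoid_chart \<iota> m e K A B "reflect_axis m \<circ> T" by (rule chart_reflected)
  have "chart_pole \<noteq> E.chart_pole"
  proof
    assume eq: "chart_pole = E.chart_pole"
    have "(reflect_axis m \<circ> T) chart_pole = (1 / glen e (scl A B pole)) *\<^sub>R scl A B pole"
      unfolding eq E.chart_pole_def by (rule E.T_inv)
    then have "reflect_axis m ((1 / glen e (scl A B pole)) *\<^sub>R scl A B pole) = (1 / glen e (scl A B pole)) *\<^sub>R scl A B pole"
      by (simp add: chart_pole_def)
    then have "snd (reflect_axis m ((1 / glen e (scl A B pole)) *\<^sub>R scl A B pole)) $ m = snd ((1 / glen e (scl A B pole)) *\<^sub>R scl A B pole) $ m" by simp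
    then have "sqrt (A m) / glen e (scl A B pole) = 0"
      by (simp add: reflect_axis_def scl_def pole_def axis_def)
    moreover have "glen e (scl A B pole) \<noteq> 0"
      using chart_pole_in_ellipsoid unfolding ellipsoid_def chart_pole_def by (auto simp: gform_inv_T gform_simps)
    ultimately show False using A_pos[of m] by simp
  qed
  then show ?thesis
    using chart_pole_in_ellipsoid E.range_chart ellipsoid_reflected by auto
qed

lemma emeasure_vol_chart_pole:
  assumes vol: "riemannian_volume TYPE('k) (gform e) ellipsoid vol"
  shows "emeasure vol {chart_pole} = 0"
proof -
  interpret E: ellipsoid_chart \<iota> m e K A B "reflect_axis m \<circ> T" by (rule chart_reflected)
  show ?thesis
    using E.emeasure_vol_singleton[of vol chart_pole] vol ellipsoid_reflected chart_pole_reflected by simp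
qed

text \<open>The measure is carried by the ellipsoid, and the chart covers it up to one point of
  volume 0; so the defining formula for this single parametrization already determines
  \<open>vol\<close>.\<close>

lemma vol_eq_distr:
  assumes vol: "riemannian_volume TYPE('k) (gform e) ellipsoid vol"
  shows "vol = distr (density lborel (\<lambda>s. ennreal (chart_density s))) borel chart"
proof (rule measure_eqI)
  have sets: "sets vol = sets borel" and null: "emeasure vol (- ellipsoid) = 0"
    using vol by (auto simp: riemannian_volume_def)
  show "sets vol = sets (distr (density lborel (\<lambda>s. ennreal (chart_density s))) borel chart)"
    by (simp add: sets)
  fix S assume "S \<in> sets vol"
  then have S: "S \<in> sets borel" by (simp add: sets)
  have "S - range chart \<subseteq> - ellipsoid \<union> {chart_pole}" using ellipsoid_eq by auto
  then have "emeasure vol (S - range chart) \<le> emeasure vol (- ellipsoid \<union> {chart_pole})"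
    using ellipsoid_borel by (intro emeasure_mono) (auto simp: sets)
  also have "\<dots> \<le> emeasure vol (- ellipsoid) + emeasure vol {chart_pole}"
    using ellipsoid_borel by (intro emeasure_subadditive) (auto simp: sets)
  finally have z: "emeasure vol (S - range chart) = 0"
    using null emeasure_vol_chart_pole[OF vol] by simp
  have "emeasure vol S = emeasure vol (S \<inter> range chart) + emeasure vol (S - range chart)"
    using S range_chart_borel by (subst plus_emeasure) (auto simp: sets intro!: arg_cong[where f="emeasure vol"])
  also have "\<dots> = (\<integral>\<^sup>+s. ennreal (chart_density s) * indicator (S \<inter> range chart) (chart s) \<partial>lborel)"
    using S range_chart_borel z by (simp add: emeasure_vol_range[OF vol])
  also have "\<dots> = (\<integral>\<^sup>+s. ennreal (chart_density s) * indicator (chart -` S) s \<partial>lborel)"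
    by (intro nn_integral_cong) (auto simp: indicator_def)
  also have "\<dots> = emeasure (distr (density lborel (\<lambda>s. ennreal (chart_density s))) borel chart) S"
  proof -
    have "chart -` S \<in> sets borel" using measurable_sets[OF chart_measurable S] by simp
    then show ?thesis using S by (subst emeasure_distr) (auto simp: emeasure_density)
  qed
  finally show "emeasure vol S = emeasure (distr (density lborel (\<lambda>s. ennreal (chart_density s))) borel chart) S" .
qed

text \<open>Stereographic projection of the vector whose scaled image is \<open>T y\<close>; being a
  quotient of linear terms, it is insensitive to the normalization. As a Borel left inverse of the
  chart it yields measurability of integrands containing \<open>\<rho>\<close>, which is controlled
  only on the ellipsoid.\<close>

definition unchart :: "'n space \<Rightarrow> (real, 'k) vec" where
  "unchart y = (\<chi> j. (snd (T y) $ \<iota> j / sqrt (A (\<iota> j))) / (fst (T y) / sqrt B - snd (T y) $ m / sqrt (A m)))"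

lemma unchart_chart: "unchart (chart s) = s"
proof -
  have l: "glen e (Z A B s) > 0" by (rule glen_Z_pos)
  have s0: "sqrt (A i) \<noteq> 0" "sqrt B \<noteq> 0" for i using A_pos[of i] B_pos by auto
  have T: "T (chart s) = (1 / glen e (Z A B s)) *\<^sub>R Z A B s" by (simp add: chart_def)
  have 1: "snd (T (chart s)) $ \<iota> j / sqrt (A (\<iota> j)) = 2 * s $ j / glen e (Z A B s)" for j
    using s0(1)[of "\<iota> j"] by (simp add: T Z_def scl_def chart_vector_def emb_def pole_def copole_def axis_def)
  have 2: "snd (T (chart s)) $ m / sqrt (A m) = ((norm s)\<^sup>2 - 1) / glen e (Z A B s)"
    using s0(1)[of m] by (simp add: T Z_def scl_def chart_vector_def emb_def pole_def copole_def axis_def)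
  have 3: "fst (T (chart s)) / sqrt B = ((norm s)\<^sup>2 + 1) / glen e (Z A B s)"
    using s0 by (simp add: T fst_Z add.commute)
  have "2 * s $ j / glen e (Z A B s) / (((norm s)\<^sup>2 + 1) / glen e (Z A B s) - ((norm s)\<^sup>2 - 1) / glen e (Z A B s)) = s $ j" for j
    using l by (simp add: diff_divide_distrib[symmetric])
  then show ?thesis unfolding unchart_def 1 2 3 by (simp add: vec_eq_iff)
qed

lemma unchart_measurable [measurable]: "unchart \<in> borel_measurable borel"
proof -
  have T: "continuous_on UNIV T" using bounded_linear_T by (rule linear_continuous_on)
  have m1: "(\<lambda>y. fst (T y)) \<in> borel_measurable borel" "(\<lambda>y. snd (T y) $ i) \<in> borel_measurable borel" for i
    using T by (auto intro!: borel_measurable_continuous_onI continuous_intros)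
  have "(\<lambda>y. unchart y \<bullet> b) \<in> borel_measurable borel" if Basis: "b \<in> Basis" for b
  proof -
    obtain j where b: "b = axis j 1" using Basis by (auto simp: Basis_vec_def)
    show ?thesis unfolding b inner_axis unchart_def vec_lambda_beta inner_real_def mult_1_right by (intro borel_measurable_divide borel_measurable_diff m1 borel_measurable_const)
  qed
  then show ?thesis by (subst borel_measurable_euclidean_space) auto
qed

section \<open>The potential of the homeoidal charge\<close>

lemma potential_in_chart:
  assumes vol: "riemannian_volume TYPE('k) (gform e) ellipsoid vol"
    and dens: "homeoidal_density (gform e) (\<lambda>x. qform A B (T x)) ellipsoid \<rho>"
  shows "\<exists>c. \<forall>x. e * gform e x x = 1 \<and> integrable lborel (charge_kernel A B (T x)) \<longrightarrow>
    set_integrable vol ellipsoid (\<lambda>y. \<rho> y * K (gform e x y)) \<and>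
    (LINT y:ellipsoid|vol. \<rho> y * K (gform e x y)) = c * (\<integral>s. charge_kernel A B (T x) s \<partial>lborel)"
proof -
  obtain c0 where c0: "\<And>y. y \<in> ellipsoid \<Longrightarrow> \<rho> y = c0 / sqrt (gform e (metric_gradient (gform e) (\<lambda>x. qform A B (T x)) y) (metric_gradient (gform e) (\<lambda>x. qform A B (T x)) y))"
    using dens unfolding homeoidal_density_def by blast
  let ?X = "\<lambda>s. gform e (conormal e A B (Z A B s)) (conormal e A B (Z A B s))"
  let ?l = "\<lambda>s. glen e (Z A B s)"
  have rho: "\<rho> (chart s) = c0 * ?l s / (2 * sqrt (?X s))" for s
  proof -
    have "conormal e A B (r *\<^sub>R z) = r *\<^sub>R conormal e A B z" for r z
      by (simp add: conormal_def prod_eq_iff vec_eq_iff)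
    then have "conormal e A B (T (chart s)) = (1 / ?l s) *\<^sub>R conormal e A B (Z A B s)" by (simp add: chart_def)
    then have "gform e (metric_gradient (gform e) (\<lambda>x. qform A B (T x)) (chart s)) (metric_gradient (gform e) (\<lambda>x. qform A B (T x)) (chart s)) = (2 / ?l s)\<^sup>2 * ?X s"
      unfolding metric_gradient_qform by (simp add: gform_simps gform_inv_T power2_eq_square)
    then show ?thesis
      using c0[OF chart_in_ellipsoid, of s] glen_Z_pos[of s] by (simp add: real_sqrt_mult)
  qed
  \<comment> \<open>The constant of \<open>chart_density_eq\<close> times that of the density; the 2
    is there because the gradient is twice the conormal.\<close>
  define c where "c = 2 ^ CARD('k) * sqrt ((\<Prod>i\<in>UNIV. A i) * B) * c0 / 2"
  show ?thesis
  proof (intro exI[of _ c] allI impI)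
    fix x assume x: "e * gform e x x = 1 \<and> integrable lborel (charge_kernel A B (T x))"
    let ?f = "\<lambda>y. \<rho> y * K (gform e x y)"
    define h where "h = (\<lambda>s. c0 * ?l s / (2 * sqrt (?X s)) * (?l s ^ CARD('k) * charge_kernel A B (T x) s))"
    have fh: "?f (chart s) = h s" for s
    proof -
      have "glen e (T x) = 1" using x by (simp add: glen_def gform_T)
      moreover have "gform e x (chart s) = gform e (T x) (Z A B s) / ?l s"
        by (simp add: gform_commute[of e x] chart_def gform_inv_T_left gform_simps gform_commute[of e "T x"])
      ultimately have "K (gform e x (chart s)) = ?l s ^ CARD('k) * charge_kernel A B (T x) s"
        using glen_Z_pos[of s] by (simp add: charge_kernel_def)
      then show ?thesis by (simp add: h_def rho)
    qed
    have nz: "?l s \<noteq> 0" "sqrt (?X s) \<noteq> 0" for s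
      using glen_Z_pos[of s] conormal_norm_pos[of s] by auto
    have h_meas: "h \<in> borel_measurable borel"
    proof -
      have "(\<lambda>s. c0 * ?l s / (2 * sqrt (?X s)) * ?l s ^ CARD('k)) \<in> borel_measurable borel"
        using nz by (intro borel_measurable_continuous_onI continuous_intros continuous_on_conormal) auto
      moreover have "charge_kernel A B (T x) \<in> borel_measurable borel"
        using borel_measurable_integrable[of lborel "charge_kernel A B (T x)"] x by simp
      ultimately show ?thesis unfolding h_def mult.assoc[symmetric] by (rule borel_measurable_times)
    qed
    have dh: "chart_density s * h s = c * charge_kernel A B (T x) s" for s
      unfolding chart_density_eq h_def c_def using nz[of s] by simp
    \<comment> \<open>The integrand splits into a part on the range of the chart, measurable because
      it factors through \<open>unchart\<close>, and its value at the missed point, which has volume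
      0.\<close>
    define F1 where "F1 = (\<lambda>y. indicator (range chart) y * h (unchart y))"
    define F2 where "F2 = (\<lambda>y. ?f chart_pole * indicator {chart_pole} y)"
    have F1_meas: "F1 \<in> borel_measurable borel"
      unfolding F1_def using range_chart_borel h_meas by measurable
    have split: "indicator ellipsoid y *\<^sub>R ?f y = F1 y + F2 y" for y
    proof (cases "y \<in> range chart")
      case True
      then obtain s where y: "y = chart s" by auto
      then have "y \<in> ellipsoid" "y \<noteq> chart_pole" using chart_in_ellipsoid chart_pole_not_in_range by (simp, blast)
      moreover have "h (unchart y) = ?f y" by (simp add: y unchart_chart fh)
      ultimately show ?thesis using True by (simp add: F1_def F2_def)
    next
      case False
      then show ?thesis
        using range_chart chart_pole_in_ellipsoid by (auto simp: F1_def F2_def indicator_def)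
    qed
    have "integrable lborel (\<lambda>s. chart_density s *\<^sub>R F1 (chart s))"
      using x by (simp add: F1_def unchart_chart dh)
    then have I1: "integrable vol F1"
      using F1_meas by (subst vol_eq_distr[OF vol], subst integrable_distr_eq)
        (auto simp: integrable_density chart_density_nonneg)
    have J1: "integral\<^sup>L vol F1 = c * (\<integral>s. charge_kernel A B (T x) s \<partial>lborel)"
    proof -
      have "integral\<^sup>L vol F1 = (\<integral>s. chart_density s *\<^sub>R F1 (chart s) \<partial>lborel)"
        using F1_meas by (subst vol_eq_distr[OF vol], subst integral_distr)
          (auto simp: integral_density chart_density_nonneg)
      then show ?thesis by (simp add: F1_def unchart_chart dh)
    qed
    have sets: "{chart_pole} \<in> sets vol" using vol by (simp add: riemannian_volume_def)
    have I2: "integrable vol F2"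
      unfolding F2_def using sets emeasure_vol_chart_pole[OF vol] by (intro integrable_mult_right integrable_real_indicator) auto
    have J2: "integral\<^sup>L vol F2 = 0"
      unfolding F2_def using sets emeasure_vol_chart_pole[OF vol] by (simp add: measure_def)
    show "set_integrable vol ellipsoid ?f \<and> (LINT y:ellipsoid|vol. ?f y) = c * (\<integral>s. charge_kernel A B (T x) s \<partial>lborel)"
      unfolding set_integrable_def set_lebesgue_integral_def split
      using I1 I2 J1 J2 by simp
  qed
qed

lemma charge_kernel_chart: "charge_kernel A B (T (chart c)) = charge_kernel A B (scl A B (chart_vector c))"
proof -
  have "T (chart c) = (1 / glen e (Z A B c)) *\<^sub>R scl A B (chart_vector c)" by (simp add: chart_def Z_def)
  then show ?thesis using glen_Z_pos[of c] by (auto simp: charge_kernel_scaleR)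
qed

lemma potential_constant_on_chart:
  "\<exists>c. \<forall>s. integrable lborel (charge_kernel A B (T (chart s))) \<and> (\<integral>t. charge_kernel A B (T (chart s)) t \<partial>lborel) = c"
proof -
  obtain c where c: "\<And>p. inside A B p \<Longrightarrow> integrable lborel (charge_kernel A B p) \<and> (\<integral>s. charge_kernel A B p s \<partial>lborel) = c"
    using inside_equipotential[OF adm] by blast
  have "inside A B (scl A B (chart_vector s + pole))" for s
    using boundary_segment_inside[of 1 s] by simp
  then have "(\<integral>t. charge_kernel A B (scl A B (chart_vector s)) t \<partial>lborel) = c" for s
    using potential_boundary(2)[of s] c unfolding \<Phi>_def by simp
  then show ?thesis
    unfolding charge_kernel_chart using potential_boundary(1) by (intro exI[of _ c]) simp
qed

lemma chart_ne_point: "\<exists>s. chart s \<noteq> y"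
proof -
  have "axis undefined 1 \<noteq> (0 :: (real, 'k) vec)" by (simp add: axis_eq_0_iff)
  then have "chart (axis undefined 1) \<noteq> chart 0" using inj_chart by (simp add: inj_eq)
  then show ?thesis by metis
qed

text \<open>The ranges of the chart and of the reflected chart are connected, overlap, and together
  cover everything. On the sphere this identifies \<open>E\<close>, given as a component, with
  \<open>ellipsoid\<close>.\<close>

lemma ellipsoid_connected: "connected ellipsoid"
proof -
  interpret E: ellipsoid_chart \<iota> m e K A B "reflect_axis m \<circ> T" by (rule chart_reflected)
  have c: "connected (range chart)" "connected (range E.chart)"
    by (auto intro!: connected_continuous_image continuous_on_chart E.continuous_on_chart)
  obtain s where s: "chart s \<noteq> E.chart_pole" using chart_ne_point by blast
  then have "chart s \<in> range chart \<inter> range E.chart"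
    using chart_in_ellipsoid E.range_chart ellipsoid_reflected by auto
  then have "connected (range chart \<union> range E.chart)"
    by (intro connected_Un c) blast
  moreover have "range chart \<union> range E.chart = ellipsoid"
    using range_chart E.range_chart ellipsoid_reflected chart_pole_reflected chart_pole_in_ellipsoid by blast
  ultimately show ?thesis by simp
qed

context
  fixes vol :: "'n space measure" and \<rho> :: "'n space \<Rightarrow> real"
  assumes vol: "riemannian_volume TYPE('k) (gform e) ellipsoid vol"
    and dens: "homeoidal_density (gform e) (\<lambda>x. qform A B (T x)) ellipsoid \<rho>"
begin

lemma potential_constant_inside:
  "\<exists>c. \<forall>x. e * gform e x x = 1 \<and> inside A B (T x) \<longrightarrow>
    set_integrable vol ellipsoid (\<lambda>y. \<rho> y * K (gform e x y)) \<and> (LINT y:ellipsoid|vol. \<rho> y * K (gform e x y)) = c"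
proof -
  obtain c where c: "\<And>p. inside A B p \<Longrightarrow> integrable lborel (charge_kernel A B p) \<and> (\<integral>s. charge_kernel A B p s \<partial>lborel) = c"
    using inside_equipotential[OF adm] by blast
  obtain d where d: "\<And>x. e * gform e x x = 1 \<and> integrable lborel (charge_kernel A B (T x)) \<Longrightarrow>
    set_integrable vol ellipsoid (\<lambda>y. \<rho> y * K (gform e x y)) \<and>
    (LINT y:ellipsoid|vol. \<rho> y * K (gform e x y)) = d * (\<integral>s. charge_kernel A B (T x) s \<partial>lborel)"
    using potential_in_chart[OF vol dens] by blast
  show ?thesis
  proof (intro exI[of _ "d * c"] allI impI)
    fix x assume x: "e * gform e x x = 1 \<and> inside A B (T x)"
    then have "integrable lborel (charge_kernel A B (T x)) \<and> (\<integral>s. charge_kernel A B (T x) s \<partial>lborel) = c"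
      using c by blast
    then show "set_integrable vol ellipsoid (\<lambda>y. \<rho> y * K (gform e x y)) \<and> (LINT y:ellipsoid|vol. \<rho> y * K (gform e x y)) = d * c"
      using d[of x] x by simp
  qed
qed

lemma potential_constant_range_chart:
  "\<exists>c. \<forall>s. set_integrable vol ellipsoid (\<lambda>y. \<rho> y * K (gform e (chart s) y)) \<and>
    (LINT y:ellipsoid|vol. \<rho> y * K (gform e (chart s) y)) = c"
proof -
  obtain c where c: "\<And>s. integrable lborel (charge_kernel A B (T (chart s))) \<and> (\<integral>t. charge_kernel A B (T (chart s)) t \<partial>lborel) = c"
    using potential_constant_on_chart by blast
  obtain d where d: "\<And>x. e * gform e x x = 1 \<and> integrable lborel (charge_kernel A B (T x)) \<Longrightarrow>
    set_integrable vol ellipsoid (\<lambda>y. \<rho> y * K (gform e x y)) \<and>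
    (LINT y:ellipsoid|vol. \<rho> y * K (gform e x y)) = d * (\<integral>s. charge_kernel A B (T x) s \<partial>lborel)"
    using potential_in_chart[OF vol dens] by blast
  have "e * gform e (chart s) (chart s) = 1" for s
    using chart_in_ellipsoid[of s] by (simp add: ellipsoid_def)
  then have "set_integrable vol ellipsoid (\<lambda>y. \<rho> y * K (gform e (chart s) y)) \<and>
    (LINT y:ellipsoid|vol. \<rho> y * K (gform e (chart s) y)) = d * c" for s
    using c[of s] d[of "chart s"] by simp
  then show ?thesis by blast
qed

end

lemma potential_constant_confocal:
  assumes vol: "riemannian_volume TYPE('k) (gform e) ellipsoid vol"
    and dens: "homeoidal_density (gform e) (\<lambda>x. qform A B (T x)) ellipsoid \<rho>"
    and adm': "admissible e (\<lambda>i. A i - l) (B + e * l)"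
  shows "\<exists>c. \<forall>x. e * gform e x x = 1 \<and> qform (\<lambda>i. A i - l) (B + e * l) (T x) = 0 \<and> fst (T x) > 0 \<longrightarrow>
    set_integrable vol ellipsoid (\<lambda>y. \<rho> y * K (gform e x y)) \<and> (LINT y:ellipsoid|vol. \<rho> y * K (gform e x y)) = c"
proof (cases "l = 0")
  case False
  obtain c where c: "\<And>p. qform (\<lambda>i. A i - l) (B + e * l) p = 0 \<and> fst p > 0 \<Longrightarrow>
      integrable lborel (charge_kernel A B p) \<and> (\<integral>s. charge_kernel A B p s \<partial>lborel) = c"
    using confocal_equipotential[OF adm adm' False] by blast
  obtain d where d: "\<And>x. e * gform e x x = 1 \<and> integrable lborel (charge_kernel A B (T x)) \<Longrightarrow>
    set_integrable vol ellipsoid (\<lambda>y. \<rho> y * K (gform e x y)) \<and>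
    (LINT y:ellipsoid|vol. \<rho> y * K (gform e x y)) = d * (\<integral>s. charge_kernel A B (T x) s \<partial>lborel)"
    using potential_in_chart[OF vol dens] by blast
  show ?thesis
  proof (intro exI[of _ "d * c"] allI impI)
    fix x assume x: "e * gform e x x = 1 \<and> qform (\<lambda>i. A i - l) (B + e * l) (T x) = 0 \<and> fst (T x) > 0"
    then have "integrable lborel (charge_kernel A B (T x)) \<and> (\<integral>s. charge_kernel A B (T x) s \<partial>lborel) = c"
      using c by blast
    then show "set_integrable vol ellipsoid (\<lambda>y. \<rho> y * K (gform e x y)) \<and> (LINT y:ellipsoid|vol. \<rho> y * K (gform e x y)) = d * c"
      using d[of x] x by simp
  qed
next
  case True
  \<comment> \<open>For \<open>l = 0\<close> the field point lies on the charged surface, so the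
    boundary value is used. The chart misses one point, which the reflected chart reaches; the two
    constants agree at a common point of both ranges.\<close>
  interpret E: ellipsoid_chart \<iota> m e K A B "reflect_axis m \<circ> T" by (rule chart_reflected)
  let ?P = "\<lambda>x c. set_integrable vol ellipsoid (\<lambda>y. \<rho> y * K (gform e x y)) \<and> (LINT y:ellipsoid|vol. \<rho> y * K (gform e x y)) = c"
  obtain c where c: "\<And>s. ?P (chart s) c"
    using potential_constant_range_chart[OF vol dens] by blast
  have dens': "homeoidal_density (gform e) (\<lambda>x. qform A B ((reflect_axis m \<circ> T) x)) E.ellipsoid \<rho>"
    using dens by (simp add: ellipsoid_reflected qform_reflect_axis)
  obtain c' where c': "\<And>s. ?P (E.chart s) c'"
    using E.potential_constant_range_chart[OF _ dens'] vol unfolding ellipsoid_reflected by blast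
  obtain s where s: "chart s \<noteq> E.chart_pole" using chart_ne_point by blast
  then have "chart s \<in> range E.chart" using chart_in_ellipsoid E.range_chart ellipsoid_reflected by auto
  then have "c = c'" using c[of s] c' by auto
  have "?P x c" if x: "x \<in> ellipsoid" for x
  proof (cases "x = chart_pole")
    case True
    then obtain s where "x = E.chart s" using chart_pole_reflected by auto
    then show ?thesis using c'[of s] \<open>c = c'\<close> by simp
  next
    case False
    then obtain s where "x = chart s" using ellipsoid_eq x by auto
    then show ?thesis using c[of s] by simp
  qed
  then show ?thesis by (intro exI[of _ c]) (simp add: True ellipsoid_def)
qed

end

section \<open>A projection axis, and the kernels of the two geometries\<close>

lemma stereographic_exists:
  assumes "CARD('n::{finite,wellorder}) = CARD('k::{finite,wellorder}) + 1"
  obtains \<iota> :: "'k::{finite,wellorder} \<Rightarrow> 'n::{finite,wellorder}" and m where "stereographic \<iota> m"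
proof -
  define m where "m = (undefined :: 'n::{finite,wellorder})"
  have "card (- {m}) = CARD('k)" using assms by (simp add: Compl_eq_Diff_UNIV card_Diff_singleton)
  then obtain \<iota> where "bij_betw \<iota> (UNIV :: 'k::{finite,wellorder} set) (- {m})"
    using finite_same_card_bij[of "UNIV :: 'k::{finite,wellorder} set" "- {m}"] by auto
  then have "stereographic \<iota> m" by unfold_locales (auto simp: bij_betw_def)
  then show ?thesis by (rule that)
qed

lemma kernel_potential_spherical:
  fixes \<iota> :: "'k::{finite,wellorder} \<Rightarrow> 'n::{finite,wellorder}"
  assumes "stereographic \<iota> m"
  shows "kernel_potential \<iota> m 1 (spherical_kernel CARD('n))"
proof -
  interpret stereographic \<iota> m by (rule assms)
  have n: "CARD('n) \<ge> 2" using card_n by (simp add: Suc_le_eq)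
  have dom: "kernel_domain 1 = {- 1<..<1}"
    by (auto simp: kernel_domain_def abs_square_less_1 abs_less_iff)
  have "\<exists>C. \<forall>\<sigma>\<in>kernel_domain 1. \<bar>spherical_kernel CARD('n) \<sigma>\<bar> \<le> C * (1 * (1 - \<sigma>\<^sup>2)) powr - ((real CARD('n) - 3/2) / 2)"
    using spherical_kernel_bound[OF n] by (simp add: dom Ball_def)
  then show ?thesis
    by unfold_locales (use spherical_kernel_has_derivative[of _ "CARD('n)"] n in \<open>auto simp: dom\<close>)
qed

lemma kernel_potential_hyperbolic:
  fixes \<iota> :: "'k::{finite,wellorder} \<Rightarrow> 'n::{finite,wellorder}"
  assumes "stereographic \<iota> m"
  shows "kernel_potential \<iota> m (- 1) (hyperbolic_kernel CARD('n))"
proof -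
  interpret stereographic \<iota> m by (rule assms)
  have n: "CARD('n) \<ge> 2" using card_n by (simp add: Suc_le_eq)
  have dom: "kernel_domain (- 1) = {..< - 1}"
  proof (intro set_eqI iffI)
    fix \<sigma> :: real
    assume "\<sigma> \<in> kernel_domain (- 1)"
    then have "1\<^sup>2 < (- \<sigma>)\<^sup>2" "- \<sigma> > 0" by (simp_all add: kernel_domain_def)
    then have "1 < - \<sigma>" by (intro power2_less_imp_less[of 1 "- \<sigma>"]) auto
    then show "\<sigma> \<in> {..< - 1}" by simp
  next
    fix \<sigma> :: real
    assume "\<sigma> \<in> {..< - 1}"
    then show "\<sigma> \<in> kernel_domain (- 1)" using one_less_power[of "- \<sigma>" 2] by (simp add: kernel_domain_def)
  qed
  show ?thesis
    by unfold_locales (use hyperbolic_kernel_has_derivative[of _ "CARD('n)"] hyperbolic_kernel_bound[OF n] n in \<open>auto simp: dom\<close>)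
qed

section \<open>The two geometries\<close>

text \<open>The region \<open>R\<close> cannot cross the hyperplane \<open>fst (T x) = 0\<close>, on
  which the form is nonnegative, and its frontier \<open>E\<close> lies strictly above that
  hyperplane; being connected, \<open>R\<close> lies above it as well.\<close>

lemma inside_region_subset:
  fixes T :: "'n::{finite,wellorder} space \<Rightarrow> 'n space"
  assumes T: "linear T" and A: "\<And>i. A i > 0" and q: "\<And>x. q x = qform A B (T x)"
    and E: "E \<noteq> {}" "\<And>y. y \<in> E \<Longrightarrow> fst (T y) > 0" and x: "x \<in> inside_region M q E"
  shows "x \<in> M" "qform A B (T x) < 0" "fst (T x) > 0"
proof -
  obtain R where R: "R \<in> components {x \<in> M. q x < 0}" "(top_of_set M) frontier_of R = E" "x \<in> R"
    using x unfolding inside_region_def by blast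
  have sub: "R \<subseteq> {x \<in> M. q x < 0}" and conn: "connected R"
    using R(1) in_components_subset in_components_connected by blast+
  then show "x \<in> M" "qform A B (T x) < 0" using R(3) q by auto
  have cont: "continuous_on S T" for S using T by (simp add: linear_continuous_on linear_conv_bounded_linear)
  obtain y where y: "y \<in> E" using E(1) by blast
  then have "y \<in> closure R"
    using R(2) closure_mono[of "M \<inter> R" R] by (auto simp: frontier_of_def closure_of_subtopology)
  moreover have "open {z. fst (T z) > 0}" by (intro open_Collect_less continuous_intros cont)
  then have "{z. fst (T z) > 0} \<inter> closure R = {} \<longleftrightarrow> {z. fst (T z) > 0} \<inter> R = {}"
    by (rule open_Int_closure_eq_empty)
  ultimately obtain z where z: "z \<in> R" "fst (T z) > 0"
    using E(2)[OF y] by blast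
  show "fst (T x) > 0"
  proof (rule ccontr)
    assume "\<not> fst (T x) > 0"
    moreover have "connected (T ` R)" by (rule connected_continuous_image[OF cont conn])
    ultimately have "\<exists>w\<in>T ` R. (1, 0) \<bullet> w = 0"
      using z R(3) by (intro connected_ivt_hyperplane[of "T ` R" "T x" "T z" "(1, 0)" 0]) (auto simp: inner_prod_def)
    then obtain w where w: "w \<in> T ` R" "(1, 0) \<bullet> w = 0" by blast
    then have "fst w = 0" by (simp add: inner_prod_def)
    then have "qform A B w \<ge> 0" using A by (auto simp: qform_def intro!: sum_nonneg divide_nonneg_pos)
    then show False using w sub q by force
  qed
qed

text \<open>At a point of \<open>U\<close> the derivative within \<open>M\<close> depends only on
  values on \<open>M \<inter> U\<close>, where the potential is constant.\<close>

lemma force_vanishes_on_constant_potential: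
  assumes g: "\<And>x. g x 0 = 0" "\<And>w. g 0 w = 0" and U: "open U"
    and c: "\<And>x. x \<in> M \<Longrightarrow> x \<in> U \<Longrightarrow> potential_exists p vol E \<rho> x \<and> potential p vol E \<rho> x = c"
    and S: "S \<subseteq> M \<inter> U"
  shows "force_vanishes_on g M p vol E \<rho> S"
  unfolding force_vanishes_on_def force_at_def
proof (intro ballI conjI)
  fix x assume x: "x \<in> S"
  then show "potential_exists p vol E \<rho> x" using c S by blast
  show "g x 0 = 0" by (rule g)
  have const: "((\<lambda>x. c) has_derivative (\<lambda>w. - g 0 w)) (at x within M \<inter> U)"
    by (simp add: g has_derivative_const)
  have xMU: "x \<in> M \<inter> U" using x S by blast
  have "(potential p vol E \<rho> has_derivative (\<lambda>w. - g 0 w)) (at x within M \<inter> U)"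
    by (rule has_derivative_transform[OF xMU _ const]) (use c in auto)
  moreover have "at x within M = at x within (M \<inter> U)"
    by (rule at_within_nhd[of _ U]) (use x S U in auto)
  ultimately show "(potential p vol E \<rho> has_derivative (\<lambda>w. - g 0 w)) (at x within M)"
    by (simp only:)
qed

lemma spherical_form_eq: "spherical_form a b l = qform (\<lambda>i. a i - l) (b + l)"
  by (simp add: spherical_form_def qform_def fun_eq_iff)

lemma hyperbolic_form_eq: "hyperbolic_form a b l = qform (\<lambda>i. a i - l) (b - l)"
  by (simp add: hyperbolic_form_def qform_def fun_eq_iff)

lemma spherical_point_potential_eq:
  "spherical_point_potential x y = spherical_kernel CARD('n) (gform 1 x y)" for x :: "'n::finite space"
  by (simp add: spherical_point_potential_def spherical_kernel_def gform_1)

lemma hyperbolic_point_potential_eq: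
  "hyperbolic_point_potential x y = hyperbolic_kernel CARD('n) (gform (- 1) x y)" for x :: "'n::finite space"
  by (simp add: hyperbolic_point_potential_def hyperbolic_kernel_def gform_minus_1)

text \<open>Replacing \<open>x\<close> by \<open>- x\<close> changes the sign of the product with
  each source point, and the spherical kernel is odd. This transfers every result to the antipodal
  sets, with the opposite constant.\<close>

lemma spherical_potential_minus:
  fixes x :: "'n::finite space"
  assumes E: "E \<subseteq> sphere 0 1" and x: "x \<in> sphere 0 1"
    and c: "potential_exists spherical_point_potential vol E \<rho> x" "potential spherical_point_potential vol E \<rho> x = c"
  shows "potential_exists spherical_point_potential vol E \<rho> (- x) \<and> potential spherical_point_potential vol E \<rho> (- x) = - c"
proof -
  have "indicator E y *\<^sub>R (\<rho> y * spherical_point_potential (- x) y) = - (indicator E y *\<^sub>R (\<rho> y * spherical_point_potential x y))" for y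
  proof (cases "y \<in> E")
    case True
    then have "norm y = 1" using E by auto
    then have "\<bar>x \<bullet> y\<bar> \<le> 1" using Cauchy_Schwarz_ineq2[of x y] x by simp
    then have "spherical_kernel CARD('n) (- (x \<bullet> y)) = - spherical_kernel CARD('n) (x \<bullet> y)"
      by (intro spherical_kernel_minus) auto
    then show ?thesis by (simp add: spherical_point_potential_eq gform_1)
  qed simp
  then show ?thesis
    using c by (simp add: potential_exists_def potential_def set_integrable_def set_lebesgue_integral_def)
qed

lemma spherical_case:
  fixes q :: "'n::{finite,wellorder} space \<Rightarrow> real"
  assumes dim: "CARD('n) = CARD('k::{finite,wellorder}) + 1"
    and a_pos: "\<And>i. a i > 0" and b_pos: "b > 0"
    and E_upper: "\<And>x. x \<in> E \<Longrightarrow> fst (T x) > 0"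
    and ell: "spherical_ellipsoid q E" and T: "orthonormal_coordinates (\<bullet>) T"
    and q: "\<And>x. q x = spherical_form a b 0 (T x)"
    and vol: "riemannian_volume TYPE('k) (\<bullet>) E vol" and dens: "homeoidal_density (\<bullet>) q E \<rho>"
  shows "force_vanishes_on (\<bullet>) (sphere 0 1) spherical_point_potential vol E \<rho> (inside_region (sphere 0 1) q E)"
    and "force_vanishes_on (\<bullet>) (sphere 0 1) spherical_point_potential vol E \<rho> (uminus ` inside_region (sphere 0 1) q E)"
    and "- b < l \<Longrightarrow> (\<And>i. l < a i) \<Longrightarrow> equipotential spherical_point_potential vol E \<rho> (spherical_confocal T a b l)"
    and "- b < l \<Longrightarrow> (\<And>i. l < a i) \<Longrightarrow> equipotential spherical_point_potential vol E \<rho> (uminus ` spherical_confocal T a b l)"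
proof -
  obtain \<iota> :: "'k \<Rightarrow> 'n" and m where st: "stereographic \<iota> m" using stereographic_exists[OF dim] by blast
  have linT: "linear T" and isoT: "\<And>x y. T x \<bullet> T y = x \<bullet> y" using T by (auto simp: orthonormal_coordinates_def)
  interpret K: kernel_potential \<iota> m 1 "spherical_kernel CARD('n)" by (rule kernel_potential_spherical[OF st])
  interpret C: ellipsoid_chart \<iota> m 1 "spherical_kernel CARD('n)" a b T
    by unfold_locales (use a_pos b_pos linT isoT in \<open>auto simp: admissible_def gform_1 linear_add linear_scale\<close>)
  have q_eq: "q = (\<lambda>x. qform a b (T x))" using q by (simp add: spherical_form_eq fun_eq_iff)
  have nsq: "x \<bullet> x = 1 \<longleftrightarrow> x \<in> sphere 0 1" for x :: "'n space"
    by (simp add: norm_eq_1)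
  have ellipsoid: "C.ellipsoid = {x \<in> sphere 0 1. q x = 0} \<inter> {x. fst (T x) > 0}"
    unfolding C.ellipsoid_def by (auto simp: gform_1 nsq q_eq)
  have comp: "E \<in> components {x \<in> sphere 0 1. q x = 0}" using ell by (simp add: spherical_ellipsoid_def)
  \<comment> \<open>By \<open>E_upper\<close> the component \<open>E\<close> lies in the upper part
    of the zero set, which is connected; maximality of components gives equality.\<close>
  have E: "E = C.ellipsoid"
  proof
    show sub: "E \<subseteq> C.ellipsoid" using in_components_subset[OF comp] E_upper by (auto simp: ellipsoid)
    have "E \<noteq> {}" by (rule in_components_nonempty[OF comp])
    then show "C.ellipsoid \<subseteq> E"
      using sub by (intro components_maximal[OF comp C.ellipsoid_connected]) (auto simp: ellipsoid)
  qed
  have E_ne: "E \<noteq> {}" by (rule in_components_nonempty[OF comp])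
  have E_sphere: "E \<subseteq> sphere 0 1" using in_components_subset[OF comp] by auto
  have vol': "riemannian_volume TYPE('k) (gform 1) C.ellipsoid vol" using vol by (simp add: gform_1 E)
  have dens': "homeoidal_density (gform 1) (\<lambda>x. qform a b (T x)) C.ellipsoid \<rho>"
    using dens by (simp add: gform_1 E q_eq)
  have pot: "set_integrable vol C.ellipsoid (\<lambda>y. \<rho> y * spherical_kernel CARD('n) (gform 1 x y)) = potential_exists spherical_point_potential vol E \<rho> x"
    "(LINT y:C.ellipsoid|vol. \<rho> y * spherical_kernel CARD('n) (gform 1 x y)) = potential spherical_point_potential vol E \<rho> x" for x
    by (simp_all add: potential_exists_def potential_def spherical_point_potential_eq E)
  let ?P = "\<lambda>x c. potential_exists spherical_point_potential vol E \<rho> x \<and> potential spherical_point_potential vol E \<rho> x = c"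
  have neg: "?P (- x) (- c)" if "?P x c" "x \<in> sphere 0 1" for x c
    using spherical_potential_minus[OF E_sphere that(2)] that(1) by blast
  let ?U = "{x. qform a b (T x) < 0} \<inter> {x. fst (T x) > 0}"
  have contT: "continuous_on S T" for S using linT by (simp add: linear_continuous_on linear_conv_bounded_linear)
  have U: "open ?U" by (intro open_Int open_Collect_less continuous_intros contT)
  obtain c where c: "\<And>x. x \<in> sphere 0 1 \<Longrightarrow> x \<in> ?U \<Longrightarrow> ?P x c"
    using C.potential_constant_inside[OF vol' dens'] unfolding pot by (auto simp: gform_1 nsq K.inside_def)
  have sub: "inside_region (sphere 0 1) q E \<subseteq> sphere 0 1 \<inter> ?U"
    using inside_region_subset[OF linT a_pos fun_cong[OF q_eq] E_ne E_upper] by blast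
  show "force_vanishes_on (\<bullet>) (sphere 0 1) spherical_point_potential vol E \<rho> (inside_region (sphere 0 1) q E)"
    by (rule force_vanishes_on_constant_potential[OF _ _ U c sub]) auto
  have U': "open (uminus ` ?U)" using U by (rule open_negations)
  have c': "?P x (- c)" if x: "x \<in> sphere 0 1" "x \<in> uminus ` ?U" for x
  proof -
    obtain y where y: "x = - y" "y \<in> ?U" using x by auto
    then show ?thesis using neg[OF c[of y]] x by auto
  qed
  show "force_vanishes_on (\<bullet>) (sphere 0 1) spherical_point_potential vol E \<rho> (uminus ` inside_region (sphere 0 1) q E)"
  proof (rule force_vanishes_on_constant_potential[OF _ _ U' c'])
    show "uminus ` inside_region (sphere 0 1) q E \<subseteq> sphere 0 1 \<inter> uminus ` ?U"
    proof (rule image_subsetI)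
      fix y assume "y \<in> inside_region (sphere 0 1) q E"
      then have "y \<in> sphere 0 1 \<inter> ?U" by (rule subsetD[OF sub])
      then have y: "norm y = 1" "y \<in> ?U" by simp_all
      have "norm (- y) = 1" using y(1) by (simp only: norm_minus_cancel)
      then have "- y \<in> sphere 0 1" by (simp only: mem_sphere_0)
      then show "- y \<in> sphere 0 1 \<inter> uminus ` ?U" using y(2) by blast
    qed
  qed auto
  {
    assume l: "- b < l" "\<And>i. l < a i"
    then have adm': "admissible 1 (\<lambda>i. a i - l) (b + 1 * l)" by (simp add: admissible_def)
    obtain d where d: "\<And>x. x \<in> spherical_confocal T a b l \<Longrightarrow> ?P x d"
      using C.potential_constant_confocal[OF vol' dens' adm'] unfolding pot
      by (auto simp: gform_1 nsq spherical_confocal_def spherical_form_eq)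
    then show "equipotential spherical_point_potential vol E \<rho> (spherical_confocal T a b l)"
      unfolding equipotential_def by blast
    have "?P x (- d)" if "x \<in> uminus ` spherical_confocal T a b l" for x
      using that neg[OF d] by (auto simp: spherical_confocal_def)
    then show "equipotential spherical_point_potential vol E \<rho> (uminus ` spherical_confocal T a b l)"
      unfolding equipotential_def by blast
  }
qed

lemma hyperbolic_case:
  fixes q :: "'n::{finite,wellorder} space \<Rightarrow> real"
  assumes dim: "CARD('n) = CARD('k::{finite,wellorder}) + 1"
    and a_pos: "\<And>i. a i > 0" and b_pos: "b > 0" and ab: "\<And>i. a i < b"
    and E_upper: "\<And>x. x \<in> E \<Longrightarrow> fst (T x) > 0"
    and ell: "hyperbolic_ellipsoid q E" and T: "orthonormal_coordinates mink T"
    and q: "\<And>x. q x = hyperbolic_form a b 0 (T x)"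
    and vol: "riemannian_volume TYPE('k) mink E vol" and dens: "homeoidal_density mink q E \<rho>"
  shows "force_vanishes_on mink hyperboloid hyperbolic_point_potential vol E \<rho> (inside_region hyperboloid q E)"
    and "(\<And>i. l < a i) \<Longrightarrow> equipotential hyperbolic_point_potential vol E \<rho> (hyperbolic_confocal T a b l)"
proof -
  obtain \<iota> :: "'k \<Rightarrow> 'n" and m where st: "stereographic \<iota> m" using stereographic_exists[OF dim] by blast
  have linT: "linear T" and isoT: "\<And>x y. mink (T x) (T y) = mink x y" using T by (auto simp: orthonormal_coordinates_def)
  interpret K: kernel_potential \<iota> m "- 1" "hyperbolic_kernel CARD('n)" by (rule kernel_potential_hyperbolic[OF st])
  interpret C: ellipsoid_chart \<iota> m "- 1" "hyperbolic_kernel CARD('n)" a b T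
    by unfold_locales (use a_pos b_pos ab linT isoT in \<open>auto simp: admissible_def gform_minus_1 linear_add linear_scale\<close>)
  have q_eq: "q = (\<lambda>x. qform a b (T x))" using q by (simp add: hyperbolic_form_eq fun_eq_iff)
  have E_def: "E = {x \<in> hyperboloid. q x = 0}" using ell by (simp add: hyperbolic_ellipsoid_def)
  have E: "E = C.ellipsoid"
  proof
    show "E \<subseteq> C.ellipsoid"
      using E_upper by (auto simp: E_def C.ellipsoid_def gform_minus_1 hyperboloid_def q_eq)
    show "C.ellipsoid \<subseteq> E"
    proof
      fix x assume x: "x \<in> C.ellipsoid"
      then have m: "mink x x = - 1" "q x = 0" "fst (T x) > 0" by (auto simp: C.ellipsoid_def gform_minus_1 q_eq)
      \<comment> \<open>\<open>C.ellipsoid\<close> only fixes the sheet of \<open>T x\<close>. If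
        \<open>x\<close> were on the lower sheet, then \<open>- x\<close> would lie in
        \<open>E\<close> and contradict \<open>E_upper\<close>.\<close>
      have "fst x > 0"
      proof (rule ccontr)
        assume "\<not> fst x > 0"
        moreover have "fst x \<noteq> 0" using m(1) by (auto simp: mink_def) (smt (verit) inner_ge_zero)
        ultimately have "- x \<in> hyperboloid" using m(1) by (simp add: hyperboloid_def mink_def)
        moreover have "q (- x) = 0" using m(2) by (simp add: q_eq linear_neg[OF linT] qform_def)
        ultimately have "fst (T (- x)) > 0" using E_upper by (simp add: E_def)
        then show False using m(3) by (simp add: linear_neg[OF linT])
      qed
      then show "x \<in> E" using m by (simp add: E_def hyperboloid_def)
    qed
  qed
  have y0: "C.chart 0 \<in> E" using C.chart_in_ellipsoid E by simp
  then have E_ne: "E \<noteq> {}" by blast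
  \<comment> \<open>The isometry \<open>T\<close> preserves the sheets: points of one sheet have
    negative product, points of different sheets positive product, and one point of \<open>E\<close>
    is known to be mapped to the upper sheet.\<close>
  have upper: "fst (T x) > 0" if x: "x \<in> hyperboloid" for x
  proof (rule ccontr)
    let ?y = "C.chart 0"
    assume n: "\<not> fst (T x) > 0"
    have y: "mink ?y ?y = - 1" "fst ?y > 0" "fst (T ?y) > 0" using y0 E_upper by (auto simp: E_def hyperboloid_def)
    have xx: "mink x x = - 1" "fst x > 0" using x by (auto simp: hyperboloid_def)
    have "mink (T x) (T x) = - 1" using xx by (simp add: isoT)
    then have "fst (T x) \<noteq> 0" by (auto simp: mink_def) (smt (verit) inner_ge_zero)
    then have "fst (- T x) > 0" using n by simp
    moreover have "- gform (- 1) (- T x) (- T x) > 0" by (simp add: gform_simps) (simp add: gform_minus_1 isoT xx)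
    moreover have "- gform (- 1) (T ?y) (T ?y) > 0" by (simp add: gform_minus_1 isoT y)
    ultimately have "gform (- 1) (- T x) (T ?y) < 0"
      using y(3) by (intro timelike_pair_negative)
    moreover have "gform (- 1) x ?y < 0"
      using y xx by (intro timelike_pair_negative) (auto simp: gform_minus_1)
    ultimately show False by (simp only: gform_simps) (simp add: gform_minus_1 isoT)
  qed
  have vol': "riemannian_volume TYPE('k) (gform (- 1)) C.ellipsoid vol" using vol by (simp add: gform_minus_1 E)
  have dens': "homeoidal_density (gform (- 1)) (\<lambda>x. qform a b (T x)) C.ellipsoid \<rho>"
    using dens by (simp add: gform_minus_1 E q_eq)
  have pot: "set_integrable vol C.ellipsoid (\<lambda>y. \<rho> y * hyperbolic_kernel CARD('n) (gform (- 1) x y)) = potential_exists hyperbolic_point_potential vol E \<rho> x"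
    "(LINT y:C.ellipsoid|vol. \<rho> y * hyperbolic_kernel CARD('n) (gform (- 1) x y)) = potential hyperbolic_point_potential vol E \<rho> x" for x
    by (simp_all add: potential_exists_def potential_def hyperbolic_point_potential_eq E)
  let ?P = "\<lambda>x c. potential_exists hyperbolic_point_potential vol E \<rho> x \<and> potential hyperbolic_point_potential vol E \<rho> x = c"
  let ?U = "{x. qform a b (T x) < 0} \<inter> {x. fst (T x) > 0}"
  have contT: "continuous_on S T" for S using linT by (simp add: linear_continuous_on linear_conv_bounded_linear)
  have U: "open ?U" by (intro open_Int open_Collect_less continuous_intros contT)
  obtain c where c: "\<And>x. x \<in> hyperboloid \<Longrightarrow> x \<in> ?U \<Longrightarrow> ?P x c"
    using C.potential_constant_inside[OF vol' dens'] unfolding pot by (auto simp: gform_minus_1 hyperboloid_def K.inside_def)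
  have sub: "inside_region hyperboloid q E \<subseteq> hyperboloid \<inter> ?U"
    using inside_region_subset[OF linT a_pos fun_cong[OF q_eq] E_ne E_upper] by blast
  show "force_vanishes_on mink hyperboloid hyperbolic_point_potential vol E \<rho> (inside_region hyperboloid q E)"
    by (rule force_vanishes_on_constant_potential[OF _ _ U c sub]) (auto simp: mink_def)
  assume l: "\<And>i. l < a i"
  have "l < b" using l[of undefined] ab[of undefined] by linarith
  then have adm': "admissible (- 1) (\<lambda>i. a i - l) (b + - 1 * l)" using l ab by (simp add: admissible_def)
  obtain d where d: "\<And>x. x \<in> hyperbolic_confocal T a b l \<Longrightarrow> ?P x d"
    using C.potential_constant_confocal[OF vol' dens' adm'] upper unfolding pot
    by (auto simp: gform_minus_1 hyperboloid_def hyperbolic_confocal_def hyperbolic_form_eq)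
  then show "equipotential hyperbolic_point_potential vol E \<rho> (hyperbolic_confocal T a b l)"
    unfolding equipotential_def by blast
qed

theorem theorem13:
  fixes q :: "'n::{finite,wellorder} space \<Rightarrow> real"
    and E :: "'n space set"
    and T :: "'n space \<Rightarrow> 'n space"
    and a :: "'n \<Rightarrow> real"
    and b :: real
    and vol :: "'n space measure"
    and \<rho> :: "'n space \<Rightarrow> real"
  assumes dim: "CARD('n) = CARD('k::{finite,wellorder}) + 1"
    and a_pos: "\<And>i. a i > 0"
    and a_decreasing: "\<And>i j. i < j \<Longrightarrow> a j < a i"
    and b_pos: "b > 0"
    and E_upper: "\<And>x. x \<in> E \<Longrightarrow> fst (T x) > 0"
  shows
    "(spherical_ellipsoid q E \<and>
      orthonormal_coordinates (\<bullet>) T \<and>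
      (\<forall>x. q x = spherical_form a b 0 (T x)) \<and>
      riemannian_volume TYPE('k) (\<bullet>) E vol \<and>
      homeoidal_density (\<bullet>) q E \<rho>
      \<longrightarrow>
      force_vanishes_on (\<bullet>) (sphere 0 1) spherical_point_potential vol E \<rho>
        (inside_region (sphere 0 1) q E) \<and>
      force_vanishes_on (\<bullet>) (sphere 0 1) spherical_point_potential vol E \<rho>
        (uminus ` inside_region (sphere 0 1) q E) \<and>
      (\<forall>l. - b < l \<and> (\<forall>i. l < a i) \<longrightarrow>
        equipotential spherical_point_potential vol E \<rho> (spherical_confocal T a b l) \<and>
        equipotential spherical_point_potential vol E \<rho> (uminus ` spherical_confocal T a b l)))
     \<and>
     (hyperbolic_ellipsoid q E \<and>
      orthonormal_coordinates mink T \<and>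
      (\<forall>i. a i < b) \<and>
      (\<forall>x. q x = hyperbolic_form a b 0 (T x)) \<and>
      riemannian_volume TYPE('k) mink E vol \<and>
      homeoidal_density mink q E \<rho>
      \<longrightarrow>
      force_vanishes_on mink hyperboloid hyperbolic_point_potential vol E \<rho>
        (inside_region hyperboloid q E) \<and>
      (\<forall>l. (\<forall>i. l < a i) \<longrightarrow>
        equipotential hyperbolic_point_potential vol E \<rho> (hyperbolic_confocal T a b l)))"
proof (intro conjI impI)
  assume h: "spherical_ellipsoid q E \<and> orthonormal_coordinates (\<bullet>) T \<and> (\<forall>x. q x = spherical_form a b 0 (T x)) \<and>
    riemannian_volume TYPE('k) (\<bullet>) E vol \<and> homeoidal_density (\<bullet>) q E \<rho>"
  note spherical = spherical_case[OF dim a_pos b_pos E_upper h[THEN conjunct1] h[THEN conjunct2, THEN conjunct1]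
      h[THEN conjunct2, THEN conjunct2, THEN conjunct1, rule_format] h[THEN conjunct2, THEN conjunct2, THEN conjunct2, THEN conjunct1]
      h[THEN conjunct2, THEN conjunct2, THEN conjunct2, THEN conjunct2]]
  show "force_vanishes_on (\<bullet>) (sphere 0 1) spherical_point_potential vol E \<rho> (inside_region (sphere 0 1) q E)"
    by (rule spherical)
  show "force_vanishes_on (\<bullet>) (sphere 0 1) spherical_point_potential vol E \<rho> (uminus ` inside_region (sphere 0 1) q E)"
    by (rule spherical)
  show "\<forall>l. - b < l \<and> (\<forall>i. l < a i) \<longrightarrow>
      equipotential spherical_point_potential vol E \<rho> (spherical_confocal T a b l) \<and>
      equipotential spherical_point_potential vol E \<rho> (uminus ` spherical_confocal T a b l)"
    using spherical(3,4) by blast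
next
  assume h: "hyperbolic_ellipsoid q E \<and> orthonormal_coordinates mink T \<and> (\<forall>i. a i < b) \<and>
    (\<forall>x. q x = hyperbolic_form a b 0 (T x)) \<and> riemannian_volume TYPE('k) mink E vol \<and> homeoidal_density mink q E \<rho>"
  note hyperbolic = hyperbolic_case[OF dim a_pos b_pos h[THEN conjunct2, THEN conjunct2, THEN conjunct1, rule_format] E_upper
      h[THEN conjunct1] h[THEN conjunct2, THEN conjunct1]
      h[THEN conjunct2, THEN conjunct2, THEN conjunct2, THEN conjunct1, rule_format]
      h[THEN conjunct2, THEN conjunct2, THEN conjunct2, THEN conjunct2, THEN conjunct1]
      h[THEN conjunct2, THEN conjunct2, THEN conjunct2, THEN conjunct2, THEN conjunct2]]
  show "force_vanishes_on mink hyperboloid hyperbolic_point_potential vol E \<rho> (inside_region hyperboloid q E)"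
    by (rule hyperbolic)
  show "\<forall>l. (\<forall>i. l < a i) \<longrightarrow> equipotential hyperbolic_point_potential vol E \<rho> (hyperbolic_confocal T a b l)"
    using hyperbolic(2) by blast
qed

end
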